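(* Let $G$ be a finite group and let $Q$ be a primary subgroup of $G$ (i.e. a subgroup of prime power order). Then $Q$ is submodular in $G$ if and only if $Q$ is $\mathrm{K}\mathfrak{U}_1$-subnormal in $G$.
   Context: All groups are finite. A formation is a class $\mathfrak{F}$ of groups (closed under isomorphism) that is closed under quotients and such that $G/N_1, G/N_2\in\mathfrak{F}$ with $N_1,N_2\lhd G$ implies $G/(N_1\cap N_2)\in\mathfrak{F}$. The $\mathfrak{F}$-residual $G^{\mathfrak{F}}$ of a group $G$ is the intersection of all normal subgroups $N$ of $G$ with $G/N\in\mathfrak{F}$. A subgroup $H$ of $G$ is $\mathrm{K}\mathfrak{F}$-subnormal in $G$ if there is a chain of subgroups $H=H_0\le H_1\le\dots\le H_n=G$ such that for every $i$ either $H_i$ is normal in $H_{i+1}$ or $H_{i+1}^{\mathfrak{F}}\le H_i$. $\mathfrak{U}_1$ denotes the class of all supersolvable groups of square-free exponent (it is a formation). A subgroup $M$ of $G$ is modular in $G$ if it is a modular element of the lattice of subgroups of $G$, i.e. $\langle X, M\cap Z\rangle=\langle X,M\rangle\cap Z$ for all subgroups $X\le Z$ of $G$, and $\langle M, Y\cap Z\rangle=\langle M,Y\rangle\cap Z$ for all subgroups $Y,Z$ of $G$ with $M\le Z$. A subgroup $H$ of $G$ is submodular in $G$ if there is a chain of subgroups $H=H_0\le H_1\le\dots\le H_n=G$ such that $H_i$ is a modular subgroup of $H_{i+1}$ for every $i$. *)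

theory Defs
  imports
    "HOL-Algebra.Elementary_Groups"
    "HOL-Algebra.Generated_Groups"
    "HOL-Computational_Algebra.Squarefree"
begin

text \<open>
  A subgroup \<open>H\<close> of \<open>G\<close>, regarded as a group in its own right, is \<open>G\<lparr>carrier := H\<rparr>\<close>.
\<close>

definition supersolvable :: "('a, 'b) monoid_scheme \<Rightarrow> bool" where
  "supersolvable G \<longleftrightarrow>
     (\<exists>(n::nat) N. N 0 = {\<one>\<^bsub>G\<^esub>} \<and> N n = carrier G \<and>
        (\<forall>i\<le>n. N i \<lhd> G) \<and>
        (\<forall>i<n. N i \<subseteq> N (Suc i) \<and>
               cyclic_group ((G\<lparr>carrier := N (Suc i)\<rparr>) Mod N i)))"

text \<open>Only meaningful for groups of finite exponent, in particular for finite groups.\<close>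
definition group_exponent :: "('a, 'b) monoid_scheme \<Rightarrow> nat" where
  "group_exponent G = (LEAST n::nat. 0 < n \<and> (\<forall>x\<in>carrier G. x [^]\<^bsub>G\<^esub> n = \<one>\<^bsub>G\<^esub>))"

definition U1 :: "('a, 'b) monoid_scheme \<Rightarrow> bool" where
  "U1 G \<longleftrightarrow> group G \<and> finite (carrier G) \<and> supersolvable G \<and> squarefree (group_exponent G)"

text \<open>
  A class \<open>F\<close> of groups enters the residual of \<open>G\<close> only through the quotients of \<open>G\<close> and of its
  subgroups, all of which have type \<^typ>\<open>'a set monoid\<close> when \<open>G\<close> has elements of type \<^typ>\<open>'a\<close>.
  The intersection is over a nonempty family as soon as \<open>F\<close> contains the trivial group
  \<open>G Mod carrier G\<close>.
\<close>
definition residual :: "('a set monoid \<Rightarrow> bool) \<Rightarrow> ('a, 'b) monoid_scheme \<Rightarrow> 'a set" where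
  "residual F G = \<Inter>{N. N \<lhd> G \<and> F (G Mod N)}"

definition KF_subnormal ::
  "('a set monoid \<Rightarrow> bool) \<Rightarrow> 'a set \<Rightarrow> ('a, 'b) monoid_scheme \<Rightarrow> bool" where
  "KF_subnormal F H G \<longleftrightarrow>
     (\<exists>(n::nat) C. C 0 = H \<and> C n = carrier G \<and>
        (\<forall>i\<le>n. subgroup (C i) G) \<and>
        (\<forall>i<n. C i \<subseteq> C (Suc i) \<and>
               (C i \<lhd> G\<lparr>carrier := C (Suc i)\<rparr> \<or>
                residual F (G\<lparr>carrier := C (Suc i)\<rparr>) \<subseteq> C i)))"

definition modular_subgroup :: "'a set \<Rightarrow> ('a, 'b) monoid_scheme \<Rightarrow> bool" where
  "modular_subgroup M G \<longleftrightarrow> subgroup M G \<and>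
     (\<forall>X Z. subgroup X G \<longrightarrow> subgroup Z G \<longrightarrow> X \<subseteq> Z \<longrightarrow>
        generate G (X \<union> (M \<inter> Z)) = generate G (X \<union> M) \<inter> Z) \<and>
     (\<forall>Y Z. subgroup Y G \<longrightarrow> subgroup Z G \<longrightarrow> M \<subseteq> Z \<longrightarrow>
        generate G (M \<union> (Y \<inter> Z)) = generate G (M \<union> Y) \<inter> Z)"

definition submodular_subgroup :: "'a set \<Rightarrow> ('a, 'b) monoid_scheme \<Rightarrow> bool" where
  "submodular_subgroup H G \<longleftrightarrow>
     (\<exists>(n::nat) C. C 0 = H \<and> C n = carrier G \<and>
        (\<forall>i\<le>n. subgroup (C i) G) \<and>
        (\<forall>i<n. C i \<subseteq> C (Suc i) \<and> modular_subgroup (C i) (G\<lparr>carrier := C (Suc i)\<rparr>)))"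

end

theory Submission
  imports
    Defs
    "HOL-Algebra.Group_Action"
    "HOL-Algebra.Sylow"
    "HOL-Number_Theory.Residues"
begin

text \<open>
  Each kind of step has to be replaced by a chain of steps of the other kind.

  \<^bold>\<open>Modular steps.\<close> Let \<open>M < G\<close> be modular and let \<open>W\<close> be maximal among the proper modular
  subgroups above \<open>M\<close>. If \<open>W\<close> is not normal, let \<open>x\<close> be an element of least order that does not
  normalize \<open>W\<close>. Conjugates and joins of modular subgroups are modular, so \<open>G\<close> is the join of \<open>W\<close> and
  its conjugate by \<open>x\<close>, hence of \<open>W\<close> and \<open>x\<close>. The modular laws then show that \<open>V = N\<^sub>G(W)\<close> has
  \<^emph>\<open>maximal traces\<close>: \<open>Z \<inter> V\<close> is equal to \<open>Z\<close> or maximal in \<open>Z\<close>, for every subgroup \<open>Z\<close> of \<open>G\<close>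
  (\<open>modular_proper_trace_overgroup\<close>). If \<open>V\<close> is not normal and \<open>K\<close> is its core, then \<open>G/K\<close> lies in
  \<open>U1\<close> (\<open>core_free_trace_U1\<close>), so \<open>V\<close> contains the residual. In every case one of \<open>W\<close> and \<open>V\<close> is a proper
  subgroup above \<open>M\<close> from which there is an admissible step to \<open>G\<close>. As \<open>M\<close> is modular in that subgroup,
  induction applies.

  The structure of \<open>G/K\<close> rests on \<open>torsion_subgroup\<close>. Consider a conjugation-invariant family of
  subgroups with maximal traces and trivial intersection. All its properties pass to subgroups \<open>H\<close>, which
  makes induction possible without forming quotients. It forces \<open>x\<^sup>r = 1\<close> whenever the order of \<open>x\<close> divides
  \<open>r\<^sup>2\<close> for a prime \<open>r\<close>, and every subgroup of prime exponent is abelian. The claim is that for the largest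
  prime \<open>p\<close> dividing \<open>|H|\<close> the elements with \<open>x\<^sup>p = 1\<close> form a subgroup, the normal Sylow \<open>p\<close>-subgroup. A
  nontrivial proper normal subgroup of \<open>H\<close> provides a normal elementary abelian subgroup, and the claim follows
  from proper subgroups of \<open>H\<close>. If \<open>H\<close> is simple and \<open>M \<noteq> 1\<close> is a proper trace on \<open>H\<close>, then induction applied to
  \<open>M\<close> gives \<open>M = P T\<close> with \<open>P\<close> normal in \<open>M\<close> and of prime order, and \<open>T\<close> the intersection of \<open>M\<close> with another
  conjugate, acting faithfully on \<open>P\<close>. The case \<open>T = 1\<close> is excluded by counting conjugates (\<open>T_nontrivial\<close>), the
  case \<open>T \<noteq> 1\<close> by looking at \<open>S = N\<^sub>H(T)\<close>, which turns out to be self-normalizing and to have order \<open>|T|\<close>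
  times a prime (\<open>simple_case_impossible\<close>). Once the normal Sylow subgroup is known, a core-free nonnormal \<open>M\<close>
  with maximal traces has prime order and a normal complement of prime order.

  \<^bold>\<open>Residual steps.\<close> Let \<open>R\<close> be the residual of \<open>G\<close>, let \<open>R \<le> H\<close>, and let the \<open>p\<close>-group \<open>Q\<close> be submodular
  in \<open>H\<close>. Restricting the chain shows that \<open>Q\<close> is submodular in \<open>R Q\<close>. There is a tower of normal subgroups of
  \<open>G\<close> from \<open>R\<close> to \<open>G\<close> with factors of prime order, and for consecutive members \<open>K < L\<close> the subgroup \<open>K Q\<close> is
  modular in \<open>L Q\<close> (\<open>p_subgroup_step_modular\<close>): the group \<open>K Q\<close> acts on \<open>L/K\<close>, whose automorphism
  group is cyclic, and \<open>p\<close>-th powers of \<open>Q\<close> lie in \<open>K\<close>, so the kernel \<open>C\<close> of the action has index \<open>1\<close> or \<open>p\<close>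
  in \<open>K Q\<close>; thus the order of \<open>L Q / C\<close> has at most two prime factors, and its maximal subgroups are modular.
  This is where \<open>Q\<close> has to be a \<open>p\<close>-group: a Frobenius group of order \<open>42\<close> lies in
  \<open>U1\<close>, but its complements of order \<open>6\<close> are not submodular.
\<close>

section \<open>Congruences modulo a prime\<close>

lemma cong_one_of_coprime_powers:
  fixes i m n q :: nat
  assumes m: "[i ^ m = 1] (mod q)" and n: "[i ^ n = 1] (mod q)" and cop: "coprime m n"
  shows "[i = 1] (mod q)"
proof -
  obtain x where "[m * x = 1] (mod n)" using cong_solve_coprime_nat[OF cop] by auto
  then obtain k l where kl: "1 + k * n = m * x + l * n" by (metis cong_iff_lin_nat)
  have e: "[i ^ (k * n) = 1] (mod q)" for k
    using cong_pow[OF n, of k] by (simp add: power_mult[symmetric] mult.commute)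
  have "[i * 1 = i * i ^ (k * n)] (mod q)" by (intro cong_mult cong_refl cong_sym[OF e])
  also have "i * i ^ (k * n) = i ^ (m * x) * i ^ (l * n)"
    by (metis kl power_Suc power_add plus_1_eq_Suc)
  also have "[\<dots> = 1 * 1] (mod q)"
    using cong_pow[OF m, of x] by (intro cong_mult e) (simp add: power_mult)
  finally show ?thesis by simp
qed

text \<open>
  By Fermat, the order of \<open>i\<close> divides both \<open>n\<close> and \<open>q - 1\<close>. In the form
  of group actions: an element whose \<open>n\<close>-th power acts trivially on a group of order
  \<open>q\<close> itself acts trivially.
\<close>
lemma cong_one_of_pow_cong_one:
  fixes i n q :: nat
  assumes q: "prime q" and n: "[i ^ n = 1] (mod q)" "n > 0" and cop: "coprime n (q - 1)"
  shows "[i = 1] (mod q)"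
proof -
  have "coprime (i ^ n) q"
    using n(1) by (metis cong_imp_coprime cong_sym coprime_1_left)
  then have "\<not> q dvd i"
    using n(2) q coprime_common_divisor[of "i ^ n" q q] by (metis dvd_refl dvd_power dvd_trans not_prime_unit)
  then have "[i ^ (q - 1) = 1] (mod q)" using fermat_theorem q by blast
  then show ?thesis using cong_one_of_coprime_powers[OF n(1) _ cop] by blast
qed

text \<open>
  The polynomial \<open>X\<^sup>p - 1\<close> has at most \<open>p\<close> roots modulo \<open>q\<close>, and
  the powers of \<open>i\<close> already provide \<open>p\<close> of them.
\<close>
lemma prime_roots_of_unity_cyclic:
  fixes i j p q :: nat
  assumes q: "prime q" and p: "prime p" and i: "[i ^ p = 1] (mod q)" "\<not> [i = 1] (mod q)"
    and j: "[j ^ p = 1] (mod q)"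
  shows "\<exists>n. [j = i ^ n] (mod q)"
proof -
  let ?Z = "{x \<in> {..<q}. [x ^ p = 1] (mod q)}" and ?f = "\<lambda>n. i ^ n mod q"
  have p0: "p > 0" and q0: "q > 0" using prime_gt_0_nat p q by auto
  have ci: "coprime i q"
  proof -
    have "coprime (i ^ p) q" using i(1) by (metis cong_imp_coprime cong_sym coprime_1_left)
    then show ?thesis using p0 by simp
  qed
  have inj: "m = n" if "m \<le> n" "n < p" "?f m = ?f n" for m n
  proof (rule ccontr)
    assume "m \<noteq> n"
    then have d: "0 < n - m" "n - m < p" using that by auto
    have "[i ^ m * 1 = i ^ m * i ^ (n - m)] (mod q)"
      using that by (simp add: cong_def power_add[symmetric])
    then have e: "[i ^ (n - m) = 1] (mod q)"
      using ci cong_mult_lcancel_nat[of "i ^ m" q 1 "i ^ (n - m)"] by (simp add: cong_sym_eq)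
    have "coprime p (n - m)" using p d by (intro prime_imp_coprime) (auto dest!: dvd_imp_le)
    then show False using cong_one_of_coprime_powers[OF i(1) e] i(2) d by simp
  qed
  have "inj_on ?f {..<p}"
  proof (rule inj_onI)
    fix m n assume "m \<in> {..<p}" "n \<in> {..<p}" "?f m = ?f n"
    then show "m = n" using inj[of m n] inj[of n m] by (metis lessThan_iff nat_le_linear)
  qed
  then have card: "card (?f ` {..<p}) = p" by (simp add: card_image)
  have sub: "?f ` {..<p} \<subseteq> ?Z"
  proof
    fix x assume "x \<in> ?f ` {..<p}"
    then obtain n where n: "x = i ^ n mod q" by blast
    have "[x ^ p = (i ^ n) ^ p] (mod q)" unfolding n by (intro cong_pow) (simp add: cong_def)
    also have "(i ^ n) ^ p = (i ^ p) ^ n" by (simp add: power_mult[symmetric] mult.commute)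
    also have "[(i ^ p) ^ n = 1] (mod q)" using cong_pow[OF i(1), of n] by simp
    finally show "x \<in> ?Z" using n q0 by simp
  qed
  have "card ?Z \<le> p" using roots_mod_prime_bound[OF q p0, of 1] by simp
  then have "?f ` {..<p} = ?Z" using card by (intro card_seteq sub) auto
  moreover have "[(j mod q) ^ p = j ^ p] (mod q)" by (intro cong_pow) (simp add: cong_def)
  then have "j mod q \<in> ?Z" using cong_trans[OF _ j] q0 by simp
  ultimately obtain n where "j mod q = i ^ n mod q" by blast
  then show ?thesis unfolding cong_def by blast
qed

lemma obtain_largest_prime_divisor:
  fixes n :: nat
  assumes "n > 0" "n \<noteq> 1"
  obtains p where "prime p" "p dvd n" "\<And>r. \<lbrakk>prime r; r dvd n\<rbrakk> \<Longrightarrow> r \<le> p"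
proof -
  have "prime_factors n \<noteq> {}" using prime_factor_nat[OF assms(2)] assms(1) by (auto simp: prime_factors_dvd)
  then have "Max (prime_factors n) \<in> prime_factors n" by (intro Max_in) auto
  moreover have "r \<le> Max (prime_factors n)" if "prime r" "r dvd n" for r
    using that assms(1) by (auto simp: prime_factors_dvd intro!: Max_ge)
  ultimately show thesis using that by (auto simp: prime_factors_dvd)
qed

section \<open>Conjugation and products of subgroups\<close>

lemma set_multE:
  assumes "x \<in> A <#>\<^bsub>G\<^esub> B"
  obtains a b where "a \<in> A" "b \<in> B" "x = a \<otimes>\<^bsub>G\<^esub> b"
  using assms unfolding set_mult_def by blast

lemma set_multI: "\<lbrakk>a \<in> A; b \<in> B\<rbrakk> \<Longrightarrow> a \<otimes>\<^bsub>G\<^esub> b \<in> A <#>\<^bsub>G\<^esub> B"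
  unfolding set_mult_def by blast

context group
begin

definition conj_by :: "'a \<Rightarrow> 'a \<Rightarrow> 'a" where
  "conj_by g x = g \<otimes> x \<otimes> inv g"

lemma conj_by_closed [simp, intro]:
  "\<lbrakk>g \<in> carrier G; x \<in> carrier G\<rbrakk> \<Longrightarrow> conj_by g x \<in> carrier G"
  by (simp add: conj_by_def)

lemma conj_by_one_left [simp]: "x \<in> carrier G \<Longrightarrow> conj_by \<one> x = x"
  by (simp add: conj_by_def)

lemma conj_by_one_right [simp]: "g \<in> carrier G \<Longrightarrow> conj_by g \<one> = \<one>"
  by (simp add: conj_by_def)

lemma conj_by_mult:
  "\<lbrakk>g \<in> carrier G; x \<in> carrier G; y \<in> carrier G\<rbrakk> \<Longrightarrow> conj_by g (x \<otimes> y) = conj_by g x \<otimes> conj_by g y"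
  by (simp add: conj_by_def m_assoc inv_solve_left)

lemma conj_by_comp:
  "\<lbrakk>g \<in> carrier G; h \<in> carrier G; x \<in> carrier G\<rbrakk> \<Longrightarrow> conj_by g (conj_by h x) = conj_by (g \<otimes> h) x"
  by (simp add: conj_by_def m_assoc inv_mult_group)

lemma conj_by_inv_cancel [simp]:
  "\<lbrakk>g \<in> carrier G; x \<in> carrier G\<rbrakk> \<Longrightarrow> conj_by (inv g) (conj_by g x) = x"
  "\<lbrakk>g \<in> carrier G; x \<in> carrier G\<rbrakk> \<Longrightarrow> conj_by g (conj_by (inv g) x) = x"
  by (simp_all add: conj_by_comp)

lemma conj_by_hom: "g \<in> carrier G \<Longrightarrow> group_hom G G (conj_by g)"
  by (rule group_hom.intro[OF is_group is_group]) 
     (auto intro!: group_hom_axioms.intro homI simp: conj_by_mult)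

lemma conj_by_inv:
  "\<lbrakk>g \<in> carrier G; x \<in> carrier G\<rbrakk> \<Longrightarrow> conj_by g (inv x) = inv (conj_by g x)"
  using group_hom.hom_inv[OF conj_by_hom] by blast

lemma conj_by_pow:
  "\<lbrakk>g \<in> carrier G; x \<in> carrier G\<rbrakk> \<Longrightarrow> conj_by g (x [^] (n::nat)) = conj_by g x [^] n"
  by (induction n) (simp_all add: conj_by_mult)

lemma conj_by_eq_self_iff:
  assumes "g \<in> carrier G" "x \<in> carrier G"
  shows "conj_by g x = x \<longleftrightarrow> g \<otimes> x = x \<otimes> g"
  using assms by (simp add: conj_by_def inv_solve_right')

lemma conj_by_inj: "\<lbrakk>g \<in> carrier G; A \<subseteq> carrier G\<rbrakk> \<Longrightarrow> inj_on (conj_by g) A"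
  by (rule inj_on_inverseI[where g = "conj_by (inv g)"]) auto

lemma conj_by_eq_iff [simp]:
  "\<lbrakk>g \<in> carrier G; x \<in> carrier G; y \<in> carrier G\<rbrakk> \<Longrightarrow> conj_by g x = conj_by g y \<longleftrightarrow> x = y"
  using conj_by_inv_cancel(1) by metis

lemma conj_by_eq_one_iff:
  "\<lbrakk>g \<in> carrier G; x \<in> carrier G\<rbrakk> \<Longrightarrow> conj_by g x = \<one> \<longleftrightarrow> x = \<one>"
  using conj_by_eq_iff[of g x \<one>] by simp

lemma conj_by_image_comp:
  "\<lbrakk>g \<in> carrier G; h \<in> carrier G; A \<subseteq> carrier G\<rbrakk> \<Longrightarrow> conj_by g ` conj_by h ` A = conj_by (g \<otimes> h) ` A"
  unfolding image_image by (rule image_cong) (auto simp: conj_by_comp)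

lemma conj_by_image_one [simp]: "A \<subseteq> carrier G \<Longrightarrow> conj_by \<one> ` A = A"
  by (force simp: subset_iff)

lemma conj_by_image_cancel [simp]:
  "\<lbrakk>g \<in> carrier G; A \<subseteq> carrier G\<rbrakk> \<Longrightarrow> conj_by (inv g) ` conj_by g ` A = A"
  "\<lbrakk>g \<in> carrier G; A \<subseteq> carrier G\<rbrakk> \<Longrightarrow> conj_by g ` conj_by (inv g) ` A = A"
  by (simp_all add: conj_by_image_comp)

lemma conj_by_image_subgroup:
  "\<lbrakk>g \<in> carrier G; subgroup A G\<rbrakk> \<Longrightarrow> subgroup (conj_by g ` A) G"
  by (rule group_hom.subgroup_img_is_subgroup[OF conj_by_hom])

lemma mem_conj_by_image_iff:
  assumes "g \<in> carrier G" "A \<subseteq> carrier G" "x \<in> carrier G"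
  shows "x \<in> conj_by g ` A \<longleftrightarrow> conj_by (inv g) x \<in> A"
proof
  assume "x \<in> conj_by g ` A"
  then obtain a where "a \<in> A" "x = conj_by g a" by blast
  then show "conj_by (inv g) x \<in> A" using assms by (simp add: subsetD)
next
  assume "conj_by (inv g) x \<in> A"
  moreover have "x = conj_by g (conj_by (inv g) x)" using assms by simp
  ultimately show "x \<in> conj_by g ` A" by blast
qed

lemma conj_by_image_subset_carrier:
  "\<lbrakk>g \<in> carrier G; A \<subseteq> carrier G\<rbrakk> \<Longrightarrow> conj_by g ` A \<subseteq> carrier G"
  by auto

lemma conj_by_mem_subgroup:
  "\<lbrakk>subgroup A G; g \<in> A; x \<in> A\<rbrakk> \<Longrightarrow> conj_by g x \<in> A"
  by (simp add: conj_by_def subgroup.m_closed subgroup.m_inv_closed)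

lemma conj_by_image_self:
  assumes A: "subgroup A G" and g: "g \<in> A"
  shows "conj_by g ` A = A"
proof
  show "conj_by g ` A \<subseteq> A" using conj_by_mem_subgroup[OF A g] by blast
  show "A \<subseteq> conj_by g ` A"
  proof
    fix x assume x: "x \<in> A"
    have "conj_by (inv g) x \<in> A"
      using conj_by_mem_subgroup[OF A subgroup.m_inv_closed[OF A g] x] .
    then show "x \<in> conj_by g ` A"
      using subgroup.mem_carrier[OF A] g x by (subst mem_conj_by_image_iff) (auto simp: subgroup.subset[OF A])
  qed
qed

lemma subgroup_nat_pow_closed:
  "\<lbrakk>subgroup A G; x \<in> A\<rbrakk> \<Longrightarrow> x [^] (n::nat) \<in> A"
  by (induction n) (simp_all add: subgroup.one_closed subgroup.m_closed)

lemma subgroup_card_dvd: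
  assumes "subgroup A G" "subgroup B G" "A \<subseteq> B"
  shows "card A dvd card B"
proof -
  interpret B: group "G\<lparr>carrier := B\<rparr>" using assms(2) subgroup_imp_group by blast
  have "subgroup A (G\<lparr>carrier := B\<rparr>)" using assms subgroup_incl by blast
  from B.lagrange[OF this] show ?thesis
    unfolding order_def by (simp) (metis dvd_triv_right)
qed

lemma pow_coprime_mem:
  assumes A: "subgroup A G" and x: "x \<in> carrier G"
    and m: "x [^] (m::nat) \<in> A" and n: "x [^] (n::nat) \<in> A" and cop: "coprime m n"
  shows "x \<in> A"
proof -
  obtain u v :: int where uv: "u * int m + v * int n = 1"
    using cop bezout_int[of "int m" "int n"] by auto
  have "x = x [^] (1::int)" using x by simp
  also have "\<dots> = x [^] (int m * u + int n * v)" using uv by (simp add: mult.commute)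
  also have "\<dots> = (x [^] m) [^] u \<otimes> (x [^] n) [^] v"
    using x by (simp add: int_pow_mult int_pow_pow[symmetric] int_pow_int)
  also have "\<dots> \<in> A" using subgroup_int_pow_closed[OF A] m n by (simp add: subgroup.m_closed[OF A])
  finally show ?thesis .
qed

lemma set_mult_subgroup:
  assumes A: "subgroup A G" and B: "subgroup B G"
    and nrm: "\<And>b a. \<lbrakk>b \<in> B; a \<in> A\<rbrakk> \<Longrightarrow> conj_by b a \<in> A"
  shows "subgroup (A <#> B) G"
proof (rule subgroupI)
  have cA: "\<And>a. a \<in> A \<Longrightarrow> a \<in> carrier G" using subgroup.mem_carrier[OF A] .
  have cB: "\<And>a. a \<in> B \<Longrightarrow> a \<in> carrier G" using subgroup.mem_carrier[OF B] .
  show "A <#> B \<subseteq> carrier G" using cA cB by (auto simp: set_mult_def)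
  show "A <#> B \<noteq> {}" using subgroup.one_closed[OF A] subgroup.one_closed[OF B] by (auto simp: set_mult_def)
  fix x assume "x \<in> A <#> B"
  then obtain a b where ab: "a \<in> A" "b \<in> B" "x = a \<otimes> b" by (auto simp: set_mult_def)
  have "inv x = conj_by (inv b) (inv a) \<otimes> inv b"
    using ab cA cB by (simp add: conj_by_def inv_mult_group m_assoc)
  moreover have "conj_by (inv b) (inv a) \<in> A"
    using nrm subgroup.m_inv_closed[OF A] subgroup.m_inv_closed[OF B] ab by blast
  ultimately show "inv x \<in> A <#> B" using subgroup.m_inv_closed[OF B] ab by (auto simp: set_mult_def)
  fix y assume "y \<in> A <#> B"
  then obtain c d where cd: "c \<in> A" "d \<in> B" "y = c \<otimes> d" by (auto simp: set_mult_def)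
  have "x \<otimes> y = (a \<otimes> conj_by b c) \<otimes> (b \<otimes> d)"
    using ab cd cA cB by (simp add: conj_by_def m_assoc inv_solve_left)
  moreover have "a \<otimes> conj_by b c \<in> A" "b \<otimes> d \<in> B"
    using ab cd nrm subgroup.m_closed[OF A] subgroup.m_closed[OF B] by auto
  ultimately show "x \<otimes> y \<in> A <#> B" unfolding set_mult_def by blast
qed

lemma set_mult_incl:
  assumes A: "subgroup A G" and B: "subgroup B G"
  shows "A \<subseteq> A <#> B" "B \<subseteq> A <#> B"
proof -
  show "A \<subseteq> A <#> B"
  proof
    fix a assume "a \<in> A"
    then have "a = a \<otimes> \<one>" "a \<in> A" using subgroup.mem_carrier[OF A] by auto
    then show "a \<in> A <#> B" using subgroup.one_closed[OF B] unfolding set_mult_def by blast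
  qed
  show "B \<subseteq> A <#> B"
  proof
    fix a assume "a \<in> B"
    then have "a = \<one> \<otimes> a" "a \<in> B" using subgroup.mem_carrier[OF B] by auto
    then show "a \<in> A <#> B" using subgroup.one_closed[OF A] unfolding set_mult_def by blast
  qed
qed

lemma set_mult_least:
  assumes "subgroup C G" "A \<subseteq> C" "B \<subseteq> C"
  shows "A <#> B \<subseteq> C"
  using assms by (auto simp: set_mult_def subgroup.m_closed subset_iff)

lemma dedekind_left:
  assumes Y: "subgroup Y G" and A: "A \<subseteq> Y" and B: "B \<subseteq> carrier G"
  shows "(A <#> B) \<inter> Y = A <#> (B \<inter> Y)"
proof
  show "(A <#> B) \<inter> Y \<subseteq> A <#> (B \<inter> Y)"
  proof
    fix z assume z: "z \<in> (A <#> B) \<inter> Y"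
    then obtain a b where ab: "a \<in> A" "b \<in> B" "z = a \<otimes> b" by (auto elim: set_multE)
    have "inv a \<otimes> z \<in> Y" using ab A z subgroup.m_closed[OF Y] subgroup.m_inv_closed[OF Y] by blast
    moreover have "inv a \<otimes> z = b"
      using ab A B subgroup.subset[OF Y] by (simp add: m_assoc[symmetric] subset_iff)
    ultimately show "z \<in> A <#> (B \<inter> Y)" unfolding ab(3) using ab by (intro set_multI) auto
  qed
  show "A <#> (B \<inter> Y) \<subseteq> (A <#> B) \<inter> Y"
    using set_mult_least[OF Y A, of "B \<inter> Y"] mono_set_mult[of A A "B \<inter> Y" B] by blast
qed

lemma dedekind_right:
  assumes Y: "subgroup Y G" and B: "B \<subseteq> Y" and A: "A \<subseteq> carrier G"
  shows "(A <#> B) \<inter> Y = (A \<inter> Y) <#> B"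
proof
  show "(A <#> B) \<inter> Y \<subseteq> (A \<inter> Y) <#> B"
  proof
    fix z assume z: "z \<in> (A <#> B) \<inter> Y"
    then obtain a b where ab: "a \<in> A" "b \<in> B" "z = a \<otimes> b" by (auto elim: set_multE)
    have "z \<otimes> inv b \<in> Y" using ab B z subgroup.m_closed[OF Y] subgroup.m_inv_closed[OF Y] by blast
    moreover have "z \<otimes> inv b = a"
      using ab A B subgroup.subset[OF Y] by (simp add: m_assoc subset_iff)
    ultimately show "z \<in> (A \<inter> Y) <#> B" unfolding ab(3) using ab by (intro set_multI) auto
  qed
  show "(A \<inter> Y) <#> B \<subseteq> (A <#> B) \<inter> Y"
    using set_mult_least[OF Y _ B, of "A \<inter> Y"] mono_set_mult[of "A \<inter> Y" A B B] by blast
qed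

lemma subgroup_Int: "\<lbrakk>subgroup A G; subgroup B G\<rbrakk> \<Longrightarrow> subgroup (A \<inter> B) G"
  by (rule subgroups_Inter_pair)

definition normalizer_in :: "'a set \<Rightarrow> 'a set \<Rightarrow> 'a set" where
  "normalizer_in H A = {g \<in> H. conj_by g ` A = A}"

lemma normalizer_in_subgroup:
  assumes H: "subgroup H G" and A: "A \<subseteq> carrier G"
  shows "subgroup (normalizer_in H A) G"
proof (rule subgroupI)
  have cH: "\<And>a. a \<in> H \<Longrightarrow> a \<in> carrier G" using subgroup.mem_carrier[OF H] .
  show "normalizer_in H A \<subseteq> carrier G" using cH by (auto simp: normalizer_in_def)
  have "\<one> \<in> normalizer_in H A" using subgroup.one_closed[OF H] A by (simp add: normalizer_in_def)
  then show "normalizer_in H A \<noteq> {}" by blast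
  fix x assume x: "x \<in> normalizer_in H A"
  then have "conj_by (inv x) ` A = A"
    using conj_by_image_cancel(1)[of x A] cH A by (auto simp: normalizer_in_def)
  then show "inv x \<in> normalizer_in H A" using x subgroup.m_inv_closed[OF H] by (auto simp: normalizer_in_def)
  fix y assume y: "y \<in> normalizer_in H A"
  show "x \<otimes> y \<in> normalizer_in H A"
    using x y cH subgroup.m_closed[OF H] conj_by_image_comp[of x y A] A by (auto simp: normalizer_in_def)
qed

lemma subgroup_le_normalizer:
  assumes "subgroup A G" "A \<subseteq> H"
  shows "A \<subseteq> normalizer_in H A"
  unfolding normalizer_in_def using conj_by_image_self[OF assms(1)] assms(2) by blast

definition centralizer_in :: "'a set \<Rightarrow> 'a set \<Rightarrow> 'a set" where
  "centralizer_in H X = {g \<in> H. \<forall>x\<in>X. g \<otimes> x = x \<otimes> g}"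

lemma centralizer_in_subgroup:
  assumes H: "subgroup H G" and X: "X \<subseteq> carrier G"
  shows "subgroup (centralizer_in H X) G"
proof (rule subgroupI)
  have c: "\<And>h. h \<in> H \<Longrightarrow> h \<in> carrier G" "\<And>x. x \<in> X \<Longrightarrow> x \<in> carrier G"
    using subgroup.mem_carrier[OF H] X by auto
  show "centralizer_in H X \<subseteq> carrier G" using c by (auto simp: centralizer_in_def)
  have "\<one> \<in> centralizer_in H X" using subgroup.one_closed[OF H] c by (simp add: centralizer_in_def)
  then show "centralizer_in H X \<noteq> {}" by blast
  fix g assume g: "g \<in> centralizer_in H X"
  have "inv g \<otimes> x = x \<otimes> inv g" if "x \<in> X" for x
  proof -
    have "g \<otimes> x = x \<otimes> g" "g \<in> carrier G" "x \<in> carrier G" using g that c by (auto simp: centralizer_in_def)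
    then show ?thesis by (metis inv_closed inv_solve_left inv_solve_right m_assoc m_closed)
  qed
  then show "inv g \<in> centralizer_in H X"
    using g subgroup.m_inv_closed[OF H] by (simp add: centralizer_in_def)
  fix h assume h: "h \<in> centralizer_in H X"
  have "g \<otimes> h \<otimes> x = x \<otimes> (g \<otimes> h)" if "x \<in> X" for x
  proof -
    have "g \<otimes> x = x \<otimes> g" "h \<otimes> x = x \<otimes> h" "g \<in> carrier G" "h \<in> carrier G" "x \<in> carrier G"
      using g h that c by (auto simp: centralizer_in_def)
    then show ?thesis by (metis m_assoc)
  qed
  then show "g \<otimes> h \<in> centralizer_in H X"
    using g h subgroup.m_closed[OF H] by (simp add: centralizer_in_def)
qed

text \<open>
  When \<open>H\<close> has a normal Sylow \<open>p\<close>-subgroup of exponent \<open>p\<close>, it is this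
  set; speaking of the set avoids any choice of Sylow subgroups and makes the passage to subgroups of
  \<open>H\<close> an intersection.
\<close>
definition torsion :: "nat \<Rightarrow> 'a set \<Rightarrow> 'a set" where
  "torsion p H = {x \<in> H. x [^] p = \<one>}"

lemma torsion_pow: "x \<in> torsion p H \<Longrightarrow> x [^] p = \<one>"
  by (simp add: torsion_def)

lemma torsion_subset: "torsion p H \<subseteq> H"
  by (auto simp: torsion_def)

lemma conj_by_torsion:
  assumes "H \<subseteq> carrier G" "g \<in> carrier G" "x \<in> torsion p H" "conj_by g x \<in> K"
  shows "conj_by g x \<in> torsion p K"
  using assms conj_by_pow[of g x p] by (auto simp: torsion_def)

lemma conj_by_pow_closed:
  assumes U: "subgroup U G" and y: "y \<in> carrier G" and nrm: "\<And>u. u \<in> U \<Longrightarrow> conj_by y u \<in> U"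
    and u: "u \<in> U"
  shows "conj_by (y [^] (n::nat)) u \<in> U"
  using u
proof (induction n arbitrary: u)
  case 0
  then show ?case using subgroup.mem_carrier[OF U] by simp
next
  case (Suc n)
  have "conj_by (y [^] Suc n) u = conj_by (y [^] n) (conj_by y u)"
    using subgroup.mem_carrier[OF U] Suc.prems y by (simp add: conj_by_comp)
  then show ?case using Suc nrm by simp
qed

text \<open>
  Modulo \<open>A\<close> the factor \<open>a\<close> disappears.
\<close>
lemma mult_pow_normalized:
  assumes A: "subgroup A G" and n: "n \<in> carrier G" "\<And>a. a \<in> A \<Longrightarrow> conj_by n a \<in> A" and a: "a \<in> A"
  shows "\<exists>b\<in>A. (a \<otimes> n) [^] (k::nat) = b \<otimes> n [^] k"
proof (induction k)
  case 0
  then show ?case using subgroup.one_closed[OF A] by force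
next
  case (Suc k)
  have Ac: "\<And>a. a \<in> A \<Longrightarrow> a \<in> carrier G" using subgroup.mem_carrier[OF A] .
  obtain b where b: "b \<in> A" "(a \<otimes> n) [^] k = b \<otimes> n [^] k" using Suc by blast
  have nk: "conj_by (n [^] k) a \<in> A" using conj_by_pow_closed[OF A n a] .
  have "(a \<otimes> n) [^] Suc k = (b \<otimes> conj_by (n [^] k) a) \<otimes> (n [^] k \<otimes> n)"
    using b a n Ac by (simp add: conj_by_def m_assoc inv_solve_left)
  then show ?case using nk b subgroup.m_closed[OF A] by auto
qed

text \<open>
  The automorphism group of a cyclic group is abelian.
\<close>
lemma conj_by_commute_cyclic:
  assumes y: "y \<in> carrier G" and g: "g \<in> carrier G" "conj_by g y = y [^] (i::nat)"
    and h: "h \<in> carrier G" "conj_by h y = y [^] (j::nat)" and a: "a = y [^] (k::nat)"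
  shows "conj_by (g \<otimes> h) a = conj_by (h \<otimes> g) a"
proof -
  have "conj_by (g \<otimes> h) y = y [^] (i * j)"
    using assms by (simp add: conj_by_comp[symmetric] conj_by_pow nat_pow_pow)
  moreover have "conj_by (h \<otimes> g) y = y [^] (j * i)"
    using assms by (simp add: conj_by_comp[symmetric] conj_by_pow nat_pow_pow)
  ultimately have "conj_by (g \<otimes> h) y = conj_by (h \<otimes> g) y" by (simp add: mult.commute)
  then show ?thesis using assms by (simp add: conj_by_pow)
qed

lemma normal_conj_by: "N \<lhd> G \<longleftrightarrow> subgroup N G \<and> (\<forall>x\<in>carrier G. \<forall>h\<in>N. conj_by x h \<in> N)"
  by (simp add: normal_inv_iff conj_by_def)

end

section \<open>Neighbours in the subgroup lattice\<close>

text \<open>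
  Maximality of a subgroup, with equality allowed. Allowing it makes the relation stable under intersections and
  under products with normal subgroups.
\<close>
definition adjacent :: "('a, 'b) monoid_scheme \<Rightarrow> 'a set \<Rightarrow> 'a set \<Rightarrow> bool" where
  "adjacent G A B \<longleftrightarrow> (\<forall>C. subgroup C G \<longrightarrow> A \<subseteq> C \<longrightarrow> C \<subseteq> B \<longrightarrow> C = A \<or> C = B)"

lemma adjacentD: "\<lbrakk>adjacent G A B; subgroup C G; A \<subseteq> C; C \<subseteq> B\<rbrakk> \<Longrightarrow> C = A \<or> C = B"
  unfolding adjacent_def by blast

locale fin_group = group +
  assumes fin: "finite (carrier G)"
begin

lemma finite_subgroup: "subgroup A G \<Longrightarrow> finite A"
  using fin subgroup.subset finite_subset by blast

lemma card_subgroup_pos: "subgroup A G \<Longrightarrow> card A > 0"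
  using finite_subgroup subgroup.one_closed card_gt_0_iff by blast

lemma conj_by_image_card:
  "\<lbrakk>g \<in> carrier G; A \<subseteq> carrier G\<rbrakk> \<Longrightarrow> card (conj_by g ` A) = card A"
  by (rule card_image, rule conj_by_inj)

lemma conj_by_image_eqI:
  assumes "g \<in> carrier G" "A \<subseteq> carrier G" "\<And>a. a \<in> A \<Longrightarrow> conj_by g a \<in> A"
  shows "conj_by g ` A = A"
  using assms conj_by_image_card[of g A] finite_subset[OF _ fin]
  by (intro card_subset_eq) auto

lemma subgroup_card_eq:
  assumes "subgroup A G" "subgroup B G" "A \<subseteq> B" "card B \<le> card A" shows "A = B"
  using assms finite_subgroup by (intro card_seteq) auto

lemma subgroup_psubset_card: "\<lbrakk>subgroup B G; A \<subset> B\<rbrakk> \<Longrightarrow> card A < card B"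
  using finite_subgroup psubset_card_mono by blast

lemma cauchy:
  assumes H: "subgroup H G" and p: "prime p" "p dvd card H"
  shows "\<exists>x\<in>H. x \<noteq> \<one> \<and> x [^] p = \<one>"
proof -
  interpret H: group "G\<lparr>carrier := H\<rparr>" using H subgroup_imp_group by blast
  obtain m where m: "card H = p^1 * m" using p by (auto elim: dvdE)
  obtain P where P: "subgroup P (G\<lparr>carrier := H\<rparr>)" "card P = p"
    using sylow_thm[OF p(1) H.is_group, of 1 m] m finite_subgroup[OF H] by (auto simp: order_def)
  have PG: "subgroup P G" "P \<subseteq> H"
    using incl_subgroup[OF H P(1)] subgroup.subset[OF P(1)] by auto
  have "P \<noteq> {\<one>}" using P(2) p(1) by auto
  then obtain x where x: "x \<in> P" "x \<noteq> \<one>" using subgroup.one_closed[OF PG(1)] by blast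
  interpret P: group "G\<lparr>carrier := P\<rparr>" using PG subgroup_imp_group by blast
  have "x [^]\<^bsub>G\<lparr>carrier := P\<rparr>\<^esub> order (G\<lparr>carrier := P\<rparr>) = \<one>"
    using P.pow_order_eq_1 x by fastforce
  then have "x [^] p = \<one>" using P(2) by (simp add: order_def nat_pow_consistent[symmetric])
  then show ?thesis using x PG by blast
qed

lemma subgroup_pow_card:
  assumes P: "subgroup P G" and x: "x \<in> P"
  shows "x [^] card P = \<one>"
proof -
  interpret P: group "G\<lparr>carrier := P\<rparr>" using P subgroup_imp_group by blast
  have "x [^]\<^bsub>G\<lparr>carrier := P\<rparr>\<^esub> order (G\<lparr>carrier := P\<rparr>) = \<one>"
    using P.pow_order_eq_1 x by fastforce
  then show ?thesis by (simp add: order_def nat_pow_consistent[symmetric])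
qed

lemma exponent_p_card:
  assumes H: "subgroup H G" and p: "prime p" and x: "\<And>x. x \<in> H \<Longrightarrow> x [^] p = \<one>"
  shows "\<exists>k. card H = p ^ k"
proof -
  have "r = p" if r: "prime r" "r dvd card H" for r
  proof -
    obtain y where y: "y \<in> H" "y \<noteq> \<one>" "y [^] r = \<one>" using cauchy[OF H r] by blast
    show "r = p"
    proof (rule ccontr)
      assume "r \<noteq> p"
      then have "coprime r p" using primes_coprime r p by blast
      then have "y \<in> {\<one>}" using pow_coprime_mem[OF triv_subgroup, of y r p] y x[OF y(1)] subgroup.mem_carrier[OF H y(1)] by simp
      then show False using y by simp
    qed
  qed
  then have "prime_factors (card H) \<subseteq> {p}" by (auto simp: prime_factors_dvd)
  then show ?thesis 
    using card_subgroup_pos[OF H] prime_factorization_nat[of "card H"]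
    by (metis (no_types, lifting) Diff_eq_empty_iff finite.emptyI finite_insert prod.empty prod.insert_remove
        power_0 mult.right_neutral subset_singleton_iff insert_Diff_single prod.insert empty_iff)
qed

lemma card_subgroup_eq_1: "\<lbrakk>subgroup A G; card A = 1\<rbrakk> \<Longrightarrow> A = {\<one>}"
  using subgroup.one_closed by (metis card_1_singletonE singletonD)

text \<open>
  A normal subgroup outside a maximal subgroup supplements it.
\<close>
lemma adjacent_factor:
  assumes adj: "adjacent G U H" and U: "subgroup U G" and H: "subgroup H G" "U \<subseteq> H"
    and A: "subgroup A G" "A \<subseteq> H" "\<not> A \<subseteq> U"
    and nrm: "\<And>u a. \<lbrakk>u \<in> U; a \<in> A\<rbrakk> \<Longrightarrow> conj_by u a \<in> A"
  shows "H = A <#> U"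
proof -
  have "subgroup (A <#> U) G" using set_mult_subgroup[OF A(1) U nrm] .
  moreover have "U \<subseteq> A <#> U" "A \<subseteq> A <#> U" using set_mult_incl[OF A(1) U] by auto
  moreover have "A <#> U \<subseteq> H" using set_mult_least[OF H(1) A(2) H(2)] .
  ultimately show ?thesis using adjacentD[OF adj] A(3) by blast
qed

lemma powers_subgroup:
  assumes "y \<in> carrier G"
  shows "subgroup {y [^] (k::nat) | k. True} G"
  using generate_pow_on_finite_carrier[OF fin assms] generate_is_subgroup[of "{y}"] assms by simp

text \<open>
  When \<open>y\<close> normalizes \<open>U\<close>, this \<open>m\<close> is the order of the coset of
  \<open>y\<close>.
\<close>
lemma relative_order:
  assumes U: "subgroup U G" and y: "y \<in> carrier G"
  obtains m :: nat where "m > 0" "\<And>k::nat. y [^] k \<in> U \<longleftrightarrow> m dvd k"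
proof -
  define m where "m = (LEAST m::nat. m > 0 \<and> y [^] m \<in> U)"
  have ex: "\<exists>m::nat. m > 0 \<and> y [^] m \<in> U"
    using pow_order_eq_1[OF y] fin order_gt_0_iff_finite subgroup.one_closed[OF U] by metis
  have m: "m > 0" "y [^] m \<in> U" using LeastI_ex[OF ex] by (auto simp: m_def)
  have min: "\<not> (k > 0 \<and> y [^] k \<in> U)" if "k < m" for k
    using not_less_Least that unfolding m_def by blast
  have "y [^] k \<in> U \<longleftrightarrow> m dvd k" for k :: nat
  proof
    assume k: "y [^] k \<in> U"
    have "y [^] k = (y [^] m) [^] (k div m) \<otimes> y [^] (k mod m)"
      using y by (simp add: nat_pow_pow nat_pow_mult)
    moreover have d: "(y [^] m) [^] (k div m) \<in> U" using subgroup_nat_pow_closed[OF U m(2)] .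
    ultimately have "y [^] (k mod m) = inv ((y [^] m) [^] (k div m)) \<otimes> y [^] k"
      using y by (simp add: m_assoc[symmetric])
    then have "y [^] (k mod m) \<in> U"
      using k d by (simp add: subgroup.m_closed[OF U] subgroup.m_inv_closed[OF U])
    then have "k mod m = 0" using min[of "k mod m"] m(1) by auto
    then show "m dvd k" by auto
  next
    assume "m dvd k"
    then obtain j where "k = m * j" by (auto elim: dvdE)
    then show "y [^] k \<in> U" using subgroup_nat_pow_closed[OF U m(2), of j] y by (simp add: nat_pow_pow)
  qed
  then show thesis using that m(1) by blast
qed

text \<open>
  Whenever \<open>y\<close> normalizes the maximal subgroup \<open>U\<close> of \<open>E\<close>, the quotient
  \<open>E/U\<close> is generated by the image of \<open>y\<close> and has no proper nontrivial subgroup, hence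
  has prime order.
\<close>
lemma adjacent_cyclic:
  assumes U: "subgroup U G" and E: "subgroup E G" "U \<subseteq> E" and adj: "adjacent G U E"
    and y: "y \<in> E" "y \<notin> U" and nrm: "\<And>u. u \<in> U \<Longrightarrow> conj_by y u \<in> U"
  shows "\<exists>q. prime q \<and> (\<forall>k::nat. y [^] k \<in> U \<longleftrightarrow> q dvd k) \<and>
    (\<forall>x\<in>E. \<exists>u\<in>U. \<exists>i::nat. x = u \<otimes> y [^] i)"
proof -
  have yc: "y \<in> carrier G" using y E subgroup.mem_carrier by metis
  have uc: "\<And>u. u \<in> U \<Longrightarrow> u \<in> carrier G" using subgroup.mem_carrier[OF U] .
  have cyc: "E = U <#> {(y [^] j) [^] (k::nat) | k. True}" if j: "y [^] (j::nat) \<notin> U" for j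
  proof -
    let ?Y = "{(y [^] j) [^] (k::nat) | k. True}"
    have Y: "subgroup ?Y G" using powers_subgroup yc by simp
    have s: "subgroup (U <#> ?Y) G"
      using conj_by_pow_closed[OF U yc nrm] yc by (intro set_mult_subgroup[OF U Y]) (auto simp: nat_pow_pow)
    have "?Y \<subseteq> E" using subgroup_nat_pow_closed[OF E(1)] y by auto
    then have "U <#> ?Y \<subseteq> E" using set_mult_least[OF E] by blast
    moreover have "U <#> ?Y \<noteq> U"
    proof
      assume "U <#> ?Y = U"
      then have "?Y \<subseteq> U" using set_mult_incl(2)[OF U Y] by simp
      moreover have "y [^] j = (y [^] j) [^] (1::nat)" using yc by simp
      ultimately show False using j by blast
    qed
    ultimately show ?thesis using adjacentD[OF adj s set_mult_incl(1)[OF U Y]] by blast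
  qed
  obtain m where m: "m > 0" "\<And>k::nat. y [^] k \<in> U \<longleftrightarrow> m dvd k"
    using relative_order[OF U yc] by blast
  have m1: "m \<noteq> 1" using m(2)[of 1] y yc by auto
  then obtain q where q: "prime q" "q dvd m" using prime_factor_nat by blast
  have "y [^] q \<in> U"
  proof (rule ccontr)
    assume "y [^] q \<notin> U"
    then have "y \<in> U <#> {(y [^] q) [^] (k::nat) | k. True}" using cyc y by blast
    then obtain u k where uk: "u \<in> U" "y = u \<otimes> y [^] (q * k)"
      using yc unfolding set_mult_def by (simp add: nat_pow_pow) blast
    \<comment> \<open>\<open>l\<close> is a natural number congruent to \<open>- q k\<close> modulo \<open>m\<close>; it cancels \<open>y\<^sup>q\<^sup>k\<close> without negative exponents\<close>
    obtain l where l: "q * k + l = m * (q * k + 1)" 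
      using m(1) by (metis le_add_diff_inverse le_add1 le_trans mult_le_mono1 nat_mult_1 Suc_leI One_nat_def)
    have "y [^] (1 + l) = y \<otimes> y [^] l" using yc nat_pow_mult[of y 1 l] by simp
    also have "\<dots> = u \<otimes> y [^] (q * k) \<otimes> y [^] l" using uk(2) by simp
    also have "\<dots> = u \<otimes> y [^] (m * (q * k + 1))"
      using yc uc[OF uk(1)] by (simp only: m_assoc nat_pow_closed nat_pow_mult l)
    also have "\<dots> \<in> U" using m(2) uk(1) subgroup.m_closed[OF U] dvd_triv_left by blast
    finally have "m dvd 1 + l" using m(2) by blast
    then have "q dvd 1 + l" using q(2) dvd_trans by blast
    moreover have "q dvd l" using l q(2) by (metis dvd_add_right_iff dvd_mult2 dvd_triv_left)
    ultimately have "q dvd 1" using dvd_add_left_iff by blast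
    then show False using q(1) by auto
  qed
  then have "m dvd q" using m(2) by blast
  then have mq: "m = q" using q(1) m1 unfolding prime_nat_iff by blast
  have pw: "y [^] (k::nat) \<in> U \<longleftrightarrow> q dvd k" for k using m(2) mq by simp
  have E1: "\<exists>u\<in>U. \<exists>i::nat. x = u \<otimes> y [^] i" if "x \<in> E" for x
    using cyc[of 1] that y yc by (auto simp: set_mult_def)
  show ?thesis using q(1) pw E1 by blast
qed

text \<open>
  The class equation: the conjugacy class of the identity is a singleton, the size of every class divides a
  power of \<open>p\<close>, and \<open>p\<close> divides the sum of the sizes, so there is another singleton.
\<close>
lemma exponent_p_center:
  fixes p :: nat
  assumes E: "subgroup E G" and p: "prime p" and ex: "\<And>x. x \<in> E \<Longrightarrow> x [^] p = \<one>" and nt: "E \<noteq> {\<one>}"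
  shows "\<exists>z\<in>E. z \<noteq> \<one> \<and> (\<forall>x\<in>E. x \<otimes> z = z \<otimes> x)"
proof (rule ccontr)
  assume no: "\<not> ?thesis"
  let ?E = "G\<lparr>carrier := E\<rparr>"
  let ?c = "\<lambda>g. \<lambda>h\<in>E. g \<otimes> h \<otimes> inv\<^bsub>?E\<^esub> g"
  interpret E: group ?E using E subgroup_imp_group by blast
  interpret act: group_action ?E E ?c using E.action_by_conjugation by simp
  have ec: "\<And>x. x \<in> E \<Longrightarrow> x \<in> carrier G" using subgroup.mem_carrier[OF E] .
  have orb: "orbit ?E ?c x = (\<lambda>g. conj_by g x) ` E" if "x \<in> E" for x
  proof -
    have "?c g x = conj_by g x" if "g \<in> E" for g
      using that \<open>x \<in> E\<close> m_inv_consistent[OF E] by (simp add: conj_by_def)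
    then have "(\<lambda>g. ?c g x) ` E = (\<lambda>g. conj_by g x) ` E" by (rule image_cong[OF refl])
    moreover have "orbit ?E ?c x = (\<lambda>g. ?c g x) ` E"
      unfolding orbit_def Setcompr_eq_image Collect_mem_eq by (simp cong del: image_cong_simp)
    ultimately show ?thesis by simp
  qed
  obtain k where k: "card E = p ^ k" using exponent_p_card[OF E p ex] by blast
  have E1: "\<one> \<in> E" using subgroup.one_closed[OF E] .
  have "card E \<noteq> 1" using nt E1 by (auto simp: card_1_singleton_iff)
  then have k0: "k > 0" using k by (cases k) auto
  have one: "orbit ?E ?c \<one> = {\<one>}" using orb[OF E1] E1 ec by auto
  have big: "p dvd card R" if RO: "R \<in> orbits ?E E ?c - {{\<one>}}" for R
  proof -
    obtain x where x: "x \<in> E" "R = orbit ?E ?c x" using RO unfolding orbits_def by blast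
    then have x1: "x \<noteq> \<one>" using RO one by auto
    have "order ?E = p ^ k" using k by (simp add: order_def)
    then have "p ^ k = card R * card (stabilizer ?E ?c x)"
      using act.orbit_stabilizer_theorem[OF x(1)] unfolding x(2) by simp
    then have "card R dvd p ^ k" by (rule dvdI)
    moreover have "card R \<noteq> 1"
    proof
      assume "card R = 1"
      moreover have "x \<in> R" using x orb[OF x(1)] E1 ec image_eqI[of x "\<lambda>g. conj_by g x" \<one> E] by simp
      ultimately have "R = {x}" by (auto simp: card_1_singleton_iff)
      then have "\<forall>g\<in>E. conj_by g x = x" using x orb by auto
      then have "\<forall>g\<in>E. g \<otimes> x = x \<otimes> g" using conj_by_eq_self_iff ec x by simp
      then show False using no x(1) x1 by blast
    qed
    ultimately obtain j where "card R = p ^ j" "j \<noteq> 0"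
      using divides_primepow_nat[OF p] by (metis power_0)
    then show ?thesis by simp
  qed
  define \<Omega> where "\<Omega> = orbits ?E E ?c"
  have fO: "finite \<Omega>"
    unfolding \<Omega>_def orbits_def Setcompr_eq_image using finite_subgroup[OF E] by simp
  have mem: "{\<one>} \<in> \<Omega>" unfolding \<Omega>_def orbits_def using one E1 by blast
  have "(\<Sum>R\<in>\<Omega>. \<Sum>x\<in>R. 1::nat) = (\<Sum>x\<in>E. 1)"
    unfolding \<Omega>_def by (rule act.disjoint_sum[OF finite_subgroup[OF E]])
  then have "card E = (\<Sum>R\<in>\<Omega>. card R)" by simp
  also have "\<dots> = 1 + (\<Sum>R\<in>\<Omega> - {{\<one>}}. card R)"
    using sum.remove[OF fO mem, of card] by simp
  finally have e: "card E = 1 + (\<Sum>R\<in>\<Omega> - {{\<one>}}. card R)" .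
  have d: "p dvd (\<Sum>R\<in>\<Omega> - {{\<one>}}. card R)" using big unfolding \<Omega>_def by (rule dvd_sum)
  have "p dvd card E" using k k0 by simp
  then have "p dvd 1" unfolding e using d dvd_add_left_iff by blast
  then show False using p by auto
qed

lemma adjacent_one_generated:
  assumes E: "subgroup E G" and adj: "adjacent G {\<one>} E" and y: "y \<in> E" "y \<noteq> \<one>"
  shows "\<exists>q. prime q \<and> (\<forall>k::nat. y [^] k = \<one> \<longleftrightarrow> q dvd k) \<and> (\<forall>x\<in>E. \<exists>i::nat. x = y [^] i) \<and> card E = q"
proof -
  have yc: "y \<in> carrier G" using y subgroup.mem_carrier[OF E] by blast
  have "\<exists>q. prime q \<and> (\<forall>k::nat. y [^] k \<in> {\<one>} \<longleftrightarrow> q dvd k) \<and>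
    (\<forall>x\<in>E. \<exists>u\<in>{\<one>}. \<exists>i::nat. x = u \<otimes> y [^] i)"
    using y yc subgroup.one_closed[OF E] by (intro adjacent_cyclic[OF triv_subgroup E _ adj]) auto
  then obtain q where q: "prime q" "\<And>k::nat. y [^] k = \<one> \<longleftrightarrow> q dvd k" "\<And>x. x \<in> E \<Longrightarrow> \<exists>i::nat. x = y [^] i"
    using yc by auto
  have "E = generate G {y}"
    using q(3) generate_pow_on_finite_carrier[OF fin yc] generate_subgroup_incl[OF _ E, of "{y}"] y by auto
  moreover have "ord y = q" using q(2)[of "ord y"] q(2)[of q] pow_eq_id[OF yc, of "ord y"] pow_eq_id[OF yc, of q] dvd_antisym by simp
  ultimately have "card E = q" using generate_pow_card[OF yc] by simp
  then show ?thesis using q by blast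
qed

text \<open>
  Commutators of \<open>A\<close> centralize the cyclic group \<open>P\<close>.
\<close>
lemma faithful_on_cyclic_abelian:
  assumes P: "P \<subseteq> carrier G" and y: "y \<in> P" "\<And>b. b \<in> P \<Longrightarrow> \<exists>i::nat. b = y [^] i"
    and A: "subgroup A G" and nrm: "\<And>a b. \<lbrakk>a \<in> A; b \<in> P\<rbrakk> \<Longrightarrow> conj_by a b \<in> P"
    and faithful: "\<And>c. \<lbrakk>c \<in> A; \<And>b. b \<in> P \<Longrightarrow> c \<otimes> b = b \<otimes> c\<rbrakk> \<Longrightarrow> c = \<one>"
    and st: "s \<in> A" "t \<in> A"
  shows "s \<otimes> t = t \<otimes> s"
proof -
  have c: "s \<in> carrier G" "t \<in> carrier G" using st subgroup.mem_carrier[OF A] by auto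
  have ts: "inv (t \<otimes> s) \<in> A" using st subgroup.m_closed[OF A] subgroup.m_inv_closed[OF A] by blast
  let ?c = "(s \<otimes> t) \<otimes> inv (t \<otimes> s)"
  have "?c \<otimes> a = a \<otimes> ?c" if a: "a \<in> P" for a
  proof -
    have ac: "a \<in> carrier G" using a P by blast
    let ?b = "conj_by (inv (t \<otimes> s)) a"
    obtain i where i: "conj_by s y = y [^] (i::nat)" using y(2)[OF nrm[OF st(1) y(1)]] by blast
    obtain j where j: "conj_by t y = y [^] (j::nat)" using y(2)[OF nrm[OF st(2) y(1)]] by blast
    obtain k where k: "?b = y [^] (k::nat)" using y(2)[OF nrm[OF ts a]] by blast
    have "conj_by (s \<otimes> t) ?b = conj_by (t \<otimes> s) ?b"
      using conj_by_commute_cyclic[OF subsetD[OF P y(1)] c(1) i c(2) j k] .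
    then have "conj_by ?c a = a" using c ac by (simp add: conj_by_comp[symmetric])
    then show ?thesis using conj_by_eq_self_iff[of ?c a] c ac by simp
  qed
  moreover have "?c \<in> A" using subgroup.m_closed[OF A subgroup.m_closed[OF A st] ts] .
  ultimately have "?c = \<one>" by (intro faithful)
  then show ?thesis using c inv_solve_right'[of \<one> "s \<otimes> t" "t \<otimes> s"] by simp
qed

text \<open>
  The hypothesis \<open>ti\<close> says that distinct conjugates of \<open>U\<close> meet trivially and that
  \<open>U\<close> is its own normalizer. The pairs \<open>(x, u)\<close> with a given value \<open>x\<^sub>0
  u\<^sub>0 x\<^sub>0\<^sup>-\<^sup>1\<close> are then the pairs \<open>(x\<^sub>0 v, u\<^sub>0)\<close> with
  \<open>v \<in> U\<close>.
\<close>
lemma card_conjugates_disjoint: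
  assumes H: "subgroup H G" and U: "subgroup U G" "U \<subseteq> H"
    and ab: "\<And>u v. \<lbrakk>u \<in> U; v \<in> U\<rbrakk> \<Longrightarrow> u \<otimes> v = v \<otimes> u"
    and ti: "\<And>x u. \<lbrakk>x \<in> H; u \<in> U; u \<noteq> \<one>; conj_by x u \<in> U\<rbrakk> \<Longrightarrow> x \<in> U"
  shows "card ((\<lambda>(x, u). conj_by x u) ` (H \<times> (U - {\<one>}))) * card U = card H * (card U - 1)"
proof -
  let ?f = "\<lambda>(x, u). conj_by x u" and ?S = "H \<times> (U - {\<one>})"
  have Hc: "\<And>h. h \<in> H \<Longrightarrow> h \<in> carrier G" using subgroup.mem_carrier[OF H] .
  have Uc: "\<And>h. h \<in> U \<Longrightarrow> h \<in> carrier G" using subgroup.mem_carrier[OF U(1)] .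
  have finS: "finite ?S" using finite_subgroup H U by blast
  have fib: "card {s \<in> ?S. ?f s = b} = card U" if b: "b \<in> ?f ` ?S" for b
  proof -
    obtain x0 u0 where x0: "x0 \<in> H" "u0 \<in> U" "u0 \<noteq> \<one>" "b = conj_by x0 u0" using b by auto
    have "{s \<in> ?S. ?f s = b} = (\<lambda>u. (x0 \<otimes> u, u0)) ` U"
    proof
      show "{s \<in> ?S. ?f s = b} \<subseteq> (\<lambda>u. (x0 \<otimes> u, u0)) ` U"
      proof
        fix s assume "s \<in> {s \<in> ?S. ?f s = b}"
        then obtain x u where xu: "s = (x, u)" "x \<in> H" "u \<in> U" "u \<noteq> \<one>" "conj_by x u = b" by auto
        have c: "x \<in> carrier G" "u \<in> carrier G" "x0 \<in> carrier G" "u0 \<in> carrier G"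
          using xu x0 Hc Uc by auto
        have "conj_by (inv x0) (conj_by x u) = conj_by (inv x0) (conj_by x0 u0)" using xu x0 by simp
        then have e: "conj_by (inv x0 \<otimes> x) u = u0" using c by (simp add: conj_by_comp)
        have xH: "inv x0 \<otimes> x \<in> H" using x0 xu subgroup.m_closed[OF H] subgroup.m_inv_closed[OF H] by blast
        have v: "inv x0 \<otimes> x \<in> U" using ti[OF xH xu(3,4)] e x0 by simp
        have "u = u0" using e conj_by_eq_self_iff[of "inv x0 \<otimes> x" u] ab[OF v xu(3)] c by simp
        moreover have "x = x0 \<otimes> (inv x0 \<otimes> x)" using c by (simp add: m_assoc[symmetric])
        ultimately show "s \<in> (\<lambda>u. (x0 \<otimes> u, u0)) ` U" using v xu(1) by blast
      qed
      show "(\<lambda>u. (x0 \<otimes> u, u0)) ` U \<subseteq> {s \<in> ?S. ?f s = b}"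
      proof (clarsimp, intro conjI)
        fix u assume u: "u \<in> U"
        show "x0 \<otimes> u \<in> H" using x0 u U subgroup.m_closed[OF H] by blast
        show "u0 \<in> U" "u0 \<noteq> \<one>" using x0 by auto
        have "conj_by u u0 = u0" using conj_by_eq_self_iff ab u x0 Uc by simp
        then show "conj_by (x0 \<otimes> u) u0 = b" using x0 u Uc Hc by (simp add: conj_by_comp[symmetric])
      qed
    qed
    moreover have "inj_on (\<lambda>u. (x0 \<otimes> u, u0)) U" using x0 Hc Uc by (auto intro!: inj_onI)
    ultimately show ?thesis by (simp add: card_image)
  qed
  have "card ?S = (\<Sum>s\<in>?S. 1)" by simp
  also have "\<dots> = (\<Sum>b\<in>?f ` ?S. \<Sum>s\<in>{s \<in> ?S. ?f s = b}. 1)" by (rule sum.image_gen[OF finS])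
  also have "\<dots> = (\<Sum>b\<in>?f ` ?S. card U)" using fib by (intro sum.cong) auto
  finally have "card ?S = card (?f ` ?S) * card U" by simp
  moreover have "card ?S = card H * (card U - 1)"
    using subgroup.one_closed[OF U(1)] finite_subgroup[OF U(1)] by (simp add: card_cartesian_product)
  ultimately show ?thesis by simp
qed

end

section \<open>Action on a section of prime order\<close>

text \<open>
  A cyclic group \<open>\<langle>U, y\<rangle>/U\<close> of prime order \<open>q\<close>, generated by the coset
  of \<open>y\<close>.
\<close>
locale cyclic_section = fin_group +
  fixes U :: "'a set" and y :: 'a and q :: nat
  assumes U: "subgroup U G" and y: "y \<in> carrier G" and q: "prime q"
    and y_normalizes: "u \<in> U \<Longrightarrow> conj_by y u \<in> U"
    and y_pow: "y [^] (k::nat) \<in> U \<longleftrightarrow> q dvd k"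
begin

text \<open>
  The element \<open>a\<close> normalizes \<open>U\<close> and induces the \<open>i\<close>-th power map on the
  section. The exponent is kept as a natural number that matters modulo \<open>q\<close>, so that actions
  multiply like exponents.
\<close>
definition acts :: "'a \<Rightarrow> nat \<Rightarrow> bool" where
  "acts a i \<longleftrightarrow> a \<in> carrier G \<and> (\<forall>u\<in>U. conj_by a u \<in> U) \<and> (\<exists>u\<in>U. conj_by a y = u \<otimes> y [^] i)"

lemma Uc: "u \<in> U \<Longrightarrow> u \<in> carrier G" using subgroup.mem_carrier[OF U] .

lemma coset_pow:
  assumes u: "u \<in> U"
  shows "\<exists>v\<in>U. (u \<otimes> y [^] (i::nat)) [^] (n::nat) = v \<otimes> y [^] (i * n)"
  using mult_pow_normalized[OF U nat_pow_closed[OF y] conj_by_pow_closed[OF U y y_normalizes] u, of i n] y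
  by (simp add: nat_pow_pow)

lemma coset_eq_cong:
  assumes "u \<in> U" "v \<in> U" "u \<otimes> y [^] (i::nat) = v \<otimes> y [^] (j::nat)"
  shows "[i = j] (mod q)"
proof -
  have le: "[i = j] (mod q)" if "u \<in> U" "v \<in> U" "i \<le> j" "u \<otimes> y [^] i = v \<otimes> y [^] j" for u v and i j :: nat
  proof -
    have "u \<otimes> y [^] i = v \<otimes> y [^] (j - i) \<otimes> y [^] i"
      using that Uc y by (simp add: m_assoc nat_pow_mult)
    then have "u = v \<otimes> y [^] (j - i)" using Uc that y by simp
    then have "y [^] (j - i) = inv v \<otimes> u" using Uc that y by (simp add: m_assoc[symmetric])
    then have "y [^] (j - i) \<in> U" using that subgroup.m_closed[OF U] subgroup.m_inv_closed[OF U] by simp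
    then have "q dvd j - i" using y_pow by blast
    then show ?thesis using that(3) by (metis cong_altdef_nat cong_sym)
  qed
  show ?thesis using le[of u v i j] le[of v u j i] assms by (metis cong_sym nat_le_linear)
qed

lemma acts_unique: "\<lbrakk>acts a i; acts a j\<rbrakk> \<Longrightarrow> [i = j] (mod q)"
  unfolding acts_def using coset_eq_cong by metis

lemma acts_cong:
  assumes a: "acts a i" and ij: "[i = j] (mod q)"
  shows "acts a j"
proof -
  obtain k l where kl: "j + k * q = i + l * q" using ij by (metis cong_iff_lin_nat)
  obtain u where u: "u \<in> U" "conj_by a y = u \<otimes> y [^] i" using a by (auto simp: acts_def)
  have K: "y [^] (k * q) \<in> U" "y [^] (l * q) \<in> U" using y_pow by auto
  have "y [^] (l * q) \<otimes> y [^] i = y [^] (k * q) \<otimes> y [^] j"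
    using y kl by (simp add: nat_pow_mult add.commute)
  then have "y [^] i = (inv (y [^] (l * q)) \<otimes> y [^] (k * q)) \<otimes> y [^] j"
    using y by (simp add: m_assoc inv_solve_left)
  then have "conj_by a y = (u \<otimes> (inv (y [^] (l * q)) \<otimes> y [^] (k * q))) \<otimes> y [^] j"
    using u Uc K y by (simp add: m_assoc)
  moreover have "u \<otimes> (inv (y [^] (l * q)) \<otimes> y [^] (k * q)) \<in> U"
    using u K by (simp add: subgroup.m_closed[OF U] subgroup.m_inv_closed[OF U])
  ultimately show ?thesis using a by (auto simp: acts_def)
qed

lemma acts_one: "acts \<one> 1"
  unfolding acts_def using Uc y subgroup.one_closed[OF U] by force

lemma acts_mult:
  assumes a: "acts a i" and b: "acts b j"
  shows "acts (a \<otimes> b) (i * j)"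
proof -
  have c: "a \<in> carrier G" "b \<in> carrier G" using a b by (auto simp: acts_def)
  obtain u v where u: "u \<in> U" "conj_by a y = u \<otimes> y [^] i" and v: "v \<in> U" "conj_by b y = v \<otimes> y [^] j"
    using a b by (auto simp: acts_def)
  obtain w where w: "w \<in> U" "(u \<otimes> y [^] i) [^] j = w \<otimes> y [^] (i * j)" using coset_pow[OF u(1)] by blast
  have "conj_by (a \<otimes> b) y = conj_by a (v \<otimes> y [^] j)" using c y v by (simp add: conj_by_comp[symmetric])
  also have "\<dots> = conj_by a v \<otimes> (u \<otimes> y [^] i) [^] j"
    using c y v Uc u by (simp add: conj_by_mult conj_by_pow)
  also have "\<dots> = (conj_by a v \<otimes> w) \<otimes> y [^] (i * j)"
    using w c y v(1) Uc by (simp add: m_assoc)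
  finally have "conj_by (a \<otimes> b) y = (conj_by a v \<otimes> w) \<otimes> y [^] (i * j)" .
  moreover have "conj_by a v \<otimes> w \<in> U" using a v w subgroup.m_closed[OF U] by (auto simp: acts_def)
  moreover have "conj_by (a \<otimes> b) u' \<in> U" if "u' \<in> U" for u'
    using a b that c Uc by (auto simp: acts_def conj_by_comp[symmetric])
  ultimately show ?thesis using c unfolding acts_def by blast
qed

lemma acts_pow: "acts a i \<Longrightarrow> acts (a [^] (n::nat)) (i ^ n)"
proof (induction n)
  case 0
  then show ?case using acts_one by simp
next
  case (Suc n)
  then show ?case using acts_mult[of "a [^] n" "i ^ n" a i] by (simp add: mult.commute)
qed

lemma acts_trivially:
  assumes a: "acts a 1" and v: "v \<in> U"
  shows "conj_by a (v \<otimes> y [^] (k::nat)) \<otimes> inv (v \<otimes> y [^] k) \<in> U"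
proof -
  obtain u where u: "u \<in> U" "conj_by a y = u \<otimes> y [^] (1::nat)" and c: "a \<in> carrier G" using a by (auto simp: acts_def)
  obtain w where w: "w \<in> U" "(u \<otimes> y [^] (1::nat)) [^] k = w \<otimes> y [^] (1 * k)" using coset_pow[OF u(1)] by blast
  have "conj_by a (v \<otimes> y [^] k) = conj_by a v \<otimes> w \<otimes> y [^] k"
    using c y v Uc u w by (simp add: conj_by_mult conj_by_pow m_assoc)
  then have "conj_by a (v \<otimes> y [^] k) \<otimes> inv (v \<otimes> y [^] k) = conj_by a v \<otimes> w \<otimes> (y [^] k \<otimes> (inv (y [^] k) \<otimes> inv v))"
    using c y v Uc w(1) by (simp add: m_assoc inv_mult_group)
  also have "y [^] k \<otimes> (inv (y [^] k) \<otimes> inv v) = inv v"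
    using y Uc[OF v] by (simp add: m_assoc[symmetric])
  finally show ?thesis
    using a v w by (auto simp: acts_def subgroup.m_closed[OF U] subgroup.m_inv_closed[OF U])
qed

lemma acts_one_of_coprime_pow:
  assumes a: "acts a i" and n: "acts (a [^] (n::nat)) 1" "n > 0" "coprime n (q - 1)"
  shows "acts a 1"
  using acts_cong[OF a cong_one_of_pow_cong_one[OF q acts_unique[OF acts_pow[OF a] n(1)] n(2,3)]] .

end

section \<open>Families of subgroups with maximal traces\<close>

text \<open>
  The traces \<open>Z \<inter> N\<close> of the members on any subgroup \<open>Z\<close> are maximal in
  \<open>Z\<close> or equal to \<open>Z\<close>. The intended example is the set of conjugates of one core-free
  subgroup.
\<close>
locale trace_family = fin_group +
  fixes F :: "'a set set"
  assumes F_subgroup: "N \<in> F \<Longrightarrow> subgroup N G"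
    and F_trace: "\<lbrakk>N \<in> F; subgroup Z G\<rbrakk> \<Longrightarrow> adjacent G (Z \<inter> N) Z"
    and F_conj: "\<lbrakk>N \<in> F; g \<in> carrier G\<rbrakk> \<Longrightarrow> conj_by g ` N \<in> F"
    and F_trivial: "\<lbrakk>x \<in> carrier G; \<And>N. N \<in> F \<Longrightarrow> x \<in> N\<rbrakk> \<Longrightarrow> x = \<one>"
begin

text \<open>
  If \<open>x\<close> has order \<open>r\<^sup>2\<close> then \<open>\<langle>x\<rangle>\<close> has a single
  maximal subgroup, generated by \<open>x\<^sup>r\<close>, and every member contains it.
\<close>
lemma pow_square_eq_one:
  fixes r :: nat
  assumes r: "prime r" and x: "x \<in> carrier G" and rr: "x [^] (r * r) = \<one>"
  shows "x [^] r = \<one>"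
proof (rule F_trivial)
  show "x [^] r \<in> carrier G" using x by simp
  fix N assume N: "N \<in> F"
  note sN = F_subgroup[OF N]
  show "x [^] r \<in> N"
  proof (rule ccontr)
    assume no: "x [^] r \<notin> N"
    let ?Z = "{x [^] (k::nat) | k. True}" and ?C = "{(x [^] r) [^] (k::nat) | k. True}"
    have Z: "subgroup ?Z G" and C: "subgroup ?C G" using powers_subgroup x by auto
    have "?Z \<inter> N \<subseteq> ?C"
    proof
      fix z assume "z \<in> ?Z \<inter> N"
      then obtain k where k: "z = x [^] (k::nat)" "x [^] k \<in> N" by blast
      have "r dvd k"
      proof (rule ccontr)
        assume "\<not> r dvd k"
        then have "coprime k (r * r)" using r prime_imp_coprime coprime_commute by auto
        then have "x \<in> N" using pow_coprime_mem[OF sN x k(2), of "r * r"] rr subgroup.one_closed[OF sN] by simp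
        then show False using no subgroup_nat_pow_closed[OF sN] by blast
      qed
      then obtain j where "k = r * j" by (auto elim: dvdE)
      then have "z = (x [^] r) [^] j" using k x by (simp add: nat_pow_pow)
      then show "z \<in> ?C" by blast
    qed
    moreover have "?C \<subseteq> ?Z" using x by (auto simp: nat_pow_pow)
    ultimately have "?C = ?Z \<inter> N \<or> ?C = ?Z" using adjacentD[OF F_trace[OF N Z] C] by blast
    then show False
    proof
      assume e: "?C = ?Z \<inter> N"
      have "(x [^] r) [^] (1::nat) \<in> ?C" by blast
      then show False using no e x by auto
    next
      assume e: "?C = ?Z"
      have "x [^] (1::nat) \<in> ?Z" by blast
      then have "x \<in> ?C" using e x by simp
      then obtain j where j: "x = x [^] (r * j)" using x by (auto simp: nat_pow_pow)
      have "x [^] r = (x [^] (r * j)) [^] r" using j by simp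
      also have "\<dots> = (x [^] (r * r)) [^] j" using x by (simp add: nat_pow_pow mult.commute mult.left_commute)
      also have "\<dots> = \<one>" using rr by simp
      finally show False using no subgroup.one_closed[OF sN] by simp
    qed
  qed
qed

lemma obtain_member_avoiding:
  assumes "x \<in> carrier G" "x \<noteq> \<one>"
  obtains N where "N \<in> F" "x \<notin> N"
  using F_trivial assms by blast

text \<open>
  A central element \<open>z \<noteq> 1\<close> of \<open>E\<close> lies outside some member \<open>N\<close>,
  and then \<open>E\<close> is generated by \<open>z\<close> and \<open>E \<inter> N\<close>, which is abelian
  by induction.
\<close>
lemma exponent_p_commute:
  fixes p :: nat
  assumes "subgroup E G" "prime p" "\<And>x. x \<in> E \<Longrightarrow> x [^] p = \<one>" "x \<in> E" "y \<in> E"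
  shows "x \<otimes> y = y \<otimes> x"
  using assms
proof (induction "card E" arbitrary: E x y rule: less_induct)
  case less
  note E = less.prems(1)
  have Ec: "\<And>x. x \<in> E \<Longrightarrow> x \<in> carrier G" using subgroup.mem_carrier[OF E] .
  show ?case
  proof (cases "E = {\<one>}")
    case True
    then show ?thesis using less.prems by simp
  next
    case False
    obtain z where z: "z \<in> E" "z \<noteq> \<one>" "\<And>x. x \<in> E \<Longrightarrow> x \<otimes> z = z \<otimes> x"
      using exponent_p_center[OF E less.prems(2) less.prems(3) False] by blast
    obtain N where N: "N \<in> F" "z \<notin> N" using obtain_member_avoiding z Ec by blast
    let ?U = "E \<inter> N"
    have U: "subgroup ?U G" using subgroup_Int[OF E F_subgroup[OF N(1)]] .
    have "card ?U < card E" using subgroup_psubset_card[OF E, of ?U] z N by blast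
    then have ab: "u \<otimes> v = v \<otimes> u" if "u \<in> ?U" "v \<in> ?U" for u v
      using less.hyps[OF _ U less.prems(2)] less.prems(3) that by blast
    have cent: "centralizer_in E {x} = E" if "x \<in> E" "\<And>u. u \<in> ?U \<Longrightarrow> u \<otimes> x = x \<otimes> u" for x
    proof -
      have "?U \<subseteq> centralizer_in E {x}" "z \<in> centralizer_in E {x}" "centralizer_in E {x} \<subseteq> E"
        using that z by (auto simp: centralizer_in_def)
      then show ?thesis
        using adjacentD[OF F_trace[OF N(1) E] centralizer_in_subgroup[OF E, of "{x}"]] that Ec N by blast
    qed
    have "u \<otimes> x = x \<otimes> u" if "u \<in> ?U" "x \<in> E" for u x
    proof -
      have "x \<in> centralizer_in E {u}" using cent[of u] ab that by blast
      then show ?thesis by (simp add: centralizer_in_def)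
    qed
    then have "x \<in> centralizer_in E {y}" using cent[of y] less.prems by blast
    then show ?thesis by (simp add: centralizer_in_def)
  qed
qed

lemma factor_by_normal:
  assumes N: "N \<in> F" and H: "subgroup H G" and A: "subgroup A G" "A \<subseteq> H" "\<not> A \<subseteq> N"
    and nrm: "\<And>h a. \<lbrakk>h \<in> H; a \<in> A\<rbrakk> \<Longrightarrow> conj_by h a \<in> A"
  shows "H = A <#> (H \<inter> N)"
  using adjacent_factor[OF F_trace[OF N H] subgroup_Int[OF H F_subgroup[OF N]] H _ A(1,2)] A(3) nrm by blast

text \<open>
  Let \<open>r\<close> be the largest prime dividing \<open>|D|\<close> and \<open>A\<close> the subgroup of
  elements of exponent \<open>r\<close> in \<open>D\<close>, which is normal in \<open>H\<close> and abelian.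
  For \<open>r = p\<close>, a member \<open>N\<close> not containing \<open>A\<close> gives \<open>H = A (H
  \<inter> N)\<close>, and the \<open>p\<close>-torsion of \<open>H\<close> is the product of \<open>A\<close>
  and that of \<open>H \<inter> N\<close>. For \<open>r < p\<close>, a \<open>p\<close>-element cannot act
  nontrivially on the factors \<open>A/(A \<inter> N)\<close> of order \<open>r\<close>, so it centralizes
  \<open>A\<close>; the \<open>p\<close>-torsion of \<open>H\<close> lies in the centralizer of
  \<open>A\<close>, or, when \<open>A\<close> is central, in \<open>H \<inter> N\<close>.
\<close>
lemma torsion_subgroup_of_normal:
  assumes IH: "\<And>K s. \<lbrakk>subgroup K G; K \<subset> H; prime s; \<And>r. \<lbrakk>prime r; r dvd card K\<rbrakk> \<Longrightarrow> r \<le> s\<rbrakk> \<Longrightarrow> subgroup (torsion s K) G"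
    and H: "subgroup H G" and p: "prime p" and le: "\<And>r. \<lbrakk>prime r; r dvd card H\<rbrakk> \<Longrightarrow> r \<le> p"
    and D: "subgroup D G" "D \<subset> H" "D \<noteq> {\<one>}" and Dn: "\<And>h d. \<lbrakk>h \<in> H; d \<in> D\<rbrakk> \<Longrightarrow> conj_by h d \<in> D"
  shows "subgroup (torsion p H) G"
proof -
  have Hc: "\<And>h. h \<in> H \<Longrightarrow> h \<in> carrier G" using subgroup.mem_carrier[OF H] .
  have IHp: "subgroup (torsion p K) G" if K: "subgroup K G" "K \<subset> H" for K
  proof (rule IH[OF K p])
    fix r :: nat assume r: "prime r" "r dvd card K"
    have "card K dvd card H" using subgroup_card_dvd[OF K(1) H] K by blast
    then show "r \<le> p" using le[OF r(1)] r(2) dvd_trans by blast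
  qed
  have D1: "card D \<noteq> 1" using card_subgroup_eq_1[OF D(1)] D(3) by blast
  have D0: "card D > 0" using card_subgroup_pos[OF D(1)] .
  obtain r where r: "prime r" "r dvd card D" and rmax: "\<And>s. \<lbrakk>prime s; s dvd card D\<rbrakk> \<Longrightarrow> s \<le> r"
    using obtain_largest_prime_divisor[OF D0 D1] by blast
  define A where "A = torsion r D"
  have A: "subgroup A G" unfolding A_def by (rule IH[OF D(1,2) r(1) rmax])
  have AH: "A \<subseteq> H" using D torsion_subset unfolding A_def by blast
  obtain a0 where a0: "a0 \<in> A" "a0 \<noteq> \<one>" using cauchy[OF D(1) r] by (auto simp: A_def torsion_def)
  have An: "conj_by h a \<in> A" if "h \<in> H" "a \<in> A" for h a
    using conj_by_torsion[of D h a r D] that Dn[of h a] torsion_subset subgroup.subset[OF D(1)] Hc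
    unfolding A_def by blast
  have Ar: "a [^] r = \<one>" if "a \<in> A" for a using that torsion_pow by (simp add: A_def)
  have Aab: "a \<otimes> b = b \<otimes> a" if "a \<in> A" "b \<in> A" for a b
    using exponent_p_commute[OF A r(1) Ar that] .
  have rp: "r \<le> p" using le r subgroup_card_dvd[OF D(1) H] D(2) dvd_trans by blast
  obtain N where N: "N \<in> F" "a0 \<notin> N" using obtain_member_avoiding a0 AH Hc by blast
  let ?K = "H \<inter> N"
  have K: "subgroup ?K G" "?K \<subset> H" using subgroup_Int[OF H F_subgroup[OF N(1)]] N a0 AH by auto
  have fac: "H = A <#> ?K" using factor_by_normal[OF N(1) H A AH _ An] N a0 by blast
  have P1: "subgroup (torsion p ?K) G" using IHp[OF K] .
  show ?thesis
  proof (cases "r = p")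
    case True
    \<comment> \<open>for \<open>x = a n\<close>, the powers \<open>x\<^sup>p\<close> and \<open>n\<^sup>p\<close> agree modulo \<open>A\<close>; membership in \<open>A\<close> gives trivial \<open>p\<^sup>2\<close>-th powers, hence trivial \<open>p\<close>-th powers\<close>
    have "torsion p H = A <#> torsion p ?K"
    proof
      show "torsion p H \<subseteq> A <#> torsion p ?K"
      proof
        fix x assume x: "x \<in> torsion p H"
        then have "x \<in> A <#> ?K" using fac torsion_subset by blast
        then obtain a n where an: "a \<in> A" "n \<in> ?K" "x = a \<otimes> n" by (rule set_multE)
        obtain b where b: "b \<in> A" "x [^] p = b \<otimes> n [^] p"
          using mult_pow_normalized[OF A _ An, of n a p] an Hc by blast
        have nc: "n \<in> carrier G" using an Hc by blast
        have bc: "b \<in> carrier G" using subgroup.mem_carrier[OF A b(1)] .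
        have "\<one> = b \<otimes> n [^] p" using b torsion_pow[OF x] by simp
        then have "n [^] p = inv b" using nc bc by (metis inv_equality inv_inv nat_pow_closed inv_closed)
        then have "n [^] p \<in> A" using b subgroup.m_inv_closed[OF A] by simp
        then have "(n [^] p) [^] p = \<one>" using Ar True by simp
        then have "n [^] p = \<one>" using pow_square_eq_one[OF p nc] nc by (simp add: nat_pow_pow)
        then show "x \<in> A <#> torsion p ?K" unfolding an(3) using an by (intro set_multI) (auto simp: torsion_def)
      qed
      show "A <#> torsion p ?K \<subseteq> torsion p H"
      proof
        fix x assume "x \<in> A <#> torsion p ?K"
        then obtain a n where an: "a \<in> A" "n \<in> torsion p ?K" "x = a \<otimes> n" by (rule set_multE)
        have nK: "n \<in> ?K" using an torsion_subset by blast
        obtain b where b: "b \<in> A" "x [^] p = b \<otimes> n [^] p"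
          using mult_pow_normalized[OF A _ An, of n a p] an nK Hc by blast
        have xH: "x \<in> H" using an nK AH subgroup.m_closed[OF H] by blast
        have "x [^] p \<in> A" using b torsion_pow[OF an(2)] subgroup.mem_carrier[OF A b(1)] by simp
        then have "(x [^] p) [^] p = \<one>" using Ar True by simp
        then have "x [^] p = \<one>" using pow_square_eq_one[OF p Hc[OF xH]] Hc[OF xH] by (simp add: nat_pow_pow)
        then show "x \<in> torsion p H" using xH by (simp add: torsion_def)
      qed
    qed
    moreover have "subgroup (A <#> torsion p ?K) G"
      by (rule set_mult_subgroup[OF A P1]) (use An torsion_subset in blast)
    ultimately show ?thesis by simp
  next
    case False
    have rlt: "r < p" using False rp by simp
    have cent: "x \<otimes> a = a \<otimes> x" if x: "x \<in> torsion p H" and a: "a \<in> A" for x a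
    proof -
      have xH: "x \<in> H" using x torsion_subset by blast
      have c: "x \<in> carrier G" "a \<in> carrier G" using xH Hc a AH by auto
      have "conj_by x a \<otimes> inv a = \<one>"
      proof (rule F_trivial)
        show "conj_by x a \<otimes> inv a \<in> carrier G" using c by simp
        fix L assume L: "L \<in> F"
        show "conj_by x a \<otimes> inv a \<in> L"
        proof (cases "A \<subseteq> L")
          case True
          then show ?thesis using An[OF xH a] a F_subgroup[OF L]
            by (meson subgroup.m_closed subgroup.m_inv_closed subsetD)
        next
          case False
          then obtain y where y: "y \<in> A" "y \<notin> L" by blast
          let ?B = "A \<inter> L"
          have B: "subgroup ?B G" using subgroup_Int[OF A F_subgroup[OF L]] .
          have fL: "H = A <#> (H \<inter> L)" using factor_by_normal[OF L H A AH False An] .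
          have AHL: "A \<subseteq> carrier G" "H \<inter> L \<subseteq> carrier G" using AH Hc by auto
          \<comment> \<open>\<open>H\<close> is the product of \<open>A\<close>, which is abelian, and \<open>H \<inter> L\<close>, which normalizes both \<open>A\<close> and \<open>L\<close>\<close>
          have Bn: "conj_by h b \<in> ?B" if h: "h \<in> H" and b: "b \<in> ?B" for h b
          proof -
            have "h \<in> A <#> (H \<inter> L)" using h fL by blast
            then obtain a' k where ak: "a' \<in> A" "k \<in> H \<inter> L" "h = a' \<otimes> k" by (rule set_multE)
            have kb: "conj_by k b \<in> ?B" using ak b An conj_by_mem_subgroup[OF F_subgroup[OF L]] by blast
            have "conj_by a' (conj_by k b) = conj_by k b"
              using conj_by_eq_self_iff[of a' "conj_by k b"] Aab[of a' "conj_by k b"] ak kb AHL by blast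
            moreover have "conj_by h b = conj_by a' (conj_by k b)"
              unfolding ak(3) using ak b AHL by (intro conj_by_comp[symmetric]) auto
            ultimately have "conj_by h b = conj_by k b" by simp
            then show ?thesis using kb by simp
          qed
          have yB: "y \<notin> ?B" "?B \<subseteq> A" and yH: "y \<in> H" using y AH by auto
          obtain q where q: "prime q" "\<And>k::nat. y [^] k \<in> ?B \<longleftrightarrow> q dvd k"
            "\<And>x. x \<in> A \<Longrightarrow> \<exists>u\<in>?B. \<exists>i::nat. x = u \<otimes> y [^] i"
            using adjacent_cyclic[OF B A yB(2) F_trace[OF L A] y(1) yB(1) Bn[OF yH]] by blast
          have "q dvd r" using q(2)[of r] Ar[OF y(1)] subgroup.one_closed[OF B] by simp
          then have qr: "q = r" using q(1) r(1) primes_dvd_imp_eq by blast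
          interpret S: cyclic_section G ?B y r
            using B Hc[OF yH] r(1) q(2) Bn[OF yH] unfolding qr
            by (intro cyclic_section.intro[OF fin_group_axioms] cyclic_section_axioms.intro)
          obtain i where ai: "S.acts x i" 
            using q(3)[OF An[OF xH y(1)]] c Bn xH unfolding S.acts_def by blast
          have "S.acts (x [^] p) 1" using S.acts_one torsion_pow[OF x] by simp
          moreover have "coprime p (r - 1)"
            using p rlt prime_gt_1_nat[OF r(1)] by (intro prime_imp_coprime) (auto dest!: dvd_imp_le)
          ultimately have a1: "S.acts x 1" using S.acts_one_of_coprime_pow[OF ai] prime_gt_0_nat[OF p] by blast
          obtain v k where "v \<in> ?B" "a = v \<otimes> y [^] (k::nat)" using q(3)[OF a] by blast
          then show ?thesis using S.acts_trivially[OF a1] by blast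
        qed
      qed
      then have "conj_by x a = a" using c inv_solve_right'[of \<one> "conj_by x a" a] by simp
      then show ?thesis using conj_by_eq_self_iff c by blast
    qed
    have C: "subgroup (centralizer_in H A) G" using centralizer_in_subgroup[OF H] AH Hc by blast
    show ?thesis
    proof (cases "centralizer_in H A = H")
      case False
      have "torsion p H = torsion p (centralizer_in H A)"
        using cent by (auto simp: torsion_def centralizer_in_def)
      moreover have "centralizer_in H A \<subset> H" using False by (auto simp: centralizer_in_def)
      ultimately show ?thesis using IHp[OF C] by simp
    next
      case True
      have "torsion p H = torsion p ?K"
      proof
        show "torsion p H \<subseteq> torsion p ?K"
        proof
          fix x assume x: "x \<in> torsion p H"
          then have xH: "x \<in> H" using torsion_subset by blast
          then have "x \<in> A <#> ?K" using fac by blast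
          then obtain b n where bn: "b \<in> A" "n \<in> ?K" "x = b \<otimes> n" by (rule set_multE)
          have bc: "b \<in> carrier G" "n \<in> carrier G" using bn AH Hc by auto
          have "n \<in> centralizer_in H A" using True bn by blast
          then have "b \<otimes> n = n \<otimes> b" using bn by (auto simp: centralizer_in_def)
          then have "x [^] r = b [^] r \<otimes> n [^] r" using bn bc pow_mult_distrib by simp
          then have "x [^] r = n [^] r" using Ar[OF bn(1)] bc by simp
          then have "x [^] r \<in> N" using bn subgroup_nat_pow_closed[OF F_subgroup[OF N(1)]] by simp
          moreover have "x [^] p \<in> N" using torsion_pow[OF x] subgroup.one_closed[OF F_subgroup[OF N(1)]] by simp
          moreover have "coprime r p" using primes_coprime r(1) p rlt by blast
          ultimately have "x \<in> N" using pow_coprime_mem[OF F_subgroup[OF N(1)] Hc[OF xH]] by blast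
          then show "x \<in> torsion p ?K" using x by (auto simp: torsion_def)
        qed
      qed (auto simp: torsion_def)
      then show ?thesis using P1 by simp
    qed
  qed
qed

end

section \<open>The simple case\<close>

text \<open>
  A simple group \<open>H\<close> cut by a member \<open>N\<close> in a nontrivial subgroup \<open>M\<close>
  that has a normal Sylow subgroup \<open>P\<close> for its largest prime \<open>p\<close>. The point of the
  locale is that its assumptions are contradictory.
\<close>
locale simple_trace = trace_family +
  fixes H N :: "'a set" and p :: nat
  assumes H: "subgroup H G"
    and simple: "\<lbrakk>subgroup D G; D \<subset> H; \<And>h d. \<lbrakk>h \<in> H; d \<in> D\<rbrakk> \<Longrightarrow> conj_by h d \<in> D\<rbrakk> \<Longrightarrow> D = {\<one>}"
    and N: "N \<in> F" and not_le: "\<not> H \<subseteq> N"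
    and p: "prime p"
    and P_subgroup: "subgroup (torsion p (H \<inter> N)) G"
    and P_nontrivial: "torsion p (H \<inter> N) \<noteq> {\<one>}"
    and p_largest: "\<lbrakk>prime r; r dvd card (H \<inter> N)\<rbrakk> \<Longrightarrow> r \<le> p"
begin

definition M :: "'a set" where "M = H \<inter> N"
definition P :: "'a set" where "P = torsion p M"

lemma Hc: "x \<in> H \<Longrightarrow> x \<in> carrier G" using subgroup.mem_carrier[OF H] .
lemma M_subgroup: "subgroup M G" unfolding M_def using subgroup_Int[OF H F_subgroup[OF N]] .
lemma P_is_subgroup: "subgroup P G" using P_subgroup by (simp add: P_def M_def)
lemma M_H: "M \<subseteq> H" "M \<noteq> H" using not_le by (auto simp: M_def)
lemma M_N: "M \<subseteq> N" by (auto simp: M_def)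
lemma P_M: "P \<subseteq> M" using torsion_subset by (simp add: P_def)
lemma P_pow: "a \<in> P \<Longrightarrow> a [^] p = \<one>" using torsion_pow by (simp add: P_def)
lemma P_not_one: "P \<noteq> {\<one>}" using P_nontrivial by (simp add: P_def M_def)
lemma mem_P: "\<lbrakk>a \<in> M; a [^] p = \<one>\<rbrakk> \<Longrightarrow> a \<in> P" by (simp add: P_def torsion_def)
lemma M_maximal: "adjacent G M H" using F_trace[OF N H] by (simp add: M_def)
lemma conj_H: "\<lbrakk>x \<in> H; a \<in> H\<rbrakk> \<Longrightarrow> conj_by x a \<in> H" using conj_by_mem_subgroup[OF H] .
lemma inv_H: "x \<in> H \<Longrightarrow> inv x \<in> H" using subgroup.m_inv_closed[OF H] .

lemma P_commute: "\<lbrakk>a \<in> P; b \<in> P\<rbrakk> \<Longrightarrow> a \<otimes> b = b \<otimes> a"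
  using exponent_p_commute[OF P_is_subgroup p P_pow] .

lemma above_M: "\<lbrakk>subgroup C G; M \<subseteq> C; C \<subseteq> H; \<not> C \<subseteq> M\<rbrakk> \<Longrightarrow> C = H"
  using adjacentD[OF M_maximal] by blast

lemma P_normal: "\<lbrakk>m \<in> M; a \<in> P\<rbrakk> \<Longrightarrow> conj_by m a \<in> P"
  using conj_by_mem_subgroup[OF M_subgroup] P_M conj_by_pow[of m a p] P_pow
    subgroup.mem_carrier[OF M_subgroup] by (metis mem_P conj_by_one_right subsetD)

text \<open>
  The elements all of whose conjugates lie in \<open>N\<close> form a normal subgroup of \<open>H\<close>.
\<close>
lemma core_trivial:
  assumes x: "x \<in> H" and all: "\<And>y. y \<in> H \<Longrightarrow> conj_by y x \<in> N"
  shows "x = \<one>"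
proof -
  let ?D = "{x \<in> H. \<forall>y\<in>H. conj_by y x \<in> N}"
  note sN = F_subgroup[OF N]
  have "subgroup ?D G"
  proof (rule subgroupI)
    show "?D \<subseteq> carrier G" using Hc by blast
    have "\<one> \<in> ?D" using subgroup.one_closed[OF H] subgroup.one_closed[OF sN] Hc by simp
    then show "?D \<noteq> {}" by blast
    fix a assume a: "a \<in> ?D"
    then show "inv a \<in> ?D" using inv_H Hc subgroup.m_inv_closed[OF sN] by (simp add: conj_by_inv)
    fix b assume "b \<in> ?D"
    then show "a \<otimes> b \<in> ?D"
      using a Hc subgroup.m_closed[OF H] subgroup.m_closed[OF sN] by (simp add: conj_by_mult)
  qed
  moreover have "?D \<subset> H"
  proof -
    have "a \<in> N" if "a \<in> ?D" for a
    proof -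
      have "conj_by \<one> a \<in> N" using that subgroup.one_closed[OF H] by blast
      then show ?thesis using that Hc by simp
    qed
    then have "\<not> H \<subseteq> ?D" using not_le by (meson subset_eq)
    then show ?thesis by blast
  qed
  moreover have "conj_by h d \<in> ?D" if h: "h \<in> H" and d: "d \<in> ?D" for h d
  proof -
    have "conj_by y (conj_by h d) \<in> N" if y: "y \<in> H" for y
      using that h d Hc subgroup.m_closed[OF H] by (simp add: conj_by_comp)
    then show ?thesis using h d conj_H by blast
  qed
  ultimately have "?D = {\<one>}" by (rule simple)
  moreover have "x \<in> ?D" using x all by blast
  ultimately show ?thesis by blast
qed

text \<open>
  The normalizer of a nontrivial normal subgroup of \<open>M\<close> contains the maximal subgroup
  \<open>M\<close> and is not \<open>H\<close>.
\<close>
lemma normalizes_in_M: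
  assumes Y: "subgroup Y G" "Y \<subseteq> M" "Y \<noteq> {\<one>}" and MY: "\<And>m a. \<lbrakk>m \<in> M; a \<in> Y\<rbrakk> \<Longrightarrow> conj_by m a \<in> Y"
    and x: "x \<in> H" "\<And>a. a \<in> Y \<Longrightarrow> conj_by x a \<in> Y"
  shows "x \<in> M"
proof (rule ccontr)
  assume xM: "x \<notin> M"
  have Yc: "Y \<subseteq> carrier G" using subgroup.subset[OF Y(1)] .
  have "normalizer_in H Y = H"
  proof (rule above_M)
    show "subgroup (normalizer_in H Y) G" by (rule normalizer_in_subgroup[OF H Yc])
    show "M \<subseteq> normalizer_in H Y" using M_H MY conj_by_image_eqI[OF _ Yc] Hc by (auto simp: normalizer_in_def)
    have "x \<in> normalizer_in H Y" using x conj_by_image_eqI[OF Hc Yc] by (auto simp: normalizer_in_def)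
    then show "\<not> normalizer_in H Y \<subseteq> M" using xM by blast
  qed (auto simp: normalizer_in_def)
  then have "\<And>h d. \<lbrakk>h \<in> H; d \<in> Y\<rbrakk> \<Longrightarrow> conj_by h d \<in> Y" by (auto simp: normalizer_in_def)
  then have "Y = {\<one>}" using simple[OF Y(1)] Y M_H by blast
  then show False using Y by blast
qed

lemma conj_mem_M: "\<lbrakk>x \<in> H; a \<in> H; a \<in> conj_by x ` N\<rbrakk> \<Longrightarrow> conj_by (inv x) a \<in> M"
  using mem_conj_by_image_iff[of x N a] Hc subgroup.subset[OF F_subgroup[OF N]] conj_H inv_H
  by (simp add: M_def)

lemma conj_mem_P: "\<lbrakk>x \<in> H; a \<in> P; a \<in> conj_by x ` N\<rbrakk> \<Longrightarrow> conj_by (inv x) a \<in> P"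
  using conj_mem_M[of x a] mem_P P_M M_H P_pow[of a] conj_by_pow[of "inv x" a p] Hc inv_H
  by (metis conj_by_one_right subsetD)

text \<open>
  Otherwise \<open>x\<close> would normalize \<open>P\<close>, because the \<open>p\<close>-torsion of the
  conjugate of \<open>M\<close> is the conjugate of \<open>P\<close>.
\<close>
lemma P_not_le: assumes "x \<in> H" "x \<notin> M" shows "\<not> P \<subseteq> conj_by x ` N"
proof
  assume "P \<subseteq> conj_by x ` N"
  then have "inv x \<in> M" using normalizes_in_M[OF P_is_subgroup P_M P_not_one P_normal inv_H] conj_mem_P assms by blast
  then show False using assms subgroup.m_inv_closed[OF M_subgroup] Hc by force
qed

definition T :: "'a \<Rightarrow> 'a set" where "T x = M \<inter> conj_by x ` N"

lemma T_subgroup: "x \<in> H \<Longrightarrow> subgroup (T x) G"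
  unfolding T_def using subgroup_Int[OF M_subgroup F_subgroup] F_conj[OF N] Hc by blast

lemma T_maximal: "x \<in> H \<Longrightarrow> adjacent G (T x) M"
  unfolding T_def using F_trace[OF F_conj[OF N Hc] M_subgroup] .

lemma T_M: "T x \<subseteq> M" by (auto simp: T_def)

lemma Mc: "x \<in> M \<Longrightarrow> x \<in> carrier G" using M_H Hc by blast
lemma Pc: "x \<in> P \<Longrightarrow> x \<in> carrier G" using P_M Mc by blast

lemma M_factor: assumes "x \<in> H" "x \<notin> M" shows "M = P <#> T x"
proof (rule adjacent_factor[OF T_maximal T_subgroup M_subgroup T_M P_is_subgroup P_M])
  show "\<not> P \<subseteq> T x" using P_not_le[OF assms] by (auto simp: T_def)
  show "\<And>u a. u \<in> T x \<Longrightarrow> a \<in> P \<Longrightarrow> conj_by u a \<in> P" using P_normal T_M by blast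
qed (use assms in auto)

lemma P_Int_normal_M:
  assumes x: "x \<in> H" "x \<notin> M" and m: "m \<in> M" and a: "a \<in> P" "a \<in> conj_by x ` N"
  shows "conj_by m a \<in> P \<inter> conj_by x ` N"
proof -
  have "m \<in> P <#> T x" using m M_factor[OF x] by blast
  then obtain u t where ut: "u \<in> P" "t \<in> T x" "m = u \<otimes> t" by (rule set_multE)
  have tN: "t \<in> M" "t \<in> conj_by x ` N" using ut by (auto simp: T_def)
  have N': "subgroup (conj_by x ` N) G" using F_subgroup[OF F_conj[OF N Hc[OF x(1)]]] .
  have 1: "conj_by t a \<in> P" "conj_by t a \<in> conj_by x ` N"
    using P_normal[OF tN(1) a(1)] conj_by_mem_subgroup[OF N' tN(2) a(2)] by auto
  have "conj_by u (conj_by t a) = conj_by t a"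
    using conj_by_eq_self_iff[of u "conj_by t a"] P_commute[OF ut(1) 1(1)] Pc ut 1 by blast
  then show ?thesis using 1 ut tN a Pc Mc by (simp add: conj_by_comp)
qed

text \<open>
  For a conjugate \<open>P'\<close> of \<open>P\<close> by an element outside \<open>M\<close>, the intersection
  \<open>P \<inter> P'\<close> is normalized by \<open>M\<close> and, by symmetry, by the corresponding
  conjugate of \<open>M\<close>; together they generate \<open>H\<close>.
\<close>
lemma P_Int_trivial:
  assumes x: "x \<in> H" "x \<notin> M"
  shows "P \<inter> conj_by x ` N = {\<one>}"
proof (rule ccontr)
  let ?Y = "P \<inter> conj_by x ` N"
  assume ne: "?Y \<noteq> {\<one>}"
  have Y: "subgroup ?Y G" using subgroup_Int[OF P_is_subgroup] F_subgroup[OF F_conj[OF N Hc[OF x(1)]]] by blast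
  have YM: "?Y \<subseteq> M" using P_M by blast
  have xi: "inv x \<in> H" "inv x \<notin> M" using x inv_H subgroup.m_inv_closed[OF M_subgroup] Hc by force+
  have YM': "\<And>m a. \<lbrakk>m \<in> M; a \<in> ?Y\<rbrakk> \<Longrightarrow> conj_by m a \<in> ?Y" using P_Int_normal_M[OF x] by blast
  \<comment> \<open>the conjugate of \<open>M\<close> by \<open>x\<close> normalizes \<open>?Y\<close>: transport \<open>P_Int_normal_M\<close> for \<open>inv x\<close>\<close>
  have key: "conj_by x (conj_by m (conj_by (inv x) a)) \<in> ?Y" if m: "m \<in> M" and a: "a \<in> ?Y" for m a
  proof -
    have c: "a \<in> carrier G" "m \<in> carrier G" "x \<in> carrier G" using a m Pc Mc x Hc by auto
    have z: "conj_by (inv x) a \<in> P" using conj_mem_P[OF x(1)] a by blast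
    have z': "conj_by (inv x) a \<in> conj_by (inv x) ` N" using a P_M M_N by blast
    have w: "conj_by m (conj_by (inv x) a) \<in> P" "conj_by m (conj_by (inv x) a) \<in> conj_by (inv x) ` N"
      using P_Int_normal_M[OF xi m z z'] by auto
    have "conj_by (inv (inv x)) (conj_by m (conj_by (inv x) a)) \<in> P"
      using conj_mem_P[OF xi(1) w] .
    moreover have "conj_by m (conj_by (inv x) a) \<in> N" using w P_M M_N by blast
    ultimately show ?thesis using c by simp
  qed
  have "x \<in> M"
  proof -
    have "\<exists>a\<in>P. conj_by x a \<notin> M"
    proof (rule ccontr)
      assume "\<not> ?thesis"
      then have "\<And>a. a \<in> P \<Longrightarrow> conj_by x a \<in> P"
        using mem_P P_pow conj_by_pow Hc x Pc by (metis conj_by_one_right)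
      then show False using normalizes_in_M[OF P_is_subgroup P_M P_not_one P_normal x(1)] x by blast
    qed
    then obtain b where b: "b \<in> P" "conj_by x b \<notin> M" by blast
    have "conj_by x b \<in> M"
    proof (rule normalizes_in_M[OF Y YM ne YM'])
      show "conj_by x b \<in> H" using conj_H x b P_M M_H by blast
      fix a assume a: "a \<in> ?Y"
      have bc: "b \<in> carrier G" "x \<in> carrier G" "a \<in> carrier G" using b a Pc x Hc by auto
      have "conj_by (conj_by x b) a = conj_by x (conj_by b (conj_by (inv x) a))"
        using bc by (simp add: conj_by_comp m_assoc) (simp add: conj_by_def m_assoc)
      then show "conj_by (conj_by x b) a \<in> ?Y" using key b P_M a by auto
    qed auto
    then show ?thesis using b by blast
  qed
  then show False using x by blast
qed

lemma obtain_outside_M: obtains x where "x \<in> H" "x \<notin> M"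
  using M_H by blast

lemma P_minimal: "adjacent G {\<one>} P"
  using obtain_outside_M P_Int_trivial F_trace[OF F_conj[OF N Hc] P_is_subgroup] by metis

lemma P_generated:
  assumes "y \<in> P" "y \<noteq> \<one>"
  shows "\<And>k::nat. y [^] k = \<one> \<longleftrightarrow> p dvd k" "\<And>a. a \<in> P \<Longrightarrow> \<exists>i::nat. a = y [^] i" "card P = p"
proof -
  obtain q where q: "prime q" "\<And>k::nat. y [^] k = \<one> \<longleftrightarrow> q dvd k" "\<And>a. a \<in> P \<Longrightarrow> \<exists>i::nat. a = y [^] i" "card P = q"
    using adjacent_one_generated[OF P_is_subgroup P_minimal assms] by blast
  have "q = p" using q P_pow assms p primes_dvd_imp_eq by blast
  then show "\<And>k::nat. y [^] k = \<one> \<longleftrightarrow> p dvd k" "\<And>a. a \<in> P \<Longrightarrow> \<exists>i::nat. a = y [^] i" "card P = p"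
    using q by auto
qed

lemma obtain_P_generator: obtains y where "y \<in> P" "y \<noteq> \<one>"
  using P_not_one subgroup.one_closed[OF P_is_subgroup] by blast

lemma commutes_with_P:
  assumes "y \<in> P" "y \<noteq> \<one>" "g \<in> carrier G" "g \<otimes> y = y \<otimes> g" "a \<in> P"
  shows "g \<otimes> a = a \<otimes> g"
proof -
  obtain i where i: "a = y [^] (i::nat)" using P_generated(2) assms by blast
  have "conj_by g y = y" using conj_by_eq_self_iff assms Pc by blast
  then have "conj_by g a = a" using i conj_by_pow assms Pc by simp
  then show ?thesis using conj_by_eq_self_iff assms Pc by blast
qed

text \<open>
  Let \<open>N'\<close> be a conjugate of \<open>N\<close> by an element outside \<open>M\<close>. Its trace on
  \<open>P \<langle>c\<rangle>\<close> does not contain \<open>P\<close>, so it supplements \<open>P\<close>,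
  and \<open>c = u n\<close> with commuting factors \<open>u \<in> P\<close> and \<open>n \<in> N'\<close>. Then
  \<open>c\<^sup>p = n\<^sup>p\<close> lies in \<open>N'\<close>, and so does \<open>c\<close>, since the order
  of \<open>c\<close> is prime to \<open>p\<close>. Hence \<open>c\<close> lies in all conjugates of
  \<open>N\<close>.
\<close>
lemma T_centralizer_trivial:
  assumes x: "x \<in> H" "x \<notin> M" and c: "c \<in> T x" and comm: "\<And>a. a \<in> P \<Longrightarrow> c \<otimes> a = a \<otimes> c"
  shows "c = \<one>"
proof (rule core_trivial)
  have cM: "c \<in> M" using c T_M by blast
  have cc: "c \<in> carrier G" using cM Mc by blast
  show "c \<in> H" using cM M_H by blast
  fix w assume w: "w \<in> H"
  show "conj_by w c \<in> N"
  proof (cases "w \<in> M")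
    case True
    then show ?thesis using conj_by_mem_subgroup[OF F_subgroup[OF N]] M_N cM by blast
  next
    case False
    define y where "y = inv w"
    have y: "y \<in> H" "y \<notin> M" using w False inv_H subgroup.m_inv_closed[OF M_subgroup, of y] Hc by (auto simp: y_def)
    let ?C = "{c [^] (k::nat) | k. True}"
    have C: "subgroup ?C G" using powers_subgroup cc by blast
    have CM: "?C \<subseteq> M" using subgroup_nat_pow_closed[OF M_subgroup cM] by blast
    have Z: "subgroup (P <#> ?C) G" by (rule set_mult_subgroup[OF P_is_subgroup C]) (use P_normal CM in blast)
    have ZM: "P <#> ?C \<subseteq> M" using set_mult_least[OF M_subgroup P_M CM] .
    let ?N = "conj_by y ` N"
    have yN: "?N \<in> F" using F_conj[OF N] Hc y by blast
    have "P <#> ?C = P <#> ((P <#> ?C) \<inter> ?N)"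
    proof (rule factor_by_normal[OF yN Z P_is_subgroup set_mult_incl(1)[OF P_is_subgroup C] P_not_le[OF y]])
      show "\<And>h a. h \<in> P <#> ?C \<Longrightarrow> a \<in> P \<Longrightarrow> conj_by h a \<in> P" using P_normal ZM by blast
    qed
    moreover have "c \<in> P <#> ?C"
    proof -
      have "c [^] (1::nat) \<in> ?C" by blast
      then show ?thesis using cc set_mult_incl(2)[OF P_is_subgroup C] by auto
    qed
    ultimately have "c \<in> P <#> ((P <#> ?C) \<inter> ?N)" by blast
    then obtain u n where un0: "u \<in> P" "n \<in> (P <#> ?C) \<inter> ?N" "c = u \<otimes> n" by (rule set_multE)
    have un: "u \<in> P" "n \<in> ?N" "n \<in> P <#> ?C" "c = u \<otimes> n" using un0 by auto
    have nc: "n \<in> carrier G" "u \<in> carrier G" using un ZM Mc Pc by auto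
    have nu: "n = inv u \<otimes> c" using un(4) nc by (simp add: m_assoc[symmetric])
    have iu: "inv u \<in> P" using un subgroup.m_inv_closed[OF P_is_subgroup] by blast
    have "n [^] p = (inv u) [^] p \<otimes> c [^] p"
      unfolding nu using pow_mult_distrib[OF comm[OF iu, symmetric]] nc cc by simp
    then have "n [^] p = c [^] p" using P_pow[OF iu] cc by simp
    then have cp: "c [^] p \<in> ?N" using subgroup_nat_pow_closed[OF F_subgroup[OF yN] un(2)] by metis
    obtain m where m: "m > 0" "\<And>k::nat. c [^] k \<in> {\<one>} \<longleftrightarrow> m dvd k" using relative_order[OF triv_subgroup cc] by blast
    have "\<not> p dvd m"
    proof
      assume "p dvd m"
      then obtain j where j: "m = j * p" by (metis dvd_div_mult_self)
      have "(c [^] j) [^] p = \<one>" using m(2)[of m] j cc by (simp add: nat_pow_pow)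
      then have "c [^] j \<in> P" using mem_P subgroup_nat_pow_closed[OF M_subgroup cM] by blast
      moreover have "c [^] j \<in> conj_by x ` N"
        using c subgroup_nat_pow_closed[OF F_subgroup[OF F_conj[OF N Hc[OF x(1)]]]] by (auto simp: T_def)
      ultimately have "c [^] j = \<one>" using P_Int_trivial[OF x] by blast
      then have "m dvd j" using m(2) by blast
      then have "j * p dvd j * 1" using j by simp
      then have "p dvd 1" using m(1) j by (simp only: nat_mult_dvd_cancel_disj) simp
      then show False using p by auto
    qed
    then have "coprime p m" using p prime_imp_coprime by blast
    moreover have "c [^] m \<in> ?N" using m(2)[of m] subgroup.one_closed[OF F_subgroup[OF yN]] by auto
    ultimately have "c \<in> ?N" using pow_coprime_mem[OF F_subgroup[OF yN] cc cp] by blast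
    then have "conj_by (inv y) c \<in> N"
      using mem_conj_by_image_iff[OF Hc[OF y(1)] subgroup.subset[OF F_subgroup[OF N]] cc] by simp
    then show ?thesis using y_def w Hc by simp
  qed
qed

lemma T_commute:
  assumes x: "x \<in> H" "x \<notin> M" and s: "s \<in> T x" and t: "t \<in> T x"
  shows "s \<otimes> t = t \<otimes> s"
proof -
  obtain y where y: "y \<in> P" "y \<noteq> \<one>" using obtain_P_generator .
  show ?thesis
  proof (rule faithful_on_cyclic_abelian[OF _ y(1) P_generated(2)[OF y] T_subgroup[OF x(1)] _ T_centralizer_trivial[OF x] s t])
    show "P \<subseteq> carrier G" using Pc by blast
    show "\<And>a b. a \<in> T x \<Longrightarrow> b \<in> P \<Longrightarrow> conj_by a b \<in> P" using P_normal T_M by blast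
  qed
qed

lemma T_ne_M: assumes "x \<in> H" "x \<notin> M" shows "T x \<noteq> M"
  using P_not_le[OF assms] P_M by (auto simp: T_def)

text \<open>
  The centralizer of \<open>t\<close> contains two maximal subgroups of \<open>M\<close>, hence \<open>M\<close>
  and therefore \<open>P\<close>.
\<close>
lemma T_Int_trivial:
  assumes x: "x \<in> H" "x \<notin> M" and z: "z \<in> H" "z \<notin> M" and ne: "T x \<noteq> T z"
    and t: "t \<in> T x" "t \<in> T z"
  shows "t = \<one>"
proof -
  have tc: "t \<in> carrier G" using t T_M Mc by blast
  have "\<not> T z \<subseteq> T x"
    using adjacentD[OF T_maximal[OF z(1)] T_subgroup[OF x(1)]] T_M T_ne_M[OF x] ne by blast
  moreover have "T x \<subseteq> centralizer_in M {t}" "T z \<subseteq> centralizer_in M {t}"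
    using T_commute[OF x _ t(1)] T_commute[OF z _ t(2)] T_M by (auto simp: centralizer_in_def)
  moreover have "centralizer_in M {t} \<subseteq> M" by (auto simp: centralizer_in_def)
  ultimately have "centralizer_in M {t} = M"
    using adjacentD[OF T_maximal[OF x(1)] centralizer_in_subgroup[OF M_subgroup, of "{t}"]] tc by blast
  then have "\<And>a. a \<in> P \<Longrightarrow> a \<in> centralizer_in M {t}" using P_M by blast
  then have "\<And>a. a \<in> P \<Longrightarrow> t \<otimes> a = a \<otimes> t" by (simp add: centralizer_in_def)
  then show ?thesis using T_centralizer_trivial[OF x t(1)] by blast
qed

text \<open>
  If \<open>T x = 1\<close> then \<open>M = P\<close> has prime order, is its own normalizer in
  \<open>H\<close>, and meets its other conjugates trivially. Its conjugates do not cover \<open>H\<close>. For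
  an element \<open>g\<close> outside all of them, the subgroup \<open>R\<close> generated by \<open>g\<close>
  has the same properties. The nontrivial elements of the conjugates of \<open>M\<close> make up at least half
  of the order of \<open>H\<close>, those of the conjugates of \<open>R\<close> make up another half, and the
  identity is left over.
\<close>
lemma T_nontrivial:
  assumes x: "x \<in> H" "x \<notin> M"
  shows "T x \<noteq> {\<one>}"
proof
  assume T1: "T x = {\<one>}"
  have "P <#> {\<one>} = P" using Pc by (force simp: set_mult_def)
  then have MP: "M = P" using M_factor[OF x] T1 by simp
  obtain a where a: "a \<in> P" "a \<noteq> \<one>" using obtain_P_generator .
  have cM: "card M = p" using P_generated(3)[OF a] MP by simp
  have M1: "M \<noteq> {\<one>}" using MP P_not_one by simp
  let ?IM = "(\<lambda>(x, u). conj_by x u) ` (H \<times> (M - {\<one>}))"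
  \<comment> \<open>distinct conjugates of \<open>M = P\<close> meet trivially by \<open>P_Int_trivial\<close>\<close>
  have tiM: "z \<in> M" if z: "z \<in> H" "u \<in> M" "u \<noteq> \<one>" "conj_by z u \<in> M" for z u
  proof (rule ccontr)
    assume zM: "z \<notin> M"
    have "conj_by z u \<in> P \<inter> conj_by z ` N" using z MP M_N by blast
    then have "conj_by z u = \<one>" using P_Int_trivial[OF z(1) zM] by blast
    then show False using z Hc Mc conj_by_eq_one_iff[of z u] by simp
  qed
  have IM: "card ?IM * p = card H * (p - 1)"
    using card_conjugates_disjoint[OF H M_subgroup M_H(1)] P_commute tiM MP cM by simp
  have p2: "p \<ge> 2" using p prime_ge_2_nat by blast
  have Hcard: "card H > p" using subgroup_psubset_card[OF H, of M] M_H cM by auto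
  have finH: "finite H" using finite_subgroup[OF H] .
  have IMH: "?IM \<subseteq> H - {\<one>}"
  proof
    fix b assume "b \<in> ?IM"
    then obtain z u where zu: "z \<in> H" "u \<in> M" "u \<noteq> \<one>" "b = conj_by z u" by auto
    show "b \<in> H - {\<one>}"
      using zu conj_H[of z u] M_H conj_by_eq_one_iff[of z u] Hc Mc by auto
  qed
  have "?IM \<noteq> H - {\<one>}"
  proof
    assume "?IM = H - {\<one>}"
    then have "card ?IM = card H - 1" using subgroup.one_closed[OF H] finH by simp
    then have "(card H - 1) * p = card H * (p - 1)" using IM by simp
    then have "card H * p - p = card H * p - card H" by (simp add: algebra_simps diff_mult_distrib diff_mult_distrib2)
    moreover have "card H \<le> card H * p" "p \<le> card H * p" using p2 Hcard by simp_all
    ultimately have "card H = p" by linarith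
    then show False using Hcard by simp
  qed
  then obtain g where g: "g \<in> H" "g \<noteq> \<one>" "g \<notin> ?IM" using IMH by blast
  have gN: "g \<notin> conj_by z ` N" if z: "z \<in> H" for z
  proof
    assume "g \<in> conj_by z ` N"
    then have m: "conj_by (inv z) g \<in> M" using conj_mem_M[OF z g(1)] by blast
    moreover have "conj_by (inv z) g \<noteq> \<one>" using g z Hc conj_by_eq_one_iff[of "inv z" g] by simp
    moreover have "g = conj_by z (conj_by (inv z) g)" using g z Hc by simp
    ultimately have "g \<in> ?IM" using z by (force simp: image_iff)
    then show False using g by blast
  qed
  have gN1: "g \<notin> N" using gN[OF subgroup.one_closed[OF H]] subgroup.subset[OF F_subgroup[OF N]] by simp
  have M_min: "adjacent G {\<one>} M" using P_minimal MP by simp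
  \<comment> \<open>\<open>M\<close> has prime order, so a subgroup that meets \<open>N\<close> nontrivially contains \<open>M\<close>; with \<open>g\<close> it generates \<open>H\<close>\<close>
  have meets: "Z \<inter> N = {\<one>} \<or> Z = H" if Z: "subgroup Z G" "Z \<subseteq> H" "g \<in> Z" for Z
  proof -
    have s: "subgroup (Z \<inter> N) G" using subgroup_Int[OF Z(1) F_subgroup[OF N]] .
    have "Z \<inter> N = {\<one>} \<or> Z \<inter> N = M"
      using adjacentD[OF M_min s] subgroup.one_closed[OF s] Z by (auto simp: M_def)
    moreover have "Z = H" if "Z \<inter> N = M" using above_M[OF Z(1)] that Z gN1 M_N by blast
    ultimately show ?thesis by blast
  qed
  have min: "adjacent G {\<one>} Z" if "subgroup Z G" "Z \<inter> N = {\<one>}" for Z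
    using F_trace[OF N that(1)] that(2) by simp
  define R where "R = {g [^] (k::nat) | k. True}"
  have R: "subgroup R G" unfolding R_def using powers_subgroup Hc g by blast
  have RH: "R \<subseteq> H" unfolding R_def using subgroup_nat_pow_closed[OF H g(1)] by blast
  have gR: "g \<in> R"
  proof -
    have "g [^] (1::nat) \<in> R" unfolding R_def by blast
    then show ?thesis using Hc[OF g(1)] by simp
  qed
  have Rab: "u \<otimes> v = v \<otimes> u" if "u \<in> R" "v \<in> R" for u v
    using that Hc[OF g(1)] by (auto simp: R_def nat_pow_mult add.commute)
  have RN: "R \<inter> N = {\<one>}"
  proof (rule ccontr)
    assume "R \<inter> N \<noteq> {\<one>}"
    then have e: "R = H" using meets[OF R RH gR] by blast
    have "M = {\<one>}"
    proof (rule simple[OF M_subgroup])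
      show "M \<subset> H" using M_H by blast
      fix h d assume h: "h \<in> H" and d: "d \<in> M"
      have "h \<in> R" "d \<in> R" using h d M_H unfolding e by auto
      then have "h \<otimes> d = d \<otimes> h" by (rule Rab)
      then show "conj_by h d \<in> M" using conj_by_eq_self_iff[of h d] Hc[OF h] Mc[OF d] d by simp
    qed
    then show False using M1 by blast
  qed
  have Radj: "adjacent G {\<one>} R" using min[OF R RN] .
  \<comment> \<open>\<open>R\<close> is minimal, so \<open>z\<close> normalizes it, and the normalizer of \<open>R\<close> meets \<open>N\<close> trivially, hence is minimal itself\<close>
  have tiR: "z \<in> R" if z: "z \<in> H" "u \<in> R" "u \<noteq> \<one>" "conj_by z u \<in> R" for z u
  proof -
    have uc: "u \<in> carrier G" using subgroup.mem_carrier[OF R z(2)] .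
    have c1: "conj_by z u \<noteq> \<one>" using z Hc uc conj_by_eq_one_iff[of z u] by simp
    let ?Rz = "conj_by z ` R"
    have Rz: "subgroup ?Rz G" using conj_by_image_subgroup[OF Hc[OF z(1)] R] .
    have s: "subgroup (R \<inter> ?Rz) G" using subgroup_Int[OF R Rz] .
    have "conj_by z u \<in> R \<inter> ?Rz" using z by blast
    then have "R \<inter> ?Rz = R"
      using adjacentD[OF Radj s] subgroup.one_closed[OF s] c1 by blast
    then have "R \<subseteq> ?Rz" by blast
    moreover have "card ?Rz = card R" using conj_by_image_card[OF Hc[OF z(1)] subgroup.subset[OF R]] .
    ultimately have Rz_eq: "?Rz = R" using subgroup_card_eq[OF R Rz] by simp
    let ?Z = "normalizer_in H R"
    have Z: "subgroup ?Z G" "?Z \<subseteq> H" using normalizer_in_subgroup[OF H subgroup.subset[OF R]] by (auto simp: normalizer_in_def)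
    have RZ: "R \<subseteq> ?Z" using subgroup_le_normalizer[OF R RH] .
    have zZ: "z \<in> ?Z" using z Rz_eq by (simp add: normalizer_in_def)
    have "?Z \<noteq> H"
    proof
      assume e: "?Z = H"
      have "R = {\<one>}"
      proof (rule simple[OF R])
        show "R \<subset> H"
        proof -
          have "R \<noteq> H" using RN M1 by (auto simp: M_def)
          then show ?thesis using RH by blast
        qed
        fix h d assume hd: "h \<in> H" "d \<in> R"
        then have "conj_by h ` R = R" using e unfolding normalizer_in_def by blast
        then show "conj_by h d \<in> R" using hd by blast
      qed
      then show False using gR g by blast
    qed
    then have "?Z \<inter> N = {\<one>}" using meets[OF Z] gR RZ by blast
    then have "R = ?Z" using adjacentD[OF min[OF Z(1)] R _ RZ] subgroup.one_closed[OF R] gR g by blast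
    then show ?thesis using zZ by blast
  qed
  let ?IR = "(\<lambda>(x, u). conj_by x u) ` (H \<times> (R - {\<one>}))"
  have IR: "card ?IR * card R = card H * (card R - 1)"
    using card_conjugates_disjoint[OF H R RH Rab tiR] .
  have "card R \<noteq> 1" using card_subgroup_eq_1[OF R] gR g(2) by blast
  then have R2: "card R \<ge> 2" using card_subgroup_pos[OF R] by linarith
  have IRH: "?IR \<subseteq> H - {\<one>}"
  proof
    fix b assume "b \<in> ?IR"
    then obtain z u where zu: "z \<in> H" "u \<in> R" "u \<noteq> \<one>" "b = conj_by z u" by auto
    have "b \<in> H" using conj_H[OF zu(1)] RH zu by blast
    moreover have "b \<noteq> \<one>" using conj_by_eq_one_iff[OF Hc[OF zu(1)] subgroup.mem_carrier[OF R zu(2)]] zu(3,4) by simp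
    ultimately show "b \<in> H - {\<one>}" by blast
  qed
  have disj: "?IM \<inter> ?IR = {}"
  proof (rule ccontr)
    assume "?IM \<inter> ?IR \<noteq> {}"
    then obtain z u w v where zu: "z \<in> H" "u \<in> M" and wv: "w \<in> H" "v \<in> R" "v \<noteq> \<one>"
      and e: "conj_by z u = conj_by w v" by auto
    have c: "u \<in> carrier G" "v \<in> carrier G" "z \<in> carrier G" "w \<in> carrier G"
      using zu wv Hc Mc subgroup.mem_carrier[OF R] by auto
    define x where "x = inv w \<otimes> z"
    have xH: "x \<in> H" using zu wv subgroup.m_closed[OF H] inv_H by (simp add: x_def)
    have "conj_by (inv w) (conj_by z u) = v" using e c by simp
    then have "v = conj_by x u" using c by (simp add: conj_by_comp x_def)
    then have "v \<in> conj_by x ` N" using zu M_N by blast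
    then have "v \<in> R \<inter> conj_by x ` N" using wv by blast
    moreover have s: "subgroup (R \<inter> conj_by x ` N) G"
      using subgroup_Int[OF R F_subgroup[OF F_conj[OF N Hc[OF xH]]]] .
    ultimately have "R \<inter> conj_by x ` N = R"
      using adjacentD[OF Radj s] subgroup.one_closed[OF s] wv(3) by blast
    then show False using gN[OF xH] gR by blast
  qed
  have "card ?IM + card ?IR = card (?IM \<union> ?IR)"
    using disj finite_subset[OF IMH] finite_subset[OF IRH] finH by (subst card_Un_disjoint) auto
  also have "\<dots> \<le> card (H - {\<one>})" using IMH IRH finH by (intro card_mono) auto
  also have "\<dots> = card H - 1" using subgroup.one_closed[OF H] finH by simp
  finally have total: "card ?IM + card ?IR \<le> card H - 1" .
  \<comment> \<open>\<open>(k - 1)/k \<ge> 1/2\<close>, for both classes of conjugates\<close>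
  have half: "card H \<le> 2 * I" if "I * k = card H * (k - 1)" "k \<ge> 2" for I k :: nat
  proof -
    have "card H * k \<le> card H * (2 * (k - 1))" using that(2) by (intro mult_le_mono) auto
    also have "\<dots> = 2 * I * k" using that(1) by simp
    finally show ?thesis using that(2) by simp
  qed
  have "card H \<le> 2 * card ?IM" "card H \<le> 2 * card ?IR" using half[OF IM p2] half[OF IR R2] .
  then show False using total card_subgroup_pos[OF H] by linarith
qed

text \<open>
  Every trace \<open>T\<close> has prime order \<open>q < p\<close>, and the elements of \<open>M\<close>
  outside \<open>P\<close> are conjugate into \<open>T\<close>. The normalizer \<open>S\<close> of
  \<open>T\<close> in \<open>H\<close> contains \<open>T\<close> as a maximal subgroup and is its own
  normalizer. A conjugate of \<open>N\<close> that does not contain \<open>T\<close> cuts \<open>S\<close> in a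
  complement of \<open>T\<close> generated by some \<open>v\<close>, and \<open>v\<close> is conjugate into
  \<open>P\<close> or into \<open>T\<close>. In the first case \<open>v\<close> centralizes \<open>T\<close>
  since \<open>q < p\<close>, so \<open>T\<close> normalizes a conjugate of \<open>P\<close> and lies in the
  conjugate of \<open>M\<close> that it was chosen to avoid. In the second case \<open>v\<close> has order
  \<open>q\<close> and again centralizes \<open>T\<close>, so \<open>S\<close> centralizes \<open>v\<close>. If
  \<open>g\<close> conjugates an element of \<open>T\<close> to \<open>v\<close>, then \<open>g\<close>
  normalizes \<open>S\<close>, so it lies in \<open>S\<close> and normalizes \<open>T\<close>, although
  \<open>v\<close> is not in \<open>T\<close>.
\<close>
lemma simple_case_impossible: False
proof -
  obtain x where x: "x \<in> H" "x \<notin> M" using obtain_outside_M .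
  let ?T = "T x"
  have T: "subgroup ?T G" using T_subgroup x by blast
  have TM: "?T \<subseteq> M" using T_M .
  have Tc: "\<And>t. t \<in> ?T \<Longrightarrow> t \<in> carrier G" using TM Mc by blast
  have TP: "a = \<one>" if "a \<in> P" "a \<in> ?T" for a
    using that P_Int_trivial[OF x] by (auto simp: T_def)
  obtain t where t: "t \<in> ?T" "t \<noteq> \<one>" using T_nontrivial[OF x] subgroup.one_closed[OF T] by blast
  \<comment> \<open>otherwise \<open>T\<close> would lie in all conjugates of \<open>N\<close>\<close>
  have "\<exists>y\<in>H. \<exists>s\<in>?T. s \<notin> conj_by y ` N"
  proof (rule ccontr)
    assume no: "\<not> ?thesis"
    have "t = \<one>"
    proof (rule core_trivial)
      show "t \<in> H" using t TM M_H by blast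
      fix y assume y: "y \<in> H"
      have "t \<in> conj_by (inv y) ` N" using no t inv_H[OF y] by blast
      then show "conj_by y t \<in> N"
        using mem_conj_by_image_iff[OF _ subgroup.subset[OF F_subgroup[OF N]] Tc[OF t(1)], of "inv y"] Hc[OF y] by simp
    qed
    then show False using t by blast
  qed
  then obtain y s0 where y: "y \<in> H" and s0: "s0 \<in> ?T" "s0 \<notin> conj_by y ` N" by blast
  have yM: "y \<notin> M"
  proof
    assume "y \<in> M"
    then have "conj_by y ` M = M" using conj_by_image_self[OF M_subgroup] by blast
    then show False using s0 TM M_N by blast
  qed
  have "?T \<noteq> T y" using s0 by (auto simp: T_def)
  then have TNy: "a = \<one>" if "a \<in> ?T" "a \<in> conj_by y ` N" for a
    using T_Int_trivial[OF x y yM] that TM by (auto simp: T_def)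
  have yF: "conj_by y ` N \<in> F" using F_conj[OF N Hc[OF y]] .
  have "?T \<inter> conj_by y ` N = {\<one>}"
    using TNy subgroup.one_closed[OF T] subgroup.one_closed[OF F_subgroup[OF yF]] by blast
  then have Tadj: "adjacent G {\<one>} ?T" using F_trace[OF yF T] by simp
  have gen: "\<exists>i::nat. b = a [^] i" if "a \<in> ?T" "a \<noteq> \<one>" "b \<in> ?T" for a b
    using adjacent_one_generated[OF T Tadj that(1,2)] that(3) by blast
  obtain q where q: "prime q" "\<And>k::nat. t [^] k = \<one> \<longleftrightarrow> q dvd k" "card ?T = q"
    using adjacent_one_generated[OF T Tadj t] by blast
  have Tq: "a [^] q = \<one>" if "a \<in> ?T" for a using subgroup_pow_card[OF T that] q by simp
  have "q \<noteq> p"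
  proof
    assume "q = p"
    then have "t [^] p = \<one>" using q(2)[of p] by simp
    then show False using mem_P[of t] TP[of t] t TM by blast
  qed
  moreover have "q \<le> p"
    using p_largest[OF q(1)] subgroup_card_dvd[OF T M_subgroup TM] q(3) by (simp add: M_def)
  ultimately have qp: "q < p" by simp
  have Pt: "a = \<one>" if a: "a \<in> P" "a \<in> carrier G" "s \<in> ?T" "s \<noteq> \<one>" "a \<otimes> s = s \<otimes> a" for a s
  proof (rule ccontr)
    assume "a \<noteq> \<one>"
    then have "\<And>b. b \<in> P \<Longrightarrow> s \<otimes> b = b \<otimes> s" using commutes_with_P[OF a(1) _ Tc[OF a(3)] a(5)[symmetric]] by blast
    then show False using T_centralizer_trivial[OF x a(3)] a(4) by blast
  qed
  \<comment> \<open>an element of \<open>P\<close> that normalizes \<open>T\<close> centralizes it, as commutators lie in \<open>P \<inter> T = 1\<close>\<close>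
  have NMT: "g \<in> ?T" if g: "g \<in> M" "\<And>s. s \<in> ?T \<Longrightarrow> conj_by g s \<in> ?T" for g
  proof -
    have "g \<in> P <#> ?T" using g M_factor[OF x] by blast
    then obtain u s where us: "u \<in> P" "s \<in> ?T" "g = u \<otimes> s" by (rule set_multE)
    have c: "u \<in> carrier G" "s \<in> carrier G" "t \<in> carrier G" using us t Pc Tc by auto
    have "conj_by (inv s) t \<in> ?T" using conj_by_mem_subgroup[OF T] us t subgroup.m_inv_closed[OF T] by blast
    then have "conj_by g (conj_by (inv s) t) \<in> ?T" using g by blast
    then have ut: "conj_by u t \<in> ?T" using us c by (simp add: conj_by_comp m_assoc)
    have "conj_by u t \<otimes> inv t = u \<otimes> conj_by t (inv u)" using c by (simp add: conj_by_def m_assoc)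
    moreover have "u \<otimes> conj_by t (inv u) \<in> P"
      using us P_normal[of t "inv u"] t TM subgroup.m_closed[OF P_is_subgroup] subgroup.m_inv_closed[OF P_is_subgroup] by blast
    moreover have "conj_by u t \<otimes> inv t \<in> ?T" using ut t subgroup.m_closed[OF T] subgroup.m_inv_closed[OF T] by blast
    ultimately have "conj_by u t \<otimes> inv t = \<one>" using TP by simp
    then have "conj_by u t = t" using inv_solve_right'[of \<one> "conj_by u t" t] c by simp
    then have "u \<otimes> t = t \<otimes> u" using conj_by_eq_self_iff c by blast
    then have "u = \<one>" using Pt[OF us(1) c(1) t] by blast
    then show ?thesis using us c by simp
  qed
  have MP_conj: "\<exists>w\<in>P. \<exists>s\<in>?T. s \<noteq> \<one> \<and> v = conj_by w s" if v: "v \<in> M" "v \<notin> P" for v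
  proof -
    have "v \<in> P <#> ?T" using v M_factor[OF x] by blast
    then obtain u s where us: "u \<in> P" "s \<in> ?T" "v = u \<otimes> s" by (rule set_multE)
    have c: "u \<in> carrier G" "s \<in> carrier G" using us Pc Tc by auto
    have s1: "s \<noteq> \<one>" using us v c by auto
    \<comment> \<open>\<open>s\<close> acts on \<open>P\<close> without fixed points, so \<open>w \<mapsto> w (s w\<^sup>-\<^sup>1 s\<^sup>-\<^sup>1)\<close> permutes \<open>P\<close> and reaches \<open>u\<close>\<close>
    let ?f = "\<lambda>w. conj_by w s \<otimes> inv s"
    have "?f ` P \<subseteq> P"
    proof
      fix b assume "b \<in> ?f ` P"
      then obtain w where w: "w \<in> P" "b = conj_by w s \<otimes> inv s" by blast
      have "b = w \<otimes> conj_by s (inv w)" using w c Pc by (simp add: conj_by_def m_assoc)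
      then show "b \<in> P"
        using w P_normal[of s "inv w"] us TM subgroup.m_closed[OF P_is_subgroup] subgroup.m_inv_closed[OF P_is_subgroup] by blast
    qed
    moreover have "inj_on ?f P"
    proof (rule inj_onI)
      fix w z assume wz: "w \<in> P" "z \<in> P" "?f w = ?f z"
      have wc: "w \<in> carrier G" "z \<in> carrier G" using wz Pc by auto
      have "conj_by w s = conj_by z s" using wz(3) wc c by simp
      then have "conj_by (inv z) (conj_by w s) = s" using wc c by simp
      then have "conj_by (inv z \<otimes> w) s = s" using wc c by (simp add: conj_by_comp)
      then have "(inv z \<otimes> w) \<otimes> s = s \<otimes> (inv z \<otimes> w)" using conj_by_eq_self_iff[of "inv z \<otimes> w" s] wc c by simp
      moreover have "inv z \<otimes> w \<in> P" using wz subgroup.m_closed[OF P_is_subgroup] subgroup.m_inv_closed[OF P_is_subgroup] by blast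
      ultimately have "inv z \<otimes> w = \<one>" using Pt us(2) s1 wc by blast
      then show "w = z" using wc inv_solve_left'[of \<one> z w] by simp
    qed
    ultimately have "?f ` P = P" using finite_subgroup[OF P_is_subgroup] by (simp add: endo_inj_surj)
    then obtain w where w: "w \<in> P" "u = conj_by w s \<otimes> inv s" using us(1) by blast
    then have "v = conj_by w s" using us(3) c Pc by (simp add: m_assoc)
    then show ?thesis using w us s1 by blast
  qed
  let ?S = "normalizer_in H ?T"
  have S: "subgroup ?S G" using normalizer_in_subgroup[OF H subgroup.subset[OF T]] .
  have SH: "?S \<subseteq> H" by (auto simp: normalizer_in_def)
  have S_conj: "conj_by g a \<in> ?T" if "g \<in> ?S" "a \<in> ?T" for g a using that by (auto simp: normalizer_in_def)
  have SI: "g \<in> ?S" if "g \<in> H" "\<And>a. a \<in> ?T \<Longrightarrow> conj_by g a \<in> ?T" for g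
    using that conj_by_image_eqI[OF Hc subgroup.subset[OF T]] by (auto simp: normalizer_in_def)
  have TS: "?T \<subseteq> ?S" using SI conj_by_mem_subgroup[OF T] TM M_H by blast
  have genconj: "conj_by g a \<in> ?T" if *: "g \<in> carrier G" "s \<in> ?T" "s \<noteq> \<one>" "conj_by g s \<in> ?T" "a \<in> ?T" for g s a
  proof -
    obtain i where "a = s [^] (i::nat)" using gen[OF *(2,3,5)] by blast
    then show ?thesis using * Tc subgroup_nat_pow_closed[OF T] by (simp add: conj_by_pow)
  qed
  \<comment> \<open>\<open>T\<close> lies in \<open>M\<close> and in its conjugate by \<open>x\<close>; conjugacy of the complements of \<open>P\<close> in \<open>M\<close> yields \<open>w \<in> P\<close> such that \<open>x w\<close> normalizes \<open>T\<close>\<close>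
  have S_not_M: "\<not> ?S \<subseteq> M"
  proof -
    have xc: "x \<in> carrier G" using x Hc by blast
    have "t \<in> conj_by x ` N" using t by (simp add: T_def)
    then have m: "conj_by (inv x) t \<in> M" using conj_mem_M x t TM M_H by blast
    have "conj_by (inv x) t \<notin> P"
    proof
      assume "conj_by (inv x) t \<in> P"
      then have "conj_by (inv x) (t [^] p) = \<one>" using P_pow conj_by_pow xc Tc t by simp
      then have "t [^] p = \<one>" using conj_by_eq_one_iff[of "inv x" "t [^] p"] xc Tc t by simp
      then have "t \<in> P" using mem_P t TM by blast
      then show False using TP t by blast
    qed
    then obtain w s where ws: "w \<in> P" "s \<in> ?T" "s \<noteq> \<one>" "conj_by (inv x) t = conj_by w s" using MP_conj[OF m] by blast
    have c: "w \<in> carrier G" "s \<in> carrier G" "t \<in> carrier G" using ws t Pc Tc by auto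
    have "conj_by x (conj_by (inv x) t) = conj_by x (conj_by w s)" using ws by simp
    then have "conj_by (x \<otimes> w) s = t" using c xc by (simp add: conj_by_comp)
    then have "conj_by (x \<otimes> w) a \<in> ?T" if "a \<in> ?T" for a
      using genconj[of "x \<otimes> w" s a] that ws t c xc by simp
    moreover have "x \<otimes> w \<in> H" using x ws P_M M_H subgroup.m_closed[OF H] by blast
    ultimately have "x \<otimes> w \<in> ?S" using SI by blast
    moreover have "x \<otimes> w \<notin> M"
    proof
      assume "x \<otimes> w \<in> M"
      then have "(x \<otimes> w) \<otimes> inv w \<in> M"
        using ws P_M subgroup.m_closed[OF M_subgroup] subgroup.m_inv_closed[OF M_subgroup] by blast
      then show False using x c xc by (simp add: m_assoc)
    qed
    ultimately show ?thesis by blast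
  qed
  have SN: "?S \<inter> N = ?T"
    using NMT S_conj SH TS TM M_N by (auto simp: M_def)
  have Sadj: "adjacent G ?T ?S" using F_trace[OF N S] SN by simp
  have ST: "?S \<noteq> ?T" using S_not_M TM by blast
  let ?Z = "normalizer_in H ?S"
  \<comment> \<open>the normalizer of \<open>S\<close> meets \<open>M\<close> in \<open>T\<close>, which is then maximal in it, or contains \<open>M\<close> and is \<open>H\<close>\<close>
  have NS: "?Z = ?S"
  proof -
    have Z: "subgroup ?Z G" using normalizer_in_subgroup[OF H subgroup.subset[OF S]] .
    have ZH: "?Z \<subseteq> H" by (auto simp: normalizer_in_def)
    have SZ: "?S \<subseteq> ?Z" using subgroup_le_normalizer[OF S SH] .
    have ZM: "subgroup (?Z \<inter> M) G" using subgroup_Int[OF Z M_subgroup] .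
    have "?Z \<inter> M = ?T \<or> ?Z \<inter> M = M"
      using adjacentD[OF T_maximal[OF x(1)] ZM] TS SZ TM by blast
    then show ?thesis
    proof
      assume "?Z \<inter> M = ?T"
      then have "?Z \<inter> N = ?T" using ZH by (auto simp: M_def)
      then have "adjacent G ?T ?Z" using F_trace[OF N Z] by simp
      then show ?thesis using adjacentD[OF _ S TS SZ] ST by blast
    next
      assume "?Z \<inter> M = M"
      then have ZH': "?Z = H" using above_M[OF Z _ ZH] SZ S_not_M by blast
      have SHne: "?S \<noteq> H"
      proof
        assume e: "?S = H"
        have "?T = {\<one>}"
        proof (rule simple[OF T])
          show "?T \<subset> H" using TM M_H by blast
          show "\<And>h d. h \<in> H \<Longrightarrow> d \<in> ?T \<Longrightarrow> conj_by h d \<in> ?T" using S_conj e by blast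
        qed
        then show False using t by blast
      qed
      have "?S = {\<one>}"
      proof (rule simple[OF S])
        show "?S \<subset> H" using SH SHne by blast
        fix h d assume hd: "h \<in> H" "d \<in> ?S"
        have "h \<in> ?Z" using hd ZH' by blast
        then have "conj_by h ` ?S = ?S" by (simp add: normalizer_in_def[of H "normalizer_in H ?T"])
        then show "conj_by h d \<in> ?S" using hd by blast
      qed
      then show ?thesis using t TS by blast
    qed
  qed
  let ?V = "?S \<inter> conj_by y ` N"
  have V: "subgroup ?V G" using subgroup_Int[OF S F_subgroup[OF yF]] .
  \<comment> \<open>\<open>S\<close> is not of prime order, since it contains \<open>T\<close> properly\<close>
  have "?V \<noteq> {\<one>}"
  proof
    assume V1: "?V = {\<one>}"
    then have "adjacent G {\<one>} ?S" using F_trace[OF yF S] by simp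
    then show False using adjacentD[OF _ T _ TS] subgroup.one_closed[OF T] t ST by blast
  qed
  then obtain v where v: "v \<in> ?V" "v \<noteq> \<one>" using subgroup.one_closed[OF V] by blast
  have vT: "v \<notin> ?T" using TNy v by blast
  have vH: "v \<in> H" using v SH by blast
  have c: "v \<in> carrier G" "y \<in> carrier G" "t \<in> carrier G" using vH y Hc t Tc by auto
  interpret sec: cyclic_section G "{\<one>}" t q
    using triv_subgroup c q by (intro cyclic_section.intro[OF fin_group_axioms] cyclic_section_axioms.intro) auto
  have vt: "conj_by v t \<in> ?T" using S_conj v t by blast
  obtain i where "conj_by v t = t [^] (i::nat)" using gen[OF t vt] by blast
  then have vi: "sec.acts v i" using c by (simp add: sec.acts_def)
  have comm: "v \<otimes> t = t \<otimes> v" if n: "v [^] n = \<one>" "n > 0" "coprime n (q - 1)" for n :: nat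
  proof -
    have "sec.acts (v [^] n) 1" using sec.acts_one n by simp
    then have "sec.acts v 1" using sec.acts_one_of_coprime_pow[OF vi _ n(2,3)] by blast
    then have "conj_by v t = t" using c by (simp add: sec.acts_def)
    then show ?thesis using conj_by_eq_self_iff c by blast
  qed
  have v0: "conj_by (inv y) v \<in> M" using conj_mem_M y vH v by blast
  have pow0: "v [^] n = \<one>" if "conj_by (inv y) v [^] n = \<one>" for n :: nat
  proof -
    have "conj_by (inv y) (v [^] n) = conj_by (inv y) \<one>" using that c by (simp add: conj_by_pow)
    then show ?thesis using c by (simp only: conj_by_eq_iff inv_closed nat_pow_closed one_closed)
  qed
  show False
  proof (cases "conj_by (inv y) v \<in> P")
    case True
    have "coprime p (q - 1)"
      using p qp prime_gt_1_nat[OF q(1)] by (intro prime_imp_coprime) (auto dest!: dvd_imp_le)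
    then have vt_comm: "v \<otimes> t = t \<otimes> v" using comm pow0[OF P_pow[OF True]] prime_gt_0_nat[OF p] by blast
    let ?t = "conj_by (inv y) t" and ?v = "conj_by (inv y) v"
    have e: "?t \<otimes> ?v = ?v \<otimes> ?t" using vt_comm c by (simp add: conj_by_mult[symmetric])
    have v1: "?v \<noteq> \<one>" using pow0[of 1] v c by auto
    have "conj_by ?t a \<in> P" if a: "a \<in> P" for a
    proof -
      have "?t \<otimes> a = a \<otimes> ?t" using commutes_with_P[OF True v1 _ e a] c by simp
      then show ?thesis using conj_by_eq_self_iff[of ?t a] Pc[OF a] a c by simp
    qed
    moreover have "?t \<in> H" using conj_H inv_H y t TM M_H by blast
    ultimately have "?t \<in> M" using normalizes_in_M[OF P_is_subgroup P_M P_not_one P_normal] by blast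
    then have "t \<in> conj_by y ` N"
      using mem_conj_by_image_iff[OF c(2) subgroup.subset[OF F_subgroup[OF N]] c(3)] M_N by blast
    then show False using TNy t by blast
  next
    case False
    then obtain w s where ws: "w \<in> P" "s \<in> ?T" "s \<noteq> \<one>" "conj_by (inv y) v = conj_by w s"
      using MP_conj[OF v0] by blast
    have wc: "w \<in> carrier G" "s \<in> carrier G" using ws Pc Tc by auto
    have "conj_by (inv y) v [^] q = \<one>" using ws Tq wc by (simp add: conj_by_pow[symmetric])
    moreover have "coprime q (q - 1)"
      using q(1) prime_gt_1_nat[OF q(1)] by (intro prime_imp_coprime) (auto dest!: dvd_imp_le)
    ultimately have vt_comm: "v \<otimes> t = t \<otimes> v" using comm pow0 prime_gt_0_nat[OF q(1)] by blast
    define g where "g = y \<otimes> w"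
    have gH: "g \<in> H" unfolding g_def using y ws P_M M_H subgroup.m_closed[OF H] by blast
    have gc: "g \<in> carrier G" using gH Hc by blast
    have "conj_by y (conj_by (inv y) v) = conj_by y (conj_by w s)" using ws by simp
    then have vg: "v = conj_by g s" using c wc by (simp add: g_def conj_by_comp)
    have "?T \<subseteq> centralizer_in ?S {v}"
    proof
      fix a assume a: "a \<in> ?T"
      obtain k where "a = t [^] (k::nat)" using gen[OF t a] by blast
      moreover have "conj_by v t = t" using vt_comm conj_by_eq_self_iff c by blast
      ultimately have "conj_by v a = a" using c by (simp add: conj_by_pow)
      then have "v \<otimes> a = a \<otimes> v" using conj_by_eq_self_iff c Tc a by blast
      then show "a \<in> centralizer_in ?S {v}" using a TS by (auto simp: centralizer_in_def)
    qed
    moreover have "v \<in> centralizer_in ?S {v}" "centralizer_in ?S {v} \<subseteq> ?S"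
      using v by (auto simp: centralizer_in_def)
    ultimately have cent: "centralizer_in ?S {v} = ?S"
      using adjacentD[OF Sadj centralizer_in_subgroup[OF S, of "{v}"]] c vT by blast
    have "conj_by (inv g) ` ?S \<subseteq> ?S"
    proof
      fix b assume "b \<in> conj_by (inv g) ` ?S"
      then obtain d where d: "d \<in> ?S" "b = conj_by (inv g) d" by blast
      have dc: "d \<in> carrier G" using d SH Hc by blast
      have "d \<in> centralizer_in ?S {v}" using d cent by blast
      then have "d \<otimes> v = v \<otimes> d" by (simp add: centralizer_in_def)
      then have "conj_by (inv g) (d \<otimes> v) = conj_by (inv g) (v \<otimes> d)" by simp
      then have "b \<otimes> s = s \<otimes> b" using d dc c gc wc vg by (simp add: conj_by_mult)
      then have "conj_by b s = s" using conj_by_eq_self_iff[of b s] d dc gc wc by simp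
      then have "conj_by b a \<in> ?T" if "a \<in> ?T" for a
        using genconj[of b s a] ws that d dc gc by simp
      moreover have "b \<in> H" using d SH conj_H inv_H gH by blast
      ultimately show "b \<in> ?S" using SI by blast
    qed
    then have "conj_by (inv g) ` ?S = ?S"
      using conj_by_image_eqI[of "inv g" ?S] gc subgroup.subset[OF S] by blast
    then have "inv g \<in> ?Z" using inv_H[OF gH] by (simp add: normalizer_in_def[of H "normalizer_in H ?T"])
    then have "inv (inv g) \<in> ?S" using NS subgroup.m_inv_closed[OF S] by blast
    then have "g \<in> ?S" using gc by simp
    then have "v \<in> ?T" using vg S_conj ws by blast
    then show False using vT by blast
  qed
qed

end

context trace_family
begin

text \<open>
  The subgroup in question is the normal Sylow \<open>p\<close>-subgroup of \<open>H\<close> for the largest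
  prime \<open>p\<close> (or \<open>1\<close>, if \<open>p\<close> does not divide the order). The induction
  splits according to whether \<open>H\<close> is simple; a simple \<open>H\<close> that some member cuts in the
  identity has no proper nontrivial subgroup and is abelian.
\<close>
theorem torsion_subgroup:
  "\<lbrakk>subgroup H G; prime p; \<And>r. \<lbrakk>prime r; r dvd card H\<rbrakk> \<Longrightarrow> r \<le> p\<rbrakk> \<Longrightarrow> subgroup (torsion p H) G"
proof (induction "card H" arbitrary: H p rule: less_induct)
  case less
  note H = less.prems(1) and p = less.prems(2) and le = less.prems(3)
  have Hc: "\<And>h. h \<in> H \<Longrightarrow> h \<in> carrier G" using subgroup.mem_carrier[OF H] .
  have IH: "subgroup (torsion s K) G"
    if "subgroup K G" "K \<subset> H" "prime s" "\<And>r. \<lbrakk>prime r; r dvd card K\<rbrakk> \<Longrightarrow> r \<le> s" for K s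
    using less.hyps[OF subgroup_psubset_card[OF H that(2)] that(1,3,4)] .
  have abelian: "subgroup (torsion p H) G" if ab: "\<And>x y. \<lbrakk>x \<in> H; y \<in> H\<rbrakk> \<Longrightarrow> x \<otimes> y = y \<otimes> x"
  proof (rule subgroupI)
    show "torsion p H \<subseteq> carrier G" using Hc by (auto simp: torsion_def)
    have "\<one> \<in> torsion p H" using subgroup.one_closed[OF H] by (simp add: torsion_def)
    then show "torsion p H \<noteq> {}" by blast
    fix a assume a: "a \<in> torsion p H"
    then show "inv a \<in> torsion p H"
      using Hc subgroup.m_inv_closed[OF H] by (simp add: torsion_def nat_pow_inv)
    fix b assume b: "b \<in> torsion p H"
    show "a \<otimes> b \<in> torsion p H"
      using a b Hc subgroup.m_closed[OF H] pow_mult_distrib[of a b p] ab by (simp add: torsion_def)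
  qed
  show ?case
  proof (cases "\<exists>D. subgroup D G \<and> D \<subset> H \<and> D \<noteq> {\<one>} \<and> (\<forall>h\<in>H. \<forall>d\<in>D. conj_by h d \<in> D)")
    case True
    then obtain D where D: "subgroup D G" "D \<subset> H" "D \<noteq> {\<one>}" "\<And>h d. \<lbrakk>h \<in> H; d \<in> D\<rbrakk> \<Longrightarrow> conj_by h d \<in> D" by blast
    show ?thesis by (rule torsion_subgroup_of_normal[OF IH H p le D])
  next
    case False
    then have simple: "D = {\<one>}"
      if "subgroup D G" "D \<subset> H" "\<And>h d. \<lbrakk>h \<in> H; d \<in> D\<rbrakk> \<Longrightarrow> conj_by h d \<in> D" for D
      using that by blast
    show ?thesis
    proof (cases "\<forall>N\<in>F. H \<subseteq> N")
      case True
      then have "x = \<one>" if "x \<in> H" for x using F_trivial Hc that by blast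
      then have "x \<otimes> y = y \<otimes> x" if "x \<in> H" "y \<in> H" for x y using that by metis
      then show ?thesis by (rule abelian)
    next
      case False
      then obtain N where N: "N \<in> F" "\<not> H \<subseteq> N" by blast
      have M: "subgroup (H \<inter> N) G" using subgroup_Int[OF H F_subgroup[OF N(1)]] .
      show ?thesis
      proof (cases "H \<inter> N = {\<one>}")
        case True
        then have adj: "adjacent G {\<one>} H" using F_trace[OF N(1) H] by simp
        have "x \<otimes> y = y \<otimes> x" if xy: "x \<in> H" "y \<in> H" for x y
        proof (cases "y = \<one>")
          case True
          then show ?thesis using Hc xy by simp
        next
          case False
          have s: "subgroup (centralizer_in H {y}) G" using centralizer_in_subgroup[OF H] Hc xy by blast
          have "y \<in> centralizer_in H {y}" "centralizer_in H {y} \<subseteq> H" using xy by (auto simp: centralizer_in_def)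
          then have "centralizer_in H {y} = H"
            using adjacentD[OF adj s] subgroup.one_closed[OF s] False by blast
          then have "x \<in> centralizer_in H {y}" using xy by blast
          then show ?thesis by (simp add: centralizer_in_def)
        qed
        then show ?thesis by (rule abelian)
      next
        case False
        let ?M = "H \<inter> N"
        have M1: "card ?M \<noteq> 1" using card_subgroup_eq_1[OF M] False by blast
        have M0: "card ?M > 0" using card_subgroup_pos[OF M] .
        obtain r where r: "prime r" "r dvd card ?M" and rmax: "\<And>s. \<lbrakk>prime s; s dvd card ?M\<rbrakk> \<Longrightarrow> s \<le> r"
          using obtain_largest_prime_divisor[OF M0 M1] by blast
        have P: "subgroup (torsion r ?M) G" by (rule IH[OF M _ r(1) rmax]) (use N in blast)
        have Pne: "torsion r ?M \<noteq> {\<one>}" using cauchy[OF M r] by (auto simp: torsion_def)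
        interpret simple_trace G F H N r
          by (intro simple_trace.intro[OF trace_family_axioms] simple_trace_axioms.intro)
            (use H simple N r(1) P Pne rmax in auto)
        show ?thesis using simple_case_impossible by blast
      qed
    qed
  qed
qed

end

section \<open>Core-free subgroups with maximal traces\<close>

lemma (in normal) cyclic_Mod_I:
  assumes g: "g \<in> carrier G" and gen: "\<And>x. x \<in> carrier G \<Longrightarrow> \<exists>h\<in>H. \<exists>n::nat. x = h \<otimes> g [^] n"
  shows "cyclic_group (G Mod H)"
proof -
  interpret Q: group "G Mod H" by (rule factorgroup_is_group)
  have gQ: "H #> g \<in> carrier (G Mod H)" using g by (auto simp: carrier_FactGroup)
  have "c \<in> range (\<lambda>n::int. (H #> g) [^]\<^bsub>G Mod H\<^esub> n)" if c: "c \<in> carrier (G Mod H)" for c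
  proof -
    obtain x where x: "x \<in> carrier G" "c = H #> x" using c by (auto simp: carrier_FactGroup)
    obtain h n where hn: "h \<in> H" "x = h \<otimes> g [^] (n::nat)" using gen[OF x(1)] by blast
    have "H #> x = H #> g [^] n"
      using repr_independence[of x H "g [^] n"] hn g is_subgroup
      by (simp add: r_coset_def)
    then have "c = (H #> g) [^]\<^bsub>G Mod H\<^esub> (int n)"
      using x FactGroup_int_pow[OF g, of "int n"] g by (simp add: int_pow_int)
    then show ?thesis by blast
  qed
  moreover have "range (\<lambda>n::int. (H #> g) [^]\<^bsub>G Mod H\<^esub> n) \<subseteq> carrier (G Mod H)" using gQ by auto
  ultimately have "carrier (G Mod H) = range (\<lambda>n::int. (H #> g) [^]\<^bsub>G Mod H\<^esub> n)" by blast
  then show ?thesis using Q.cyclic_group gQ by blast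
qed

lemma (in normal) cyclic_Mod_D:
  assumes "cyclic_group (G Mod H)" and fin: "finite (carrier G)"
  obtains g where "g \<in> carrier G" "\<And>x. x \<in> carrier G \<Longrightarrow> \<exists>h\<in>H. \<exists>n::nat. x = h \<otimes> g [^] n"
proof -
  interpret Q: group "G Mod H" by (rule factorgroup_is_group)
  obtain c where c: "c \<in> carrier (G Mod H)" "carrier (G Mod H) = range (\<lambda>n::int. c [^]\<^bsub>G Mod H\<^esub> n)"
    using assms Q.cyclic_group by blast
  obtain g where g: "g \<in> carrier G" "c = H #> g" using c(1) unfolding carrier_FactGroup by blast
  have "\<exists>h\<in>H. \<exists>n::nat. x = h \<otimes> g [^] n" if x: "x \<in> carrier G" for x
  proof -
    have "H #> x \<in> carrier (G Mod H)" using x by (auto simp: carrier_FactGroup)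
    then obtain n :: int where "H #> x = c [^]\<^bsub>G Mod H\<^esub> n" using c by blast
    then have e: "H #> x = H #> g [^] n" using FactGroup_int_pow[OF g(1)] g by simp
    have "g [^] n \<in> generate G {g}" using generate_pow[OF g(1)] by blast
    then obtain k :: nat where "g [^] n = g [^] k"
      using generate_pow_on_finite_carrier[OF fin g(1)] by auto
    moreover have "x \<in> H #> g [^] n" using e rcos_self[OF x is_subgroup] by simp
    ultimately show ?thesis by (auto simp: r_coset_def)
  qed
  then show thesis using that g by blast
qed

context fin_group
begin

lemma trace_conj:
  assumes M: "subgroup M G" and tr: "\<And>Z. subgroup Z G \<Longrightarrow> adjacent G (Z \<inter> M) Z"
    and g: "g \<in> carrier G" and Z: "subgroup Z G"
  shows "adjacent G (Z \<inter> conj_by g ` M) Z"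
  unfolding adjacent_def
proof (intro allI impI)
  fix C assume C: "subgroup C G" "Z \<inter> conj_by g ` M \<subseteq> C" "C \<subseteq> Z"
  let ?c = "\<lambda>A. conj_by (inv g) ` A"
  have car: "Z \<subseteq> carrier G" "M \<subseteq> carrier G" "C \<subseteq> carrier G" using subgroup.subset Z M C by auto
  have sub: "subgroup (?c Z) G" "subgroup (?c C) G" using conj_by_image_subgroup g Z C by auto
  have i1: "?c (Z \<inter> conj_by g ` M) = ?c Z \<inter> M"
    using inj_on_image_Int[OF conj_by_inj[of "inv g" "carrier G"], of Z "conj_by g ` M"] car g
      conj_by_image_subset_carrier[of g M] by simp
  have "?c Z \<inter> M \<subseteq> ?c C" "?c C \<subseteq> ?c Z" using i1 C by blast+
  then have "?c C = ?c (Z \<inter> conj_by g ` M) \<or> ?c C = ?c Z"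
    using adjacentD[OF tr[OF sub(1)] sub(2)] i1 by simp
  then have "conj_by g ` ?c C = conj_by g ` ?c (Z \<inter> conj_by g ` M) \<or> conj_by g ` ?c C = conj_by g ` ?c Z" by metis
  moreover have "Z \<inter> conj_by g ` M \<subseteq> carrier G" using car by blast
  ultimately show "C = Z \<inter> conj_by g ` M \<or> C = Z" using car g by simp
qed

lemma group_exponent_pow:
  "0 < group_exponent G" "x \<in> carrier G \<Longrightarrow> x [^] group_exponent G = \<one>"
  "\<lbrakk>0 < n; \<And>x. x \<in> carrier G \<Longrightarrow> x [^] n = \<one>\<rbrakk> \<Longrightarrow> group_exponent G \<le> n"
proof -
  let ?P = "\<lambda>n::nat. 0 < n \<and> (\<forall>x\<in>carrier G. x [^] n = \<one>)"
  have "?P (order G)" using pow_order_eq_1 fin order_gt_0_iff_finite by blast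
  then have "?P (group_exponent G)" unfolding group_exponent_def by (rule LeastI)
  then show "0 < group_exponent G" "x \<in> carrier G \<Longrightarrow> x [^] group_exponent G = \<one>" by auto
  show "\<lbrakk>0 < n; \<And>x. x \<in> carrier G \<Longrightarrow> x [^] n = \<one>\<rbrakk> \<Longrightarrow> group_exponent G \<le> n"
    unfolding group_exponent_def by (rule Least_le) auto
qed

lemma squarefree_exponent_iff:
  "squarefree (group_exponent G) \<longleftrightarrow>
    (\<forall>r::nat. prime r \<longrightarrow> (\<forall>x\<in>carrier G. x [^] (r * r) = \<one> \<longrightarrow> x [^] r = \<one>))"
proof
  assume sq: "squarefree (group_exponent G)"
  show "\<forall>r::nat. prime r \<longrightarrow> (\<forall>x\<in>carrier G. x [^] (r * r) = \<one> \<longrightarrow> x [^] r = \<one>)"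
  proof (intro allI impI ballI)
    fix r :: nat and x assume r: "prime r" and x: "x \<in> carrier G" "x [^] (r * r) = \<one>"
    have d: "ord x dvd r * r" "ord x dvd group_exponent G"
      using x group_exponent_pow(2)[OF x(1)] pow_eq_id by auto
    have "ord x dvd r ^ 2" using d by (simp add: power2_eq_square)
    then obtain j where j: "j \<le> 2" "ord x = r ^ j" using divides_primepow_nat[OF r] by blast
    have "j \<noteq> 2"
    proof
      assume "j = 2"
      then have "r ^ 2 dvd group_exponent G" using d(2) j by simp
      then show False using squarefreeD[OF sq, of r] r not_prime_unit by blast
    qed
    then have "j \<le> 1" using j by simp
    then have "ord x dvd r ^ 1" unfolding j(2) by (rule le_imp_power_dvd)
    then show "x [^] r = \<one>" using x pow_eq_id by simp
  qed
next
  assume *: "\<forall>r::nat. prime r \<longrightarrow> (\<forall>x\<in>carrier G. x [^] (r * r) = \<one> \<longrightarrow> x [^] r = \<one>)"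
  show "squarefree (group_exponent G)"
  proof (rule squarefreeI, rule ccontr)
    fix n assume n: "n ^ 2 dvd group_exponent G" "\<not> is_unit n"
    then obtain r where r: "prime r" "r dvd n" using prime_factor_nat[of n] by auto
    have "r ^ 2 dvd n ^ 2" using r by (simp add: dvd_power_same)
    then have "r * r dvd group_exponent G" using n dvd_trans by (auto simp: power2_eq_square)
    then obtain k where k: "group_exponent G = r * r * k" by (auto elim: dvdE)
    have "x [^] (r * k) = \<one>" if x: "x \<in> carrier G" for x
    proof -
      have "(x [^] k) [^] (r * r) = \<one>"
        using group_exponent_pow(2)[OF x] x by (simp add: k nat_pow_pow mult.commute)
      then have "(x [^] k) [^] r = \<one>" using * r x by simp
      then show ?thesis using x by (simp add: nat_pow_pow mult.commute)
    qed
    moreover have "0 < r * k" using k group_exponent_pow(1) by simp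
    ultimately have "group_exponent G \<le> r * k" using group_exponent_pow(3) by blast
    then have "r * (r * k) \<le> 1 * (r * k)" using k by simp
    then have "r \<le> 1" using \<open>0 < r * k\<close> by (simp only: mult_le_cancel2)
    then show False using prime_gt_1_nat[OF r(1)] by simp
  qed
qed

text \<open>
  The conjugates of \<open>M\<close> form a trace family. Let \<open>P\<close> be the normal Sylow subgroup for
  the largest prime. Then \<open>G = P M\<close>, and \<open>P \<inter> M\<close> and the centralizer of
  \<open>P\<close> in \<open>M\<close> are normal in \<open>G\<close>, hence trivial. So \<open>P\<close> has
  prime order and \<open>M\<close>, acting faithfully on it, is abelian. The intersection of \<open>M\<close>
  with a different conjugate is centralized by both and therefore trivial, so \<open>M\<close> has prime order
  too.
\<close>
lemma core_free_trace_U1: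
  assumes M: "subgroup M G" and tr: "\<And>Z. subgroup Z G \<Longrightarrow> adjacent G (Z \<inter> M) Z"
    and core: "\<And>D. \<lbrakk>D \<lhd> G; D \<subseteq> M\<rbrakk> \<Longrightarrow> D = {\<one>}" and nn: "\<not> M \<lhd> G"
  shows "U1 G"
proof -
  have Mc: "\<And>m. m \<in> M \<Longrightarrow> m \<in> carrier G" using subgroup.mem_carrier[OF M] .
  let ?F = "{conj_by g ` M | g. g \<in> carrier G}"
  have MF: "M \<in> ?F" using conj_by_image_one[OF subgroup.subset[OF M]] by force
  interpret trace_family G ?F
  proof (intro trace_family.intro[OF fin_group_axioms] trace_family_axioms.intro)
    show "subgroup N G" if "N \<in> ?F" for N using that conj_by_image_subgroup M by blast
    show "adjacent G (Z \<inter> N) Z" if "N \<in> ?F" "subgroup Z G" for N Z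
      using that trace_conj[OF M tr] by blast
    show "conj_by g ` N \<in> ?F" if N: "N \<in> ?F" and g: "g \<in> carrier G" for N g
    proof -
      obtain h where h: "h \<in> carrier G" "N = conj_by h ` M" using N by blast
      have "conj_by g ` N = conj_by (g \<otimes> h) ` M" using h g conj_by_image_comp subgroup.subset[OF M] by simp
      then show ?thesis using g h by blast
    qed
  next
    fix x assume x: "x \<in> carrier G" and all: "\<And>N. N \<in> ?F \<Longrightarrow> x \<in> N"
    show "x = \<one>"
    proof -
      let ?D = "{x \<in> carrier G. \<forall>g\<in>carrier G. conj_by g x \<in> M}"
      have "?D \<lhd> G"
        unfolding normal_conj_by
      proof (intro conjI ballI)
        show "subgroup ?D G"
        proof (rule subgroupI)
          have "\<one> \<in> ?D" using subgroup.one_closed[OF M] by simp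
          then show "?D \<noteq> {}" by blast
        qed (use subgroup.m_closed[OF M] subgroup.m_inv_closed[OF M] in \<open>auto simp: conj_by_mult conj_by_inv\<close>)
        show "\<And>h d. h \<in> carrier G \<Longrightarrow> d \<in> ?D \<Longrightarrow> conj_by h d \<in> ?D" by (auto simp: conj_by_comp)
      qed
      moreover have "?D \<subseteq> M"
      proof
        fix d assume d: "d \<in> ?D"
        then have "conj_by \<one> d \<in> M" by blast
        then show "d \<in> M" using d by simp
      qed
      moreover have "x \<in> ?D"
      proof -
        have "conj_by g x \<in> M" if g: "g \<in> carrier G" for g
        proof -
          have "x \<in> conj_by (inv g) ` M" using all g by blast
          then show ?thesis using mem_conj_by_image_iff[of "inv g" M x] subgroup.subset[OF M] g x by simp
        qed
        then show ?thesis using x by blast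
      qed
      ultimately show ?thesis using core by blast
    qed
  qed
  obtain x a where xa: "x \<in> carrier G" "a \<in> M" "conj_by x a \<notin> M" using nn M normal_conj_by by blast
  have M1: "M \<noteq> {\<one>}" using xa by auto
  have whole: "C = carrier G" if "subgroup C G" "M \<subseteq> C" "\<not> C \<subseteq> M" for C
    using adjacentD[OF tr[OF subgroup_self], of C] that subgroup.subset by blast
  have c1: "card (carrier G) \<noteq> 1"
  proof
    assume "card (carrier G) = 1"
    then have "carrier G = {\<one>}" by (rule card_subgroup_eq_1[OF subgroup_self])
    then have "a = \<one>" "x = \<one>" using xa(1) Mc[OF xa(2)] by blast+
    then show False using xa by simp
  qed
  have c0: "card (carrier G) > 0" using card_subgroup_pos[OF subgroup_self] .
  obtain p where p: "prime p" "p dvd card (carrier G)"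
    and pmax: "\<And>s. \<lbrakk>prime s; s dvd card (carrier G)\<rbrakk> \<Longrightarrow> s \<le> p"
    using obtain_largest_prime_divisor[OF c0 c1] by blast
  define P where "P = torsion p (carrier G)"
  have P: "subgroup P G" unfolding P_def by (rule torsion_subgroup[OF subgroup_self p(1) pmax])
  have Pc: "\<And>m. m \<in> P \<Longrightarrow> m \<in> carrier G" using subgroup.mem_carrier[OF P] .
  have Ppow: "\<And>a. a \<in> P \<Longrightarrow> a [^] p = \<one>" by (simp add: P_def torsion_def)
  have P1: "P \<noteq> {\<one>}" using cauchy[OF subgroup_self p] unfolding P_def torsion_def by blast
  have Pn: "conj_by g a \<in> P" if "g \<in> carrier G" "a \<in> P" for g a
    using that conj_by_torsion[of "carrier G" g a p "carrier G"] Pc by (auto simp: P_def)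
  have PG: "P \<lhd> G" using normal_conj_by P Pn by blast
  have PM: "\<not> P \<subseteq> M" using core[OF PG] P1 by blast
  have fac: "carrier G = P <#> M"
    using factor_by_normal[OF MF subgroup_self P subgroup.subset[OF P] PM Pn]
    unfolding Int_absorb1[OF subgroup.subset[OF M]] .
  have Pab: "a \<otimes> b = b \<otimes> a" if "a \<in> P" "b \<in> P" for a b
    using exponent_p_commute[OF P p(1) Ppow that] .
  \<comment> \<open>\<open>G = P M\<close>, so a subgroup of \<open>M\<close> that is normalized by \<open>M\<close> and centralized by \<open>P\<close> is normal\<close>
  have nI: "D = {\<one>}" if D: "subgroup D G" "D \<subseteq> M" "\<And>m d. \<lbrakk>m \<in> M; d \<in> D\<rbrakk> \<Longrightarrow> conj_by m d \<in> D"
    "\<And>u d. \<lbrakk>u \<in> P; d \<in> D\<rbrakk> \<Longrightarrow> u \<otimes> d = d \<otimes> u" for D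
  proof (rule core[OF _ D(2)])
    show "D \<lhd> G" unfolding normal_conj_by
    proof (intro conjI ballI D(1))
      fix g d assume g: "g \<in> carrier G" and d: "d \<in> D"
      have "g \<in> P <#> M" using g fac by blast
      then obtain u m where um: "u \<in> P" "m \<in> M" "g = u \<otimes> m" by (rule set_multE)
      have md: "conj_by m d \<in> D" using D(3) um d by blast
      have c: "u \<in> carrier G" "m \<in> carrier G" "d \<in> carrier G" "conj_by m d \<in> carrier G"
        using um d md Pc Mc D(2) by auto
      have "conj_by u (conj_by m d) = conj_by m d"
        using conj_by_eq_self_iff[OF c(1,4)] D(4)[OF um(1) md] by blast
      then show "conj_by g d \<in> D" using um md c by (simp add: conj_by_comp)
    qed
  qed
  have "P \<inter> M = {\<one>}"
  proof (rule nI)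
    show "subgroup (P \<inter> M) G" by (rule subgroup_Int[OF P M])
    show "\<And>m d. m \<in> M \<Longrightarrow> d \<in> P \<inter> M \<Longrightarrow> conj_by m d \<in> P \<inter> M"
      using Pn Mc conj_by_mem_subgroup[OF M] by blast
    show "\<And>u d. u \<in> P \<Longrightarrow> d \<in> P \<inter> M \<Longrightarrow> u \<otimes> d = d \<otimes> u" using Pab by blast
  qed auto
  then have Padj: "adjacent G {\<one>} P" using tr[OF P] by simp
  obtain y where y: "y \<in> P" "y \<noteq> \<one>" using P1 subgroup.one_closed[OF P] by blast
  have gen: "\<exists>i::nat. b = y [^] i" if "b \<in> P" for b
    using adjacent_one_generated[OF P Padj y] that by blast
  have cent: "centralizer_in M P = {\<one>}"
  proof (rule nI)
    show "subgroup (centralizer_in M P) G" by (rule centralizer_in_subgroup[OF M subgroup.subset[OF P]])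
    fix m d assume m: "m \<in> M" and d: "d \<in> centralizer_in M P"
    have dM: "d \<in> M" using d by (simp add: centralizer_in_def)
    have "conj_by m d \<otimes> u = u \<otimes> conj_by m d" if u: "u \<in> P" for u
    proof -
      let ?u = "conj_by (inv m) u"
      have "d \<otimes> ?u = ?u \<otimes> d" using d Pn[of "inv m" u] u Mc[OF m] by (simp add: centralizer_in_def)
      then have "conj_by m (d \<otimes> ?u) = conj_by m (?u \<otimes> d)" by simp
      then show ?thesis using Mc[OF m] Mc[OF dM] Pc[OF u] by (simp add: conj_by_mult)
    qed
    then show "conj_by m d \<in> centralizer_in M P"
      using conj_by_mem_subgroup[OF M m dM] by (simp add: centralizer_in_def)
  qed (auto simp: centralizer_in_def)
  have Mab: "s \<otimes> t = t \<otimes> s" if st: "s \<in> M" "t \<in> M" for s t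
  proof (rule faithful_on_cyclic_abelian[OF subgroup.subset[OF P] y(1) gen M Pn[OF Mc] _ st])
    fix c assume "c \<in> M" "\<And>b. b \<in> P \<Longrightarrow> c \<otimes> b = b \<otimes> c"
    then have "c \<in> centralizer_in M P" by (simp add: centralizer_in_def)
    then show "c = \<one>" using cent by simp
  qed
  let ?N = "conj_by x ` M"
  have NF: "?N \<in> ?F" using xa by blast
  have N: "subgroup ?N G" using conj_by_image_subgroup xa M by blast
  have "M \<inter> ?N = {\<one>}"
  proof (rule core)
    have T: "subgroup (M \<inter> ?N) G" using subgroup_Int[OF M N] .
    let ?C = "centralizer_in (carrier G) (M \<inter> ?N)"
    have "?C = carrier G"
    proof (rule whole)
      show "subgroup ?C G" by (rule centralizer_in_subgroup[OF subgroup_self subgroup.subset[OF T]])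
      show "M \<subseteq> ?C" using Mab Mc by (auto simp: centralizer_in_def)
      have "b \<otimes> d = d \<otimes> b" if bd: "b \<in> ?N" "d \<in> ?N" for b d
      proof -
        obtain b' d' where "b' \<in> M" "d' \<in> M" "b = conj_by x b'" "d = conj_by x d'" using bd by blast
        then show ?thesis using Mab[of b' d'] xa Mc by (simp add: conj_by_mult[symmetric])
      qed
      then have "?N \<subseteq> ?C" using subgroup.subset[OF N] by (auto simp: centralizer_in_def)
      then show "\<not> ?C \<subseteq> M" using xa by blast
    qed
    then have e: "g \<otimes> d = d \<otimes> g" if "g \<in> carrier G" "d \<in> M \<inter> ?N" for g d
      using that unfolding centralizer_in_def by blast
    show "M \<inter> ?N \<lhd> G" unfolding normal_conj_by
    proof (intro conjI ballI T)
      fix g d assume gd: "g \<in> carrier G" "d \<in> M \<inter> ?N"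
      then have "conj_by g d = d" using conj_by_eq_self_iff[of g d] e Mc by blast
      then show "conj_by g d \<in> M \<inter> ?N" using gd by simp
    qed
  qed auto
  then have Madj: "adjacent G {\<one>} M" using F_trace[OF NF M] by simp
  obtain t where t: "t \<in> M" "t \<noteq> \<one>" using M1 subgroup.one_closed[OF M] by blast
  have genM: "\<exists>i::nat. b = t [^] i" if "b \<in> M" for b
    using adjacent_one_generated[OF M Madj t] that by blast
  have "supersolvable G"
    unfolding supersolvable_def
  proof (intro exI conjI allI impI)
    let ?L = "\<lambda>i::nat. if i = 0 then {\<one>} else if i = 1 then P else carrier G"
    show "?L 0 = {\<one>}" "?L 2 = carrier G" by simp_all
    show "?L i \<lhd> G" for i using one_is_normal normal_self PG by simp
    show "?L i \<subseteq> ?L (Suc i)" for i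
      using subgroup.one_closed[OF P] Pc by (auto simp: subset_iff)
    fix i :: nat assume "i < 2"
    then consider "i = 0" | "i = 1" by linarith
    then show "cyclic_group ((G\<lparr>carrier := ?L (Suc i)\<rparr>) Mod ?L i)"
    proof cases
      case 1
      interpret P: group "G\<lparr>carrier := P\<rparr>" using P subgroup_imp_group by blast
      interpret n: normal "{\<one>}" "G\<lparr>carrier := P\<rparr>" using P.one_is_normal by simp
      have "cyclic_group (G\<lparr>carrier := P\<rparr> Mod {\<one>})"
      proof (rule n.cyclic_Mod_I)
        show "y \<in> carrier (G\<lparr>carrier := P\<rparr>)" using y by simp
        fix b assume "b \<in> carrier (G\<lparr>carrier := P\<rparr>)"
        then obtain i where "b = y [^] (i::nat)" using gen by auto
        then show "\<exists>h\<in>{\<one>}. \<exists>n::nat. b = h \<otimes>\<^bsub>G\<lparr>carrier := P\<rparr>\<^esub> y [^]\<^bsub>G\<lparr>carrier := P\<rparr>\<^esub> n"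
          using Pc[OF y(1)] by (auto simp: nat_pow_consistent[symmetric])
      qed
      then show ?thesis using 1 by simp
    next
      case 2
      interpret n: normal P G using PG .
      have "cyclic_group (G Mod P)"
      proof (rule n.cyclic_Mod_I)
        show "t \<in> carrier G" using t Mc by blast
        fix b assume "b \<in> carrier G"
        then have "b \<in> P <#> M" using fac by blast
        then obtain u m where um: "u \<in> P" "m \<in> M" "b = u \<otimes> m" by (rule set_multE)
        then show "\<exists>h\<in>P. \<exists>n::nat. b = h \<otimes> t [^] n" using genM by blast
      qed
      then show ?thesis using 2 by simp
    qed
  qed
  moreover have "squarefree (group_exponent G)"
    using squarefree_exponent_iff pow_square_eq_one by blast
  ultimately show ?thesis using fin is_group by (simp add: U1_def)
qed

end

section \<open>Modular subgroups\<close>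

context group
begin

text \<open>
  The join in the subgroup lattice, in which the modular laws read as lattice identities.
\<close>
definition join :: "'a set \<Rightarrow> 'a set \<Rightarrow> 'a set" where
  "join A B = generate G (A \<union> B)"

lemma join_comm: "join A B = join B A"
  by (simp add: join_def Un_commute)

lemma join_subgroup: "\<lbrakk>subgroup A G; subgroup B G\<rbrakk> \<Longrightarrow> subgroup (join A B) G"
  unfolding join_def by (rule generate_is_subgroup) (simp add: subgroup.subset)

lemma join_upper: "A \<subseteq> join A B" "B \<subseteq> join A B"
  unfolding join_def by (auto intro: generate.incl)

lemma join_least: "\<lbrakk>subgroup C G; A \<subseteq> C; B \<subseteq> C\<rbrakk> \<Longrightarrow> join A B \<subseteq> C"
  unfolding join_def by (rule generate_subgroup_incl) auto

lemma join_mono: "\<lbrakk>A \<subseteq> A'; B \<subseteq> B'\<rbrakk> \<Longrightarrow> join A B \<subseteq> join A' B'"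
  unfolding join_def by (rule mono_generate) auto

lemma join_absorb: "\<lbrakk>subgroup A G; B \<subseteq> A\<rbrakk> \<Longrightarrow> join A B = A"
  using join_least[of A A B] join_upper(1)[of A B] by blast

lemma join_assoc:
  assumes "subgroup A G" "subgroup B G" "subgroup C G"
  shows "join (join A B) C = join A (join B C)"
proof
  have s: "subgroup (join A (join B C)) G" "subgroup (join (join A B) C) G"
    using assms join_subgroup by auto
  show "join (join A B) C \<subseteq> join A (join B C)"
    by (intro join_least s) (meson join_upper subset_trans)+
  show "join A (join B C) \<subseteq> join (join A B) C"
    by (intro join_least s) (meson join_upper subset_trans)+
qed

lemma modular_subgroup_join_iff:
  "modular_subgroup M G \<longleftrightarrow> subgroup M G \<and>
     (\<forall>X Z. subgroup X G \<longrightarrow> subgroup Z G \<longrightarrow> X \<subseteq> Z \<longrightarrow> join X (M \<inter> Z) = join X M \<inter> Z) \<and>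
     (\<forall>Y Z. subgroup Y G \<longrightarrow> subgroup Z G \<longrightarrow> M \<subseteq> Z \<longrightarrow> join M (Y \<inter> Z) = join M Y \<inter> Z)"
  by (simp add: modular_subgroup_def join_def)

lemma modular_imp_subgroup: "modular_subgroup M G \<Longrightarrow> subgroup M G"
  by (simp add: modular_subgroup_def)

lemma modular_law:
  "\<lbrakk>modular_subgroup M G; subgroup X G; subgroup Z G; X \<subseteq> Z\<rbrakk> \<Longrightarrow> join X (M \<inter> Z) = join X M \<inter> Z"
  by (simp add: modular_subgroup_join_iff)

lemma modular_law_above:
  "\<lbrakk>modular_subgroup M G; subgroup Y G; subgroup Z G; M \<subseteq> Z\<rbrakk> \<Longrightarrow> join M (Y \<inter> Z) = join M Y \<inter> Z"
  by (simp add: modular_subgroup_join_iff)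

text \<open>
  The first modular law passes to \<open>H\<close> by intersecting with \<open>H\<close>. For the second,
  \<open>Z\<close> is replaced by its join with \<open>M\<close>, whose intersection with \<open>H\<close> is
  again \<open>Z\<close>.
\<close>
lemma modular_restrict:
  assumes M: "modular_subgroup M G" and H: "subgroup H G"
  shows "modular_subgroup (M \<inter> H) (G\<lparr>carrier := H\<rparr>)"
proof -
  note sM = modular_imp_subgroup[OF M]
  let ?GH = "G\<lparr>carrier := H\<rparr>"
  have MH: "subgroup (M \<inter> H) G" using subgroup_Int[OF sM H] .
  have sub: "subgroup X G \<and> X \<subseteq> H" if "subgroup X ?GH" for X
    using incl_subgroup[OF H that] subgroup.subset[OF that] by simp
  have gen: "generate ?GH K = generate G K" if "K \<subseteq> H" for K
    using generate_consistent[OF that H] .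
  have 1: "generate ?GH (X \<union> (M \<inter> H \<inter> Z)) = generate ?GH (X \<union> (M \<inter> H)) \<inter> Z"
    if "subgroup X ?GH" "subgroup Z ?GH" and XZ: "X \<subseteq> Z" for X Z
  proof -
    have X: "subgroup X G" "X \<subseteq> H" and Z: "subgroup Z G" "Z \<subseteq> H" using that sub by auto
    have "join X (M \<inter> H \<inter> Z) = join X (M \<inter> Z)" using Z by (metis Int_absorb1 Int_assoc)
    also have "\<dots> = join X M \<inter> H \<inter> Z" using modular_law[OF M X(1) Z(1) XZ] Z(2) by blast
    also have "\<dots> = join X (M \<inter> H) \<inter> Z" using modular_law[OF M X(1) H X(2)] by simp
    finally have "join X (M \<inter> H \<inter> Z) = join X (M \<inter> H) \<inter> Z" .
    then show ?thesis using gen X Z unfolding join_def by (simp add: le_infI1)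
  qed
  have 2: "generate ?GH ((M \<inter> H) \<union> (Y \<inter> Z)) = generate ?GH ((M \<inter> H) \<union> Y) \<inter> Z"
    if "subgroup Y ?GH" "subgroup Z ?GH" and MZ: "M \<inter> H \<subseteq> Z" for Y Z
  proof -
    have Y: "subgroup Y G" "Y \<subseteq> H" and Z: "subgroup Z G" "Z \<subseteq> H" using that sub by auto
    have YZ: "subgroup (Y \<inter> Z) G" "Y \<inter> Z \<subseteq> H" using subgroup_Int Y Z by auto
    let ?Z = "join M Z"
    have Z': "subgroup ?Z G" using join_subgroup[OF sM Z(1)] .
    have a: "Z = ?Z \<inter> H"
      using modular_law[OF M Z(1) H Z(2)] join_absorb[OF Z(1) MZ] join_comm by metis
    have b: "join M (Y \<inter> Z) = join M Y \<inter> ?Z"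
    proof -
      have "Y \<inter> Z = Y \<inter> ?Z" using a Y by blast
      then show ?thesis using modular_law_above[OF M Y(1) Z' join_upper(1)] by simp
    qed
    have "join (M \<inter> H) (Y \<inter> Z) = join M (Y \<inter> Z) \<inter> H"
      using modular_law[OF M YZ(1) H YZ(2)] join_comm by metis
    also have "\<dots> = (join M Y \<inter> H) \<inter> Z" using a b by blast
    also have "\<dots> = join (M \<inter> H) Y \<inter> Z"
      using modular_law[OF M Y(1) H Y(2)] join_comm by metis
    finally have "join (M \<inter> H) (Y \<inter> Z) = join (M \<inter> H) Y \<inter> Z" .
    then show ?thesis using gen Y Z unfolding join_def by (simp add: le_infI1)
  qed
  have "subgroup (M \<inter> H) ?GH" using subgroup_incl[OF MH H] by simp
  then show ?thesis unfolding modular_subgroup_def using 1 2 by simp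
qed

lemma modular_conj:
  assumes M: "modular_subgroup M G" and g: "g \<in> carrier G"
  shows "modular_subgroup (conj_by g ` M) G"
proof -
  note sM = modular_imp_subgroup[OF M]
  let ?c = "\<lambda>A. conj_by g ` A" and ?d = "\<lambda>A. conj_by (inv g) ` A"
  have Mc: "M \<subseteq> carrier G" using subgroup.subset[OF sM] .
  have cjoin: "?c (join A B) = join (?c A) (?c B)" if "A \<subseteq> carrier G" "B \<subseteq> carrier G" for A B
    using group_hom.generate_img[OF conj_by_hom[OF g], of "A \<union> B"] that
    by (simp add: join_def image_Un)
  have cint: "?c (A \<inter> B) = ?c A \<inter> ?c B" if "A \<subseteq> carrier G" "B \<subseteq> carrier G" for A B
    using inj_on_image_Int[OF conj_by_inj[OF g subset_refl] that] .
  have d: "subgroup (?d A) G \<and> ?c (?d A) = A \<and> ?d A \<subseteq> carrier G" if "subgroup A G" for A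
  proof -
    have "subgroup (?d A) G" using conj_by_image_subgroup[OF inv_closed[OF g] that] .
    then show ?thesis using conj_by_image_cancel(2)[OF g subgroup.subset[OF that]] subgroup.subset by blast
  qed
  show ?thesis
    unfolding modular_subgroup_join_iff
  proof (intro conjI allI impI)
    show "subgroup (?c M) G" using conj_by_image_subgroup[OF g sM] .
    fix X Z assume X: "subgroup X G" and Z: "subgroup Z G" and XZ: "X \<subseteq> Z"
    define X' Z' where "X' = ?d X" and "Z' = ?d Z"
    have X': "subgroup X' G" "?c X' = X" "X' \<subseteq> carrier G" and Z': "subgroup Z' G" "?c Z' = Z" "Z' \<subseteq> carrier G"
      using d[OF X] d[OF Z] by (auto simp only: X'_def Z'_def)
    have "X' \<subseteq> Z'" unfolding X'_def Z'_def by (rule image_mono[OF XZ])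
    then have "?c (join X' (M \<inter> Z')) = ?c (join X' M \<inter> Z')" using modular_law[OF M X'(1) Z'(1)] by simp
    moreover have "?c (join X' (M \<inter> Z')) = join X (?c M \<inter> Z)"
      using cjoin[OF X'(3), of "M \<inter> Z'"] cint[OF Mc Z'(3)] X'(2) Z'(2) Mc by (simp add: le_infI1)
    moreover have "?c (join X' M \<inter> Z') = join X (?c M) \<inter> Z"
      using cint[OF subgroup.subset[OF join_subgroup[OF X'(1) sM]] Z'(3)] cjoin[OF X'(3) Mc] X'(2) Z'(2) by simp
    ultimately show "join X (?c M \<inter> Z) = join X (?c M) \<inter> Z" by simp
  next
    fix Y Z assume Y: "subgroup Y G" and Z: "subgroup Z G" and MZ: "?c M \<subseteq> Z"
    define Y' Z' where "Y' = ?d Y" and "Z' = ?d Z"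
    have Y': "subgroup Y' G" "?c Y' = Y" "Y' \<subseteq> carrier G" and Z': "subgroup Z' G" "?c Z' = Z" "Z' \<subseteq> carrier G"
      using d[OF Y] d[OF Z] by (auto simp only: Y'_def Z'_def)
    have "?d (?c M) \<subseteq> Z'" unfolding Z'_def by (rule image_mono[OF MZ])
    then have "M \<subseteq> Z'" unfolding conj_by_image_cancel(1)[OF g Mc] .
    then have "?c (join M (Y' \<inter> Z')) = ?c (join M Y' \<inter> Z')" using modular_law_above[OF M Y'(1) Z'(1)] by simp
    moreover have "?c (join M (Y' \<inter> Z')) = join (?c M) (Y \<inter> Z)"
      using cjoin[OF Mc, of "Y' \<inter> Z'"] cint[OF Y'(3) Z'(3)] Y'(2,3) Z'(2) by (simp add: le_infI1)
    moreover have "?c (join M Y' \<inter> Z') = join (?c M) Y \<inter> Z"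
      using cint[OF subgroup.subset[OF join_subgroup[OF sM Y'(1)]] Z'(3)] cjoin[OF Mc Y'(3)] Y'(2) Z'(2) by simp
    ultimately show "join (?c M) (Y \<inter> Z) = join (?c M) Y \<inter> Z" by simp
  qed
qed

text \<open>
  For the first law, let \<open>V\<close> be the intersection of the join with \<open>join Z M\<close>.
  Modularity of \<open>N\<close> allows one to replace the join by \<open>V\<close>, and \<open>V\<close> by
  \<open>join (V \<inter> Z) M\<close>; modularity of \<open>M\<close> does the rest.
\<close>
lemma modular_join:
  assumes M: "modular_subgroup M G" and N: "modular_subgroup N G"
  shows "modular_subgroup (join M N) G"
proof -
  note sM = modular_imp_subgroup[OF M] and sN = modular_imp_subgroup[OF N]
  let ?J = "join M N"
  have J: "subgroup ?J G" using join_subgroup[OF sM sN] .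
  show ?thesis
    unfolding modular_subgroup_join_iff
  proof (intro conjI allI impI J)
    fix X Z assume X: "subgroup X G" and Z: "subgroup Z G" and XZ: "X \<subseteq> Z"
    let ?Z = "join Z M" and ?XM = "join X M"
    have Z': "subgroup ?Z G" and XM: "subgroup ?XM G" using join_subgroup Z X sM by auto
    have XMZ: "?XM \<subseteq> ?Z" using join_mono[OF XZ subset_refl] .
    define V where "V = ?J \<inter> ?Z"
    have V: "subgroup V G" unfolding V_def using subgroup_Int[OF J Z'] .
    have MV: "M \<subseteq> V" unfolding V_def using join_upper by blast
    have V1: "V = join M (N \<inter> ?Z)"
      unfolding V_def using modular_law[OF N sM Z' join_upper(2)] by simp
    have NZ: "subgroup (N \<inter> ?Z) G" using subgroup_Int[OF sN Z'] .
    have "join X ?J \<inter> ?Z = join ?XM N \<inter> ?Z" using join_assoc[OF X sM sN] by simp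
    also have "\<dots> = join ?XM (N \<inter> ?Z)" using modular_law[OF N XM Z' XMZ] by simp
    also have "\<dots> = join X V" using join_assoc[OF X sM NZ] V1 by simp
    finally have e1: "join X ?J \<inter> Z = join X V \<inter> Z" using join_upper(1)[of Z M] by blast
    have VZ: "subgroup (V \<inter> Z) G" using subgroup_Int[OF V Z] .
    have XVZ: "subgroup (join X (V \<inter> Z)) G" using join_subgroup[OF X VZ] .
    have "join M (Z \<inter> V) = join M Z \<inter> V" by (rule modular_law_above[OF M Z V MV])
    also have "\<dots> = V" unfolding V_def join_comm[of M Z] by blast
    finally have "V = join (V \<inter> Z) M" unfolding Int_commute[of Z V] join_comm[of M] by (rule sym)
    then have "join X V = join (join X (V \<inter> Z)) M" using join_assoc[OF X VZ sM] by simp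
    moreover have le: "join X (V \<inter> Z) \<subseteq> Z" using join_least[OF Z XZ] by blast
    ultimately have "join X V \<inter> Z = join (join X (V \<inter> Z)) (M \<inter> Z)"
      using modular_law[OF M XVZ Z le] by simp
    also have "\<dots> = join X (V \<inter> Z)"
    proof (rule join_absorb[OF XVZ])
      show "M \<inter> Z \<subseteq> join X (V \<inter> Z)" using MV join_upper(2)[of "V \<inter> Z" X] by blast
    qed
    finally have "join X V \<inter> Z = join X (V \<inter> Z)" .
    moreover have "V \<inter> Z = ?J \<inter> Z" unfolding V_def using join_upper(1)[of Z M] by blast
    ultimately show "join X (?J \<inter> Z) = join X ?J \<inter> Z" using e1 by simp
  next
    fix Y Z assume Y: "subgroup Y G" and Z: "subgroup Z G" and JZ: "?J \<subseteq> Z"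
    have MZ: "M \<subseteq> Z" "N \<subseteq> Z" using JZ join_upper by (blast+)
    have YZ: "subgroup (Y \<inter> Z) G" and NY: "subgroup (join N Y) G"
      using subgroup_Int[OF Y Z] join_subgroup[OF sN Y] by auto
    have "join ?J Y \<inter> Z = join M (join N Y) \<inter> Z" using join_assoc[OF sM sN Y] by simp
    also have "\<dots> = join M (join N Y \<inter> Z)" using modular_law_above[OF M NY Z MZ(1)] by simp
    also have "\<dots> = join M (join N (Y \<inter> Z))" using modular_law_above[OF N Y Z MZ(2)] by simp
    also have "\<dots> = join ?J (Y \<inter> Z)" using join_assoc[OF sM sN YZ] by simp
    finally show "join ?J (Y \<inter> Z) = join ?J Y \<inter> Z" by simp
  qed
qed

lemma normal_imp_modular:
  assumes N: "N \<lhd> G"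
  shows "modular_subgroup N G"
proof -
  have sN: "subgroup N G" using N normal_imp_subgroup by blast
  have nrm: "\<And>g h. \<lbrakk>g \<in> carrier G; h \<in> N\<rbrakk> \<Longrightarrow> conj_by g h \<in> N"
    using N normal_inv_iff by (simp add: conj_by_def)
  have jn: "join N X = N <#> X" if X: "subgroup X G" for X
  proof
    have "subgroup (N <#> X) G"
      by (rule set_mult_subgroup[OF sN X]) (use nrm subgroup.mem_carrier[OF X] in blast)
    then show "join N X \<subseteq> N <#> X" by (rule join_least[OF _ set_mult_incl[OF sN X]])
    show "N <#> X \<subseteq> join N X" by (rule set_mult_least[OF join_subgroup[OF sN X] join_upper])
  qed
  show ?thesis
    unfolding modular_subgroup_join_iff
  proof (intro conjI allI impI sN)
    fix X Z assume X: "subgroup X G" and Z: "subgroup Z G" and XZ: "X \<subseteq> Z"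
    have NZ: "subgroup (N \<inter> Z) G" using subgroup_Int[OF sN Z] .
    have "join X N \<inter> Z = (N \<inter> Z) <#> X"
      using jn[OF X] dedekind_right[OF Z XZ subgroup.subset[OF sN]] by (simp add: join_comm[of X])
    also have "\<dots> \<subseteq> join X (N \<inter> Z)"
      by (rule set_mult_least[OF join_subgroup[OF X NZ]]) (rule join_upper)+
    finally show "join X (N \<inter> Z) = join X N \<inter> Z"
      using join_mono[of X X "N \<inter> Z" N] join_least[OF Z XZ, of "N \<inter> Z"] by blast
  next
    fix Y Z assume Y: "subgroup Y G" and Z: "subgroup Z G" and NZ: "N \<subseteq> Z"
    show "join N (Y \<inter> Z) = join N Y \<inter> Z"
      using jn[OF Y] jn[OF subgroup_Int[OF Y Z]] dedekind_left[OF Z NZ subgroup.subset[OF Y]] by simp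
  qed
qed

end

context fin_group
begin

text \<open>
  Take \<open>W\<close> maximal among the proper modular subgroups above \<open>M\<close>. If it is not normal,
  \<open>x\<close> is an element of least order outside its normalizer. Minimality of the order of
  \<open>x\<close> means that every proper subgroup of \<open>\<langle>x\<rangle>\<close> normalizes
  \<open>W\<close>. A subgroup \<open>Y\<close> above \<open>W\<close> is the join of \<open>W\<close> and
  \<open>\<langle>x\<rangle> \<inter> Y\<close>, so it is \<open>G\<close> or lies in the normalizer of
  \<open>W\<close>. For a subgroup \<open>A\<close> between \<open>Z \<inter> N\<^sub>G(W)\<close> and
  \<open>Z\<close>, apply this to the join of \<open>A\<close> and \<open>W\<close>.
\<close>
lemma modular_proper_trace_overgroup:
  assumes M: "modular_subgroup M G" "M \<noteq> carrier G"
  shows "\<exists>V. subgroup V G \<and> M \<subseteq> V \<and> V \<noteq> carrier G \<and>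
    (V \<lhd> G \<or> (\<forall>Z. subgroup Z G \<longrightarrow> adjacent G (Z \<inter> V) Z))"
proof -
  let ?S = "{W. modular_subgroup W G \<and> M \<subseteq> W \<and> W \<noteq> carrier G}"
  have finS: "finite ?S"
    by (rule finite_subset[of _ "Pow (carrier G)"]) (use fin modular_imp_subgroup subgroup.subset in auto)
  have "M \<in> ?S" using M by simp
  then obtain W where W: "W \<in> ?S" "\<And>W'. W' \<in> ?S \<Longrightarrow> card W' \<le> card W"
    using obtains_MAX[OF finS, of card] Max_ge[OF finite_imageI[OF finS], of _ card]
    by (metis (no_types, lifting) empty_iff imageI)
  have mW: "modular_subgroup W G" and MW: "M \<subseteq> W" and Wne: "W \<noteq> carrier G" using W(1) by auto
  have sW: "subgroup W G" using modular_imp_subgroup[OF mW] .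
  have Wc: "W \<subseteq> carrier G" using subgroup.subset[OF sW] .
  show ?thesis
  proof (cases "W \<lhd> G")
    case True
    then show ?thesis using sW MW Wne by blast
  next
    case False
    let ?V = "normalizer_in (carrier G) W"
    have V: "subgroup ?V G" using normalizer_in_subgroup[OF subgroup_self Wc] .
    have WV: "W \<subseteq> ?V" using subgroup_le_normalizer[OF sW Wc] .
    have Vne: "?V \<noteq> carrier G"
    proof
      assume "?V = carrier G"
      then have "W \<lhd> G" unfolding normal_conj_by normalizer_in_def using sW by blast
      then show False using False by simp
    qed
    have ex: "\<exists>x. x \<in> carrier G \<and> x \<notin> ?V" using Vne subgroup.subset[OF V] by blast
    obtain x where x: "x \<in> carrier G" "x \<notin> ?V"
      and min: "\<And>z. z \<in> carrier G \<Longrightarrow> z \<notin> ?V \<Longrightarrow> ord x \<le> ord z"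
      using ex_has_least_nat[of "\<lambda>x. x \<in> carrier G \<and> x \<notin> ?V" _ ord] ex by metis
    let ?X = "generate G {x}"
    have X: "subgroup ?X G" using generate_is_subgroup x by simp
    have xX: "x \<in> ?X" by (rule generate.incl) simp
    have Xproper: "D \<subseteq> ?V" if D: "subgroup D G" "D \<subseteq> ?X" "x \<notin> D" for D
    proof
      fix z assume z: "z \<in> D"
      have zc: "z \<in> carrier G" using subgroup.mem_carrier[OF D(1) z] .
      have "generate G {z} \<subseteq> D" using generate_subgroup_incl[OF _ D(1)] z by simp
      then have "generate G {z} \<subset> ?X" using D xX by blast
      then have "card (generate G {z}) < card ?X" using subgroup_psubset_card[OF X] by blast
      then have "ord z < ord x" using generate_pow_card zc x by simp
      then show "z \<in> ?V" using min[OF zc] by fastforce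
    qed
    let ?Wx = "conj_by x ` W"
    have mWx: "modular_subgroup ?Wx G" using modular_conj[OF mW x(1)] .
    have sWx: "subgroup ?Wx G" using modular_imp_subgroup[OF mWx] .
    have "?Wx \<noteq> W" using x by (simp add: normalizer_in_def)
    have WWx: "W \<noteq> join W ?Wx"
    proof
      assume "W = join W ?Wx"
      then have "?Wx \<subseteq> W" using join_upper(2)[of ?Wx W] by simp
      then have "?Wx = W" by (intro conj_by_image_eqI[OF x(1) Wc]) auto
      then show False using \<open>?Wx \<noteq> W\<close> by simp
    qed
    \<comment> \<open>the join is modular and larger than \<open>W\<close>\<close>
    have J: "join W ?Wx = carrier G"
    proof (rule ccontr)
      assume "join W ?Wx \<noteq> carrier G"
      then have "join W ?Wx \<in> ?S" using modular_join[OF mW mWx] MW join_upper(1) by blast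
      then have "card (join W ?Wx) \<le> card W" by (rule W(2))
      then show False using subgroup_card_eq[OF sW join_subgroup[OF sW sWx] join_upper(1)] WWx by simp
    qed
    have JX: "join W ?X = carrier G"
    proof -
      have s: "subgroup (join W ?X) G" using join_subgroup[OF sW X] .
      have "?Wx \<subseteq> join W ?X"
      proof
        fix z assume "z \<in> ?Wx"
        then obtain w where "w \<in> W" "z = conj_by x w" by blast
        moreover have "x \<in> join W ?X" "w \<in> join W ?X" if "w \<in> W" for w
          using that xX join_upper by blast+
        ultimately show "z \<in> join W ?X" using conj_by_mem_subgroup[OF s] by blast
      qed
      then show ?thesis using join_least[OF s join_upper(1)] J subgroup.subset[OF s] by blast
    qed
    have dich: "Y = carrier G \<or> Y \<subseteq> ?V" if Y: "subgroup Y G" "W \<subseteq> Y" for Y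
    proof -
      have e: "Y = join W (?X \<inter> Y)"
        using modular_law_above[OF mW X Y] JX subgroup.subset[OF Y(1)] by blast
      show ?thesis
      proof (cases "x \<in> Y")
        case True
        then have "?X \<subseteq> Y" using generate_subgroup_incl[OF _ Y(1)] by simp
        then have "carrier G \<subseteq> Y" using join_least[OF Y] JX by blast
        then show ?thesis using subgroup.subset[OF Y(1)] by blast
      next
        case False
        have "?X \<inter> Y \<subseteq> ?V" by (rule Xproper[OF subgroup_Int[OF X Y(1)]]) (use False in auto)
        then have "join W (?X \<inter> Y) \<subseteq> ?V" using join_least[OF V WV] by blast
        then show ?thesis using e by simp
      qed
    qed
    have "adjacent G (Z \<inter> ?V) Z" if Z: "subgroup Z G" for Z
      unfolding adjacent_def
    proof (intro allI impI)
      fix A assume A: "subgroup A G" "Z \<inter> ?V \<subseteq> A" "A \<subseteq> Z"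
      have s: "subgroup (join A W) G" using join_subgroup[OF A(1) sW] .
      show "A = Z \<inter> ?V \<or> A = Z"
      proof (cases "join A W = carrier G")
        case True
        then have "join A (W \<inter> Z) = Z" using modular_law[OF mW A(1) Z A(3)] subgroup.subset[OF Z] by blast
        moreover have "W \<inter> Z \<subseteq> A" using A WV by blast
        ultimately show ?thesis using join_absorb[OF A(1)] by simp
      next
        case False
        then have "join A W \<subseteq> ?V" using dich[OF s join_upper(2)] by blast
        then show ?thesis using A join_upper(1)[of A W] by blast
      qed
    qed
    then show ?thesis using V WV Vne MW by blast
  qed
qed

end

section \<open>From modular subgroups to residuals\<close>

lemma (in normal) union_mem_iff:
  assumes "subgroup A (G Mod H)" "x \<in> carrier G"
  shows "x \<in> \<Union>A \<longleftrightarrow> H #> x \<in> A"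
  using factgroup_subgroup_union_char[OF assms(1)] assms(2) by auto

text \<open>
  The correspondence between subgroups of the quotient and subgroups above \<open>H\<close>.
\<close>
lemma (in normal) subgroup_Mod_eqI:
  assumes A: "subgroup A (G Mod H)" and B: "subgroup B (G Mod H)" and eq: "\<Union>A = \<Union>B"
  shows "A = B"
proof -
  have "C \<in> A \<longleftrightarrow> C \<in> B" for C
  proof (cases "C \<in> carrier (G Mod H)")
    case True
    then obtain x where "x \<in> carrier G" "C = H #> x" unfolding carrier_FactGroup by blast
    then show ?thesis using union_mem_iff[OF A] union_mem_iff[OF B] eq by metis
  next
    case False
    then show ?thesis using subgroup.subset[OF A] subgroup.subset[OF B] by blast
  qed
  then show ?thesis by blast
qed

lemma (in normal) union_contains:
  assumes "subgroup A (G Mod H)" shows "H \<subseteq> \<Union>A"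
  using subgroup.one_closed[OF assms] by auto

lemma (in normal) fin_group_Mod:
  assumes "finite (carrier G)" shows "fin_group (G Mod H)"
  by (rule fin_group.intro[OF factorgroup_is_group])
    (simp add: fin_group_axioms.intro carrier_FactGroup assms)

context fin_group
begin

text \<open>
  The core \<open>K\<close> of \<open>V\<close> enters as a normal subgroup of maximal order inside
  \<open>V\<close>; maximal traces survive in \<open>G/K\<close>, where the image of \<open>V\<close> is
  core-free.
\<close>
lemma trace_residual_subset:
  assumes V: "subgroup V G" and tr: "\<And>Z. subgroup Z G \<Longrightarrow> adjacent G (Z \<inter> V) Z"
    and nn: "\<not> V \<lhd> G"
  shows "residual U1 G \<subseteq> V"
proof -
  have Vc: "V \<subseteq> carrier G" using subgroup.subset[OF V] .
  let ?S = "{K. K \<lhd> G \<and> K \<subseteq> V}"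
  have finS: "finite ?S" by (rule finite_subset[of _ "Pow (carrier G)"]) (use fin Vc in auto)
  have "{\<one>} \<in> ?S" using one_is_normal subgroup.one_closed[OF V] by simp
  then have "?S \<noteq> {}" by blast
  then obtain K where K: "K \<in> ?S" "Max (card ` ?S) = card K" using obtains_MAX[OF finS] by blast
  have Kmax: "card K' \<le> card K" if "K' \<in> ?S" for K'
    using Max_ge[OF finite_imageI[OF finS], of "card K'" card] that K(2) by simp
  have KG: "K \<lhd> G" and KV: "K \<subseteq> V" using K(1) by auto
  interpret K: normal K G using KG .
  interpret Q: fin_group "G Mod K" using K.fin_group_Mod[OF fin] .
  define W where "W = (\<lambda>x. K #> x) ` V"
  have Wsub: "subgroup W (G Mod K)"
  proof -
    have "group_hom G (G Mod K) (\<lambda>x. K #> x)"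
      by (intro group_hom.intro is_group Q.is_group group_hom_axioms.intro K.r_coset_hom_Mod)
    then show ?thesis unfolding W_def using group_hom.subgroup_img_is_subgroup V by blast
  qed
  have UW: "\<Union>W = V"
  proof
    show "\<Union>W \<subseteq> V" unfolding W_def r_coset_def using KV subgroup.m_closed[OF V] by auto
    show "V \<subseteq> \<Union>W" unfolding W_def using rcos_self[OF _ K.is_subgroup] Vc by blast
  qed
  have "U1 (G Mod K)"
  proof (rule Q.core_free_trace_U1[OF Wsub])
    fix Z assume Z: "subgroup Z (G Mod K)"
    show "adjacent (G Mod K) (Z \<inter> W) Z"
      unfolding adjacent_def
    proof (intro allI impI)
      fix C assume C: "subgroup C (G Mod K)" "Z \<inter> W \<subseteq> C" "C \<subseteq> Z"
      have ZW: "subgroup (Z \<inter> W) (G Mod K)" using Q.subgroup_Int[OF Z Wsub] .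
      have sub: "subgroup (\<Union>Z) G" "subgroup (\<Union>C) G"
        using K.factgroup_subgroup_union_subgroup Z C by auto
      have UZW: "\<Union>(Z \<inter> W) = \<Union>Z \<inter> V"
      proof -
        have "x \<in> \<Union>(Z \<inter> W) \<longleftrightarrow> x \<in> \<Union>Z \<inter> V" if "x \<in> carrier G" for x
          using K.union_mem_iff[OF ZW that] K.union_mem_iff[OF Z that] K.union_mem_iff[OF Wsub that] UW by simp
        moreover have "\<Union>(Z \<inter> W) \<subseteq> carrier G" "\<Union>Z \<inter> V \<subseteq> carrier G"
          using subgroup.subset[OF K.factgroup_subgroup_union_subgroup[OF ZW]] Vc by auto
        ultimately show ?thesis by blast
      qed
      have "\<Union>Z \<inter> V \<subseteq> \<Union>C" "\<Union>C \<subseteq> \<Union>Z" using C UZW by blast+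
      then have "\<Union>C = \<Union>(Z \<inter> W) \<or> \<Union>C = \<Union>Z"
        using adjacentD[OF tr[OF sub(1)] sub(2)] UZW by simp
      then show "C = Z \<inter> W \<or> C = Z" using K.subgroup_Mod_eqI[OF C(1) ZW] K.subgroup_Mod_eqI[OF C(1) Z] by blast
    qed
  next
    fix D assume D: "D \<lhd> G Mod K" "D \<subseteq> W"
    have sD: "subgroup D (G Mod K)" using D normal_imp_subgroup by blast
    have UD: "\<Union>D \<in> ?S" using K.factgroup_subgroup_union_normal[OF D(1)] D(2) UW by blast
    have "K = \<Union>D"
      using subgroup_card_eq[OF K.is_subgroup K.factgroup_subgroup_union_subgroup[OF sD] K.union_contains[OF sD] Kmax[OF UD]] .
    moreover have t: "subgroup {\<one>\<^bsub>G Mod K\<^esub>} (G Mod K)" by (rule Q.triv_subgroup)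
    ultimately show "D = {\<one>\<^bsub>G Mod K\<^esub>}" using K.subgroup_Mod_eqI[OF sD t] by simp
  next
    show "\<not> W \<lhd> G Mod K"
    proof
      assume "W \<lhd> G Mod K"
      then have "V \<lhd> G" using K.factgroup_subgroup_union_normal UW by metis
      then show False using nn by simp
    qed
  qed
  then have "K \<in> {N. N \<lhd> G \<and> U1 (G Mod N)}" using KG by simp
  then have "residual U1 G \<subseteq> K" unfolding residual_def by blast
  then show ?thesis using KV by blast
qed

end

definition submodular_step :: "('a, 'b) monoid_scheme \<Rightarrow> 'a set \<Rightarrow> 'a set \<Rightarrow> bool" where
  "submodular_step G A B \<longleftrightarrow> subgroup A G \<and> subgroup B G \<and> A \<subseteq> B \<and> modular_subgroup A (G\<lparr>carrier := B\<rparr>)"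

definition KU1_step :: "('a, 'b) monoid_scheme \<Rightarrow> 'a set \<Rightarrow> 'a set \<Rightarrow> bool" where
  "KU1_step G A B \<longleftrightarrow> subgroup A G \<and> subgroup B G \<and> A \<subseteq> B \<and>
     (A \<lhd> G\<lparr>carrier := B\<rparr> \<or> residual U1 (G\<lparr>carrier := B\<rparr>) \<subseteq> A)"

lemma chain_iff_rtranclp:
  assumes R: "\<And>A B. R A B \<longleftrightarrow> P A \<and> P B \<and> S A B"
  shows "(\<exists>(n::nat) C. C 0 = a \<and> C n = b \<and> (\<forall>i\<le>n. P (C i)) \<and> (\<forall>i<n. S (C i) (C (Suc i))))
    \<longleftrightarrow> P a \<and> P b \<and> R\<^sup>*\<^sup>* a b"
proof
  assume "\<exists>(n::nat) C. C 0 = a \<and> C n = b \<and> (\<forall>i\<le>n. P (C i)) \<and> (\<forall>i<n. S (C i) (C (Suc i)))"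
  then obtain n :: nat and C where C: "C 0 = a" "C n = b" "\<forall>i\<le>n. P (C i)" "\<forall>i<n. S (C i) (C (Suc i))" by blast
  then have "(R ^^ n) a b" unfolding relpowp_fun_conv R by (intro exI[of _ C]) simp
  moreover have "P a" "P b" using C by auto
  ultimately show "P a \<and> P b \<and> R\<^sup>*\<^sup>* a b" by (blast intro: relpowp_imp_rtranclp)
next
  assume *: "P a \<and> P b \<and> R\<^sup>*\<^sup>* a b"
  then obtain n C where C: "C 0 = a" "C n = b" "\<forall>i<n. R (C i) (C (Suc i))"
    unfolding rtranclp_power relpowp_fun_conv by blast
  have "P (C i)" if "i \<le> n" for i
    using that * C R by (cases "i = n") auto
  then show "\<exists>(n::nat) C. C 0 = a \<and> C n = b \<and> (\<forall>i\<le>n. P (C i)) \<and> (\<forall>i<n. S (C i) (C (Suc i)))"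
    using C R by (intro exI[of _ n] exI[of _ C]) simp
qed

context fin_group
begin

lemma submodular_iff_rtranclp:
  assumes "subgroup Q G"
  shows "submodular_subgroup Q G \<longleftrightarrow> (submodular_step G)\<^sup>*\<^sup>* Q (carrier G)"
  unfolding submodular_subgroup_def
  using chain_iff_rtranclp[of "submodular_step G" "\<lambda>A. subgroup A G"
      "\<lambda>A B. A \<subseteq> B \<and> modular_subgroup A (G\<lparr>carrier := B\<rparr>)" Q "carrier G"] assms subgroup_self
  by (simp add: submodular_step_def)

lemma KU1_subnormal_iff_rtranclp:
  assumes "subgroup Q G"
  shows "KF_subnormal U1 Q G \<longleftrightarrow> (KU1_step G)\<^sup>*\<^sup>* Q (carrier G)"
  unfolding KF_subnormal_def
  using chain_iff_rtranclp[of "KU1_step G" "\<lambda>A. subgroup A G"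
      "\<lambda>A B. A \<subseteq> B \<and> (A \<lhd> G\<lparr>carrier := B\<rparr> \<or> residual U1 (G\<lparr>carrier := B\<rparr>) \<subseteq> A)" Q "carrier G"] assms subgroup_self
  by (simp add: KU1_step_def)

lemma subgroup_fin_group: "subgroup B G \<Longrightarrow> fin_group (G\<lparr>carrier := B\<rparr>)"
  using finite_subgroup subgroup_imp_group by (simp add: fin_group_def fin_group_axioms_def)

text \<open>
  Go down from \<open>B\<close> to a proper subgroup above \<open>M\<close> with maximal traces, which is normal
  or contains the residual, and repeat inside it.
\<close>
lemma modular_imp_KU1_chain:
  assumes "subgroup B G" "modular_subgroup M (G\<lparr>carrier := B\<rparr>)"
  shows "(KU1_step G)\<^sup>*\<^sup>* M B"
  using assms
proof (induction "card B" arbitrary: B rule: less_induct)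
  case less
  note B = less.prems(1) and M = less.prems(2)
  interpret B: fin_group "G\<lparr>carrier := B\<rparr>" using subgroup_fin_group[OF B] .
  show ?case
  proof (cases "M = B")
    case True
    then show ?thesis by simp
  next
    case False
    then obtain V where V: "subgroup V (G\<lparr>carrier := B\<rparr>)" "M \<subseteq> V" "V \<noteq> B"
      "V \<lhd> G\<lparr>carrier := B\<rparr> \<or> (\<forall>Z. subgroup Z (G\<lparr>carrier := B\<rparr>) \<longrightarrow> adjacent (G\<lparr>carrier := B\<rparr>) (Z \<inter> V) Z)"
      using B.modular_proper_trace_overgroup[OF M] by auto
    have VG: "subgroup V G" "V \<subset> B"
      using incl_subgroup[OF B V(1)] subgroup.subset[OF V(1)] V(3) by auto
    have "V \<lhd> G\<lparr>carrier := B\<rparr> \<or> residual U1 (G\<lparr>carrier := B\<rparr>) \<subseteq> V"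
      using B.trace_residual_subset[OF V(1)] V(4) by blast
    then have "KU1_step G V B" using VG B by (simp add: KU1_step_def psubset_imp_subset)
    moreover have "modular_subgroup M (G\<lparr>carrier := V\<rparr>)"
      using B.modular_restrict[OF M V(1)] V(2) by (simp add: Int_absorb2)
    then have "(KU1_step G)\<^sup>*\<^sup>* M V"
      using less.hyps[OF subgroup_psubset_card[OF B VG(2)] VG(1)] by blast
    ultimately show ?thesis by simp
  qed
qed

lemma submodular_imp_KU1_chain:
  assumes "(submodular_step G)\<^sup>*\<^sup>* Q A"
  shows "(KU1_step G)\<^sup>*\<^sup>* Q A"
  using assms
proof (induction rule: rtranclp_induct)
  case (step A B)
  then show ?case using modular_imp_KU1_chain[of B A] unfolding submodular_step_def by simp
qed simp

end

section \<open>Normal towers\<close>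

text \<open>
  A descending tower of normal subgroups of \<open>G\<close>, starting at \<open>G\<close>, whose nontrivial
  factors have prime order.
\<close>
inductive normal_tower :: "('a, 'b) monoid_scheme \<Rightarrow> 'a set \<Rightarrow> bool" for G where
  top: "normal_tower G (carrier G)"
| down: "\<lbrakk>normal_tower G L; K \<lhd> G; K \<subseteq> L; adjacent G K L\<rbrakk> \<Longrightarrow> normal_tower G K"

context fin_group
begin

lemma normal_tower_normal: "normal_tower G K \<Longrightarrow> K \<lhd> G"
  by (induction rule: normal_tower.induct) (simp_all add: normal_self)

text \<open>
  Intersecting with \<open>N\<close> keeps the factors of prime order or makes them trivial. This is the closure
  of supersolvable groups under subdirect products.
\<close>
lemma normal_tower_Int:
  assumes N: "normal_tower G N" and A: "normal_tower G A"
  shows "normal_tower G (N \<inter> A)"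
  using A
proof (induction rule: normal_tower.induct)
  case top
  then show ?case
    using N subgroup.subset[OF normal_imp_subgroup[OF normal_tower_normal[OF N]]] by (simp add: Int_absorb2)
next
  case (down L K)
  have sub: "subgroup N G" "subgroup K G" "subgroup L G"
    using normal_imp_subgroup normal_tower_normal N down by blast+
  have "N \<inter> K \<lhd> G" using normal_subgroup_intersect normal_tower_normal[OF N] down by blast
  moreover have "adjacent G (N \<inter> K) (N \<inter> L)"
    unfolding adjacent_def
  proof (intro allI impI)
    fix Y assume Y: "subgroup Y G" "N \<inter> K \<subseteq> Y" "Y \<subseteq> N \<inter> L"
    have Yc: "Y \<subseteq> carrier G" and Kc: "K \<subseteq> carrier G" using subgroup.subset Y sub by auto
    have KY: "subgroup (K <#> Y) G"
      by (rule set_mult_subgroup[OF sub(2) Y(1)]) (use down normal_conj_by Yc in blast)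
    have "K <#> Y \<subseteq> L" by (rule set_mult_least[OF sub(3)]) (use down Y in auto)
    then have "K <#> Y = K \<or> K <#> Y = L"
      using adjacentD[OF down(4) KY set_mult_incl(1)[OF sub(2) Y(1)]] by blast
    then show "Y = N \<inter> K \<or> Y = N \<inter> L"
    proof
      assume "K <#> Y = K"
      then have "Y \<subseteq> K" using set_mult_incl(2)[OF sub(2) Y(1)] by simp
      then show ?thesis using Y by blast
    next
      assume e: "K <#> Y = L"
      have "N \<inter> L = (K \<inter> N) <#> Y"
        using dedekind_right[OF sub(1) _ Kc, of Y] Y e by (simp add: Int_commute)
      also have "\<dots> \<subseteq> Y" by (rule set_mult_least[OF Y(1)]) (use Y in auto)
      finally have "N \<inter> L \<subseteq> Y" .
      then show ?thesis using Y by blast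
    qed
  qed
  ultimately show ?case using normal_tower.down[OF down.IH, of "N \<inter> K"] down by blast
qed

text \<open>
  Subgroups of a normal cyclic section are characteristic in it.
\<close>
lemma between_cyclic_normal:
  assumes K: "K \<lhd> G" and L: "L \<lhd> G" and g: "g \<in> L"
    and gen: "\<And>x. x \<in> L \<Longrightarrow> \<exists>k\<in>K. \<exists>n::nat. x = k \<otimes> g [^] n"
    and Y: "subgroup Y G" "K \<subseteq> Y" "Y \<subseteq> L"
  shows "Y \<lhd> G"
  unfolding normal_conj_by
proof (intro conjI ballI Y(1))
  have sK: "subgroup K G" and sL: "subgroup L G" using K L normal_imp_subgroup by auto
  have Kn: "\<And>g a. \<lbrakk>g \<in> carrier G; a \<in> K\<rbrakk> \<Longrightarrow> conj_by g a \<in> K"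
    and Ln: "\<And>g a. \<lbrakk>g \<in> carrier G; a \<in> L\<rbrakk> \<Longrightarrow> conj_by g a \<in> L" using K L normal_conj_by by auto
  have Kc: "\<And>k. k \<in> K \<Longrightarrow> k \<in> carrier G" using subgroup.mem_carrier[OF sK] .
  have gc: "g \<in> carrier G" using g subgroup.mem_carrier[OF sL] by blast
  fix a y assume a: "a \<in> carrier G" and y: "y \<in> Y"
  obtain k i where k: "k \<in> K" "y = k \<otimes> g [^] (i::nat)" using gen y Y by blast
  obtain k' j where k': "k' \<in> K" "conj_by a g = k' \<otimes> g [^] (j::nat)" using gen[OF Ln[OF a g]] by blast
  obtain b where b: "b \<in> K" "(k' \<otimes> g [^] j) [^] i = b \<otimes> (g [^] j) [^] i"
    using mult_pow_normalized[OF sK _ Kn k'(1), of "g [^] j" i] gc by blast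
  obtain b' where b': "b' \<in> K" "y [^] j = b' \<otimes> (g [^] i) [^] j"
    using mult_pow_normalized[OF sK _ Kn k(1), of "g [^] i" j] gc k(2) by blast
  have "(g [^] j) [^] i = (g [^] i) [^] j" using gc by (simp add: nat_pow_pow mult.commute)
  also have "\<dots> = inv b' \<otimes> y [^] j" using b' Kc gc by (simp add: m_assoc[symmetric])
  also have "\<dots> \<in> Y"
    using b' Y subgroup_nat_pow_closed[OF Y(1) y] subgroup.m_closed[OF Y(1)] subgroup.m_inv_closed[OF Y(1)] by blast
  finally have gij: "(g [^] j) [^] i \<in> Y" .
  have "conj_by a y = conj_by a k \<otimes> (b \<otimes> (g [^] j) [^] i)"
    using k k' b a gc Kc by (simp add: conj_by_mult conj_by_pow)
  moreover have "conj_by a k \<in> Y" "b \<in> Y" using Kn a k b Y by auto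
  ultimately show "conj_by a y \<in> Y" using gij subgroup.m_closed[OF Y(1)] by simp
qed

text \<open>
  A cyclic normal section can be refined by normal subgroups with factors of prime order.
\<close>
lemma normal_tower_cyclic:
  assumes K: "K \<lhd> G" and L: "L \<lhd> G" and g: "g \<in> L"
    and gen: "\<And>x. x \<in> L \<Longrightarrow> \<exists>k\<in>K. \<exists>n::nat. x = k \<otimes> g [^] n" and tw: "normal_tower G L"
    and Y: "subgroup Y G" "K \<subseteq> Y" "Y \<subseteq> L"
  shows "normal_tower G Y"
  using Y
proof (induction "card L - card Y" arbitrary: Y rule: less_induct)
  case less
  note Y = less.prems
  have sL: "subgroup L G" using L normal_imp_subgroup by blast
  show ?case
  proof (cases "Y = L")
    case True
    then show ?thesis using tw by simp
  next
    case False
    have ex: "\<exists>X. subgroup X G \<and> Y \<subset> X \<and> X \<subseteq> L" using sL False Y by blast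
    obtain X where X: "subgroup X G" "Y \<subset> X" "X \<subseteq> L"
      and min: "\<And>X'. subgroup X' G \<and> Y \<subset> X' \<and> X' \<subseteq> L \<Longrightarrow> card X \<le> card X'"
      using ex_has_least_nat[of "\<lambda>X. subgroup X G \<and> Y \<subset> X \<and> X \<subseteq> L" _ card] ex by metis
    have "adjacent G Y X"
      unfolding adjacent_def
    proof (intro allI impI)
      fix C assume C: "subgroup C G" "Y \<subseteq> C" "C \<subseteq> X"
      show "C = Y \<or> C = X"
      proof (cases "C = Y")
        case False
        then have "Y \<subset> C" "C \<subseteq> L" using C X by auto
        then have "card X \<le> card C" using min[of C] C by blast
        then have "C = X" using subgroup_card_eq[OF C(1) X(1) C(3)] by blast
        then show ?thesis by blast
      qed simp
    qed
    moreover have "normal_tower G X"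
    proof (rule less.hyps[OF _ X(1) _ X(3)])
      show "K \<subseteq> X" using X Y by blast
      have "card Y < card X" "card X \<le> card L"
        using subgroup_psubset_card[OF X(1,2)] card_mono[OF finite_subgroup[OF sL] X(3)] by auto
      then show "card L - card X < card L - card Y" by linarith
    qed
    moreover have "Y \<lhd> G" using between_cyclic_normal[OF K L g gen Y] .
    ultimately show ?thesis using normal_tower.down X by blast
  qed
qed

text \<open>
  For normal \<open>K\<close>: the exponent of \<open>G/K\<close> is squarefree. In this form the property is
  visibly stable under intersections.
\<close>
definition squarefree_exponent_mod :: "'a set \<Rightarrow> bool" where
  "squarefree_exponent_mod K \<longleftrightarrow> (\<forall>r::nat. prime r \<longrightarrow> (\<forall>x\<in>carrier G. x [^] (r * r) \<in> K \<longrightarrow> x [^] r \<in> K))"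

lemma U1_Mod_normal_tower:
  assumes N: "N \<lhd> G" and U: "U1 (G Mod N)"
  shows "normal_tower G N \<and> squarefree_exponent_mod N"
proof
  interpret N: normal N G using N .
  interpret Q: fin_group "G Mod N" using N.fin_group_Mod[OF fin] .
  have coset_eq: "N #> x = N \<longleftrightarrow> x \<in> N" if "x \<in> carrier G" for x
    using coset_join1[OF _ that N.is_subgroup] coset_join2[OF that N.is_subgroup] subgroup.subset[OF N.is_subgroup] by blast
  show "squarefree_exponent_mod N"
    unfolding squarefree_exponent_mod_def
  proof (intro allI impI ballI)
    fix r :: nat and x assume r: "prime r" and x: "x \<in> carrier G" "x [^] (r * r) \<in> N"
    have xQ: "N #> x \<in> carrier (G Mod N)" using x by (auto simp: carrier_FactGroup)
    have "(N #> x) [^]\<^bsub>G Mod N\<^esub> (r * r) = \<one>\<^bsub>G Mod N\<^esub>"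
      using x coset_eq[of "x [^] (r * r)"] by (simp add: N.FactGroup_pow)
    then have "(N #> x) [^]\<^bsub>G Mod N\<^esub> r = \<one>\<^bsub>G Mod N\<^esub>"
      using Q.squarefree_exponent_iff U r xQ unfolding U1_def by blast
    then show "x [^] r \<in> N" using x coset_eq[of "x [^] r"] by (simp add: N.FactGroup_pow)
  qed
  have "supersolvable (G Mod N)" using U by (simp add: U1_def)
  then obtain n :: nat and S where S': "S 0 = {\<one>\<^bsub>G Mod N\<^esub>} \<and> S n = carrier (G Mod N) \<and>
      (\<forall>i\<le>n. S i \<lhd> G Mod N) \<and>
      (\<forall>i<n. S i \<subseteq> S (Suc i) \<and> cyclic_group (((G Mod N)\<lparr>carrier := S (Suc i)\<rparr>) Mod S i))"
    unfolding supersolvable_def by (elim exE)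
  have S: "S 0 = {\<one>\<^bsub>G Mod N\<^esub>}" "S n = carrier (G Mod N)" "\<And>i. i \<le> n \<Longrightarrow> S i \<lhd> G Mod N"
    "\<And>i. i < n \<Longrightarrow> S i \<subseteq> S (Suc i)"
    "\<And>i. i < n \<Longrightarrow> cyclic_group (((G Mod N)\<lparr>carrier := S (Suc i)\<rparr>) Mod S i)"
    using S' by simp_all
  have "normal_tower G (\<Union>(S (n - j)))" if "j \<le> n" for j
    using that
  proof (induction j)
    case 0
    have "\<Union>(S n) = carrier G"
      using N.factgroup_subgroup_union_char[OF Q.subgroup_self] S(2) by (auto simp: carrier_FactGroup)
    then show ?case using normal_tower.top by simp
  next
    case (Suc j)
    define i where "i = n - Suc j"
    have i: "i < n" "n - j = Suc i" using Suc.prems by (auto simp: i_def)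
    have tw: "normal_tower G (\<Union>(S (Suc i)))" using Suc i by simp
    have nS: "S i \<lhd> G Mod N" "S (Suc i) \<lhd> G Mod N" using S(3) i by auto
    have sS: "subgroup (S i) (G Mod N)" "subgroup (S (Suc i)) (G Mod N)" using nS normal_imp_subgroup by auto
    have nU: "\<Union>(S i) \<lhd> G" "\<Union>(S (Suc i)) \<lhd> G" using N.factgroup_subgroup_union_normal nS by auto
    have sU: "subgroup (\<Union>(S i)) G" using nU normal_imp_subgroup by blast
    interpret n: normal "S i" "(G Mod N)\<lparr>carrier := S (Suc i)\<rparr>"
      using Q.normal_restrict_supergroup[OF sS(2) nS(1) S(4)[OF i(1)]] .
    have "finite (carrier ((G Mod N)\<lparr>carrier := S (Suc i)\<rparr>))" using Q.finite_subgroup[OF sS(2)] by simp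
    then obtain c where c: "c \<in> S (Suc i)"
      "\<And>d. d \<in> S (Suc i) \<Longrightarrow> \<exists>h\<in>S i. \<exists>m::nat. d = h <#> c [^]\<^bsub>(G Mod N)\<lparr>carrier := S (Suc i)\<rparr>\<^esub> m"
      using n.cyclic_Mod_D[OF S(5)[OF i(1)]] by auto
    have "c \<in> carrier (G Mod N)" using c subgroup.subset[OF sS(2)] by blast
    then obtain g where g: "g \<in> carrier G" "c = N #> g" unfolding carrier_FactGroup by blast
    have gU: "g \<in> \<Union>(S (Suc i))" using N.union_mem_iff[OF sS(2) g(1)] c g by simp
    have gen: "\<exists>k\<in>\<Union>(S i). \<exists>m::nat. x = k \<otimes> g [^] m" if x: "x \<in> \<Union>(S (Suc i))" for x
    proof -
      have xc: "x \<in> carrier G" using x nU(2) normal_imp_subgroup subgroup.mem_carrier by metis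
      have "N #> x \<in> S (Suc i)" using N.union_mem_iff[OF sS(2) xc] x by simp
      then obtain h m where h: "h \<in> S i" "N #> x = h <#> c [^]\<^bsub>(G Mod N)\<lparr>carrier := S (Suc i)\<rparr>\<^esub> (m::nat)"
        using c(2) by blast
      have "c [^]\<^bsub>(G Mod N)\<lparr>carrier := S (Suc i)\<rparr>\<^esub> m = N #> g [^] m"
        using N.FactGroup_pow[OF g(1), of m] g(2) by (simp add: Q.nat_pow_consistent[symmetric])
      then have "x \<in> h <#> (N #> g [^] m)" using h rcos_self[OF xc N.is_subgroup] by simp
      then obtain u w where uw: "u \<in> h" "w \<in> N #> g [^] m" "x = u \<otimes> w" by (rule set_multE)
      obtain v where v: "v \<in> N" "w = v \<otimes> g [^] m" using uw(2) by (auto simp: r_coset_def)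
      have uU: "u \<in> \<Union>(S i)" using uw h by blast
      moreover have "v \<in> \<Union>(S i)" using v N.union_contains[OF sS(1)] by blast
      ultimately have "u \<otimes> v \<in> \<Union>(S i)" using subgroup.m_closed[OF sU] by blast
      moreover have "x = (u \<otimes> v) \<otimes> g [^] m"
        using uw v uU subgroup.mem_carrier[OF sU] subgroup.mem_carrier[OF N.is_subgroup] g by (simp add: m_assoc)
      ultimately show ?thesis by blast
    qed
    have "normal_tower G (\<Union>(S i))"
      using normal_tower_cyclic[OF nU gU gen tw sU] S(4)[OF i(1)] by blast
    then show ?case by (simp add: i_def)
  qed
  from this[of n] show "normal_tower G N" using S(1) by simp
qed

text \<open>
  That is, the quotient by the residual is supersolvable of squarefree exponent, since only finitely many normal
  subgroups are intersected.
\<close>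
lemma residual_normal_tower:
  assumes ne: "{N. N \<lhd> G \<and> U1 (G Mod N)} \<noteq> {}"
  shows "normal_tower G (residual U1 G) \<and> squarefree_exponent_mod (residual U1 G)"
proof -
  let ?S = "{N. N \<lhd> G \<and> U1 (G Mod N)}"
  have finS: "finite ?S"
  proof (rule finite_subset)
    show "?S \<subseteq> Pow (carrier G)" using subgroup.subset[OF normal_imp_subgroup] by blast
  qed (simp add: fin)
  have "normal_tower G (\<Inter>T) \<and> squarefree_exponent_mod (\<Inter>T)" if "finite T" "T \<noteq> {}" "T \<subseteq> ?S" for T
    using that
  proof (induction T rule: finite_ne_induct)
    case (singleton N)
    then show ?case using U1_Mod_normal_tower by simp
  next
    case (insert N T)
    then have "normal_tower G N \<and> squarefree_exponent_mod N" "normal_tower G (\<Inter>T) \<and> squarefree_exponent_mod (\<Inter>T)"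
      using U1_Mod_normal_tower by auto
    then show ?case using normal_tower_Int by (simp add: squarefree_exponent_mod_def)
  qed
  then show ?thesis unfolding residual_def using finS ne by blast
qed

end

section \<open>Subgroups of prime power order over a normal tower\<close>

context fin_group
begin

text \<open>
  The trace on \<open>G\<close> shows that \<open>M\<close> is maximal or all of \<open>G\<close>. A subgroup
  \<open>X \<le> Z\<close> outside \<open>M\<close> then generates \<open>G\<close> together with
  \<open>M\<close>, and \<open>Z\<close> together with \<open>M \<inter> Z\<close>.
\<close>
lemma trace_maximal_imp_modular:
  assumes M: "subgroup M G" and tr: "\<And>Z. subgroup Z G \<Longrightarrow> adjacent G (Z \<inter> M) Z"
  shows "modular_subgroup M G"
  unfolding modular_subgroup_join_iff
proof (intro conjI allI impI M)
  have max: "adjacent G M (carrier G)"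
    using tr[OF subgroup_self] subgroup.subset[OF M] by (simp add: Int_absorb1)
  fix X Z assume X: "subgroup X G" and Z: "subgroup Z G" and XZ: "X \<subseteq> Z"
  have MZ: "subgroup (M \<inter> Z) G" using subgroup_Int[OF M Z] .
  show "join X (M \<inter> Z) = join X M \<inter> Z"
  proof (cases "X \<subseteq> M")
    case True
    have "join X (M \<inter> Z) = M \<inter> Z" using join_absorb[OF MZ, of X] True XZ by (simp add: join_comm[of X])
    moreover have "join X M = M" using join_absorb[OF M True] by (simp add: join_comm[of X])
    ultimately show ?thesis by simp
  next
    case False
    have s: "subgroup (join X (M \<inter> Z)) G" "subgroup (join X M) G" using join_subgroup X M MZ by auto
    have "Z \<inter> M \<subseteq> join X (M \<inter> Z)" using join_upper(2)[of "M \<inter> Z" X] by blast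
    moreover have "join X (M \<inter> Z) \<subseteq> Z" by (rule join_least[OF Z XZ]) blast
    ultimately have "join X (M \<inter> Z) = Z"
      using adjacentD[OF tr[OF Z] s(1)] False join_upper(1)[of X "M \<inter> Z"] by blast
    moreover have "join X M = carrier G"
      using adjacentD[OF max s(2) join_upper(2)] subgroup.subset[OF s(2)] False join_upper(1)[of X M] by blast
    ultimately show ?thesis using subgroup.subset[OF Z] by blast
  qed
next
  have max: "adjacent G M (carrier G)"
    using tr[OF subgroup_self] subgroup.subset[OF M] by (simp add: Int_absorb1)
  fix Y Z assume Y: "subgroup Y G" and Z: "subgroup Z G" and MZ: "M \<subseteq> Z"
  have "Z = M \<or> Z = carrier G" using adjacentD[OF max Z MZ] subgroup.subset[OF Z] by blast
  then show "join M (Y \<inter> Z) = join M Y \<inter> Z"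
  proof
    assume e: "Z = M"
    have "join M (Y \<inter> M) = M" by (rule join_absorb[OF M]) blast
    then show ?thesis using e join_upper(1)[of M Y] by blast
  next
    assume e: "Z = carrier G"
    have "Y \<inter> carrier G = Y" "join M Y \<subseteq> carrier G"
      using subgroup.subset[OF Y] subgroup.subset[OF join_subgroup[OF M Y]] by auto
    then show ?thesis using e by auto
  qed
qed

text \<open>
  The quotient \<open>B/C\<close> has a minimal normal subgroup \<open>D/C\<close>, the image of
  \<open>L\<close>, and a complement \<open>A/C\<close> to it, both without proper nontrivial subgroups. So no
  chain from \<open>C\<close> to \<open>B\<close> has more than one intermediate member. For \<open>W\<close>
  between \<open>Z \<inter> A\<close> and \<open>Z\<close> compare \<open>C W\<close> with \<open>C Z\<close>:
  if \<open>W\<close> is not inside \<open>A\<close>, then both meet \<open>A\<close> in \<open>C\<close> unless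
  \<open>C W = B\<close>, and their intersections with \<open>D\<close> decide that they are equal. Since
  \<open>C \<inter> Z \<le> W\<close>, this gives \<open>W = Z\<close>.
\<close>
lemma two_step_interval_trace:
  assumes sub: "subgroup A G" "subgroup B G" "subgroup C G" "subgroup L G"
    and incl: "C \<subseteq> A" "A \<subseteq> B" "L \<subseteq> B"
    and Cn: "\<And>b c. \<lbrakk>b \<in> B; c \<in> C\<rbrakk> \<Longrightarrow> conj_by b c \<in> C"
    and Ln: "\<And>b c. \<lbrakk>b \<in> B; c \<in> L\<rbrakk> \<Longrightarrow> conj_by b c \<in> L"
    and BLA: "B = L <#> A" and CA: "adjacent G C A" and AB: "adjacent G A B"
    and LC: "adjacent G (L \<inter> C) L" and LA: "L \<inter> A \<subseteq> C"
    and Z: "subgroup Z G" "Z \<subseteq> B"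
  shows "adjacent G (Z \<inter> A) Z"
  unfolding adjacent_def
proof (intro allI impI)
  fix W assume W: "subgroup W G" "Z \<inter> A \<subseteq> W" "W \<subseteq> Z"
  have Bc: "B \<subseteq> carrier G" using subgroup.subset sub by blast
  let ?D = "L <#> C"
  have D: "subgroup ?D G" by (rule set_mult_subgroup[OF sub(4,3)]) (use Ln incl in blast)
  have LD: "L \<subseteq> ?D" "C \<subseteq> ?D" using set_mult_incl[OF sub(4,3)] .
  have DB: "?D \<subseteq> B" using set_mult_least[OF sub(2)] incl by blast
  have D_min: "Y = C \<or> Y = ?D" if Y: "subgroup Y G" "C \<subseteq> Y" "Y \<subseteq> ?D" for Y
  proof -
    have e: "Y = (L \<inter> Y) <#> C" using dedekind_right[OF Y(1,2) subgroup.subset[OF sub(4)]] Y(3) by blast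
    have "L \<inter> Y = L \<inter> C \<or> L \<inter> Y = L"
      using adjacentD[OF LC subgroup_Int[OF sub(4) Y(1)]] Y(2) by blast
    moreover have "(L \<inter> C) <#> C \<subseteq> C" by (rule set_mult_least[OF sub(3)]) auto
    ultimately show ?thesis using e Y(2) by (metis subset_antisym)
  qed
  have D_max: "Y = ?D \<or> Y = B" if Y: "subgroup Y G" "?D \<subseteq> Y" "Y \<subseteq> B" for Y
  proof -
    have LY: "L \<subseteq> Y" "C \<subseteq> Y" using LD Y by auto
    have e: "Y = L <#> (A \<inter> Y)"
      using dedekind_left[OF Y(1) LY(1) subgroup.subset[OF sub(1)]] Y(3) BLA by blast
    have "A \<inter> Y = C \<or> A \<inter> Y = A"
      using adjacentD[OF CA subgroup_Int[OF sub(1) Y(1)]] LY incl by blast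
    then show ?thesis using e BLA by metis
  qed
  have CX: "subgroup (C <#> X) G" "C \<subseteq> C <#> X" "X \<subseteq> C <#> X" "C <#> X \<subseteq> B" if X: "subgroup X G" "X \<subseteq> B" for X
  proof -
    show "subgroup (C <#> X) G" by (rule set_mult_subgroup[OF sub(3) X(1)]) (use Cn X in blast)
    show "C \<subseteq> C <#> X" "X \<subseteq> C <#> X" using set_mult_incl[OF sub(3) X(1)] .
    show "C <#> X \<subseteq> B" by (rule set_mult_least[OF sub(2)]) (use incl X in auto)
  qed
  have WB: "W \<subseteq> B" using W Z by blast
  note CW = CX[OF W(1) WB] and CZ = CX[OF Z]
  have CWZ: "C <#> W \<subseteq> C <#> Z" using mono_set_mult W by blast
  \<comment> \<open>Dedekind's law, as \<open>C \<inter> Z \<le> Z \<inter> A \<le> W\<close>\<close>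
  have cancel: "W = Z" if "Z \<subseteq> C <#> W"
  proof -
    have "Z = (C \<inter> Z) <#> W"
      using dedekind_right[OF Z(1) W(3) subgroup.subset[OF sub(3)]] that by blast
    also have "\<dots> \<subseteq> W" by (rule set_mult_least[OF W(1)]) (use W incl in auto)
    finally show ?thesis using W by blast
  qed
  have cap: "(C <#> Z) \<inter> A \<subseteq> C <#> W"
    using dedekind_left[OF sub(1) incl(1) subgroup.subset[OF Z(1)]] mono_set_mult[OF subset_refl W(2), of G C] by blast
  show "W = Z \<inter> A \<or> W = Z"
  proof (cases "W \<subseteq> A")
    case True
    then show ?thesis using W by blast
  next
    case False
    then have WA: "\<not> C <#> W \<subseteq> A" using CW by blast
    have "subgroup ((C <#> W) \<inter> A) G" by (rule subgroup_Int[OF CW(1) sub(1)])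
    then have "(C <#> W) \<inter> A = C \<or> (C <#> W) \<inter> A = A"
      using adjacentD[OF CA] CW incl by blast
    then show ?thesis
    proof
      assume "(C <#> W) \<inter> A = A"
      then have "C <#> W = B" using adjacentD[OF AB CW(1) _ CW(4)] WA by blast
      then show ?thesis using cancel Z by blast
    next
      assume e: "(C <#> W) \<inter> A = C"
      then have eZ: "(C <#> Z) \<inter> A = C" using cap CZ(2) incl by blast
      \<comment> \<open>a subgroup above \<open>D\<close> is \<open>D\<close> or \<open>B\<close>, and \<open>B\<close> meets \<open>A\<close> in \<open>C\<close> only if \<open>A = C\<close> and \<open>B = D\<close>\<close>
      have above: "Y = ?D" if Y: "subgroup Y G" "?D \<subseteq> Y" "Y \<subseteq> B" "Y \<inter> A = C" for Y
      proof -
        have "B = ?D" if "Y = B"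
        proof -
          have "A = C" using that Y(4) incl by blast
          then show ?thesis using BLA by simp
        qed
        then show ?thesis using D_max[OF Y(1-3)] by metis
      qed
      have DW: "subgroup ((C <#> W) \<inter> ?D) G" "subgroup ((C <#> Z) \<inter> ?D) G"
        using subgroup_Int CW CZ D by auto
      have "(C <#> Z) \<subseteq> C <#> W"
      proof (cases "?D \<subseteq> C <#> W")
        case True
        have "C <#> W = ?D" "C <#> Z = ?D"
          using above[OF CW(1) True CW(4) e] above[OF CZ(1) order_trans[OF True CWZ] CZ(4) eZ] .
        then show ?thesis by blast
      next
        case nD: False
        have WD: "(C <#> W) \<inter> ?D = C" using D_min[OF DW(1)] CW(2) LD nD by blast
        have ZD: "(C <#> Z) \<inter> ?D = C"
        proof (rule ccontr)
          assume "(C <#> Z) \<inter> ?D \<noteq> C"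
          then have "?D \<subseteq> C <#> Z" using D_min[OF DW(2)] CZ(2) LD by blast
          then have "C <#> Z = ?D" using above[OF CZ(1) _ CZ(4) eZ] by blast
          then have "C <#> W = C" using WD CWZ by blast
          then show False using WA incl by blast
        qed
        let ?E = "?D <#> (C <#> W)"
        have En: "conj_by b d \<in> ?D" if b: "b \<in> B" and d: "d \<in> ?D" for b d
        proof -
          obtain l c where lc: "l \<in> L" "c \<in> C" "d = l \<otimes> c" using d by (rule set_multE)
          have "conj_by b d = conj_by b l \<otimes> conj_by b c"
            unfolding lc(3) using lc b incl Bc by (intro conj_by_mult) auto
          then show ?thesis using Ln[OF b lc(1)] Cn[OF b lc(2)] by (simp add: set_multI)
        qed
        have E: "subgroup ?E G" by (rule set_mult_subgroup[OF D CW(1)]) (use En CW in blast)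
        have EB: "?E \<subseteq> B" by (rule set_mult_least[OF sub(2) DB CW(4)])
        have "?E = B"
        proof -
          have "?E \<noteq> ?D"
          proof
            assume "?E = ?D"
            then have "C <#> W \<subseteq> ?D" using set_mult_incl(2)[OF D CW(1)] by simp
            then show False using WD WA incl by blast
          qed
          then show ?thesis using D_max[OF E set_mult_incl(1)[OF D CW(1)] EB] by blast
        qed
        have "C <#> Z = (?D \<inter> (C <#> Z)) <#> (C <#> W)"
          using dedekind_right[OF CZ(1) CWZ subgroup.subset[OF D]] \<open>?E = B\<close> CZ(4) by blast
        also have "\<dots> \<subseteq> C <#> W"
          by (rule set_mult_least[OF CW(1) _ subset_refl]) (use ZD CW(2) in blast)
        finally show ?thesis .
      qed
      then show ?thesis using cancel CZ by blast
    qed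
  qed
qed

text \<open>
  Let \<open>C\<close> be the centralizer of \<open>L/K\<close> in \<open>K Q\<close>, which is normal in
  \<open>L Q\<close>. Elements of \<open>Q\<close> act on \<open>L/K\<close> as \<open>p\<close>-th roots of
  unity modulo the prime \<open>q = |L/K|\<close>, so \<open>K Q/C\<close> is trivial or of order
  \<open>p\<close>. In the first case \<open>K Q\<close> is normal in \<open>L Q\<close>; in the second,
  \<open>K Q\<close> has maximal traces in \<open>L Q\<close> because \<open>L Q/C\<close> has order \<open>p
  q\<close>.
\<close>
lemma p_subgroup_step_modular:
  fixes p :: nat
  assumes K: "K \<lhd> G" and L: "L \<lhd> G" and KL: "K \<subseteq> L" "adjacent G K L"
    and Q: "subgroup Q G" and p: "prime p" and Qp: "\<And>x. x \<in> Q \<Longrightarrow> x [^] p \<in> K"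
  shows "modular_subgroup (K <#> Q) (G\<lparr>carrier := L <#> Q\<rparr>)"
proof -
  let ?A = "K <#> Q" and ?B = "L <#> Q"
  have sK: "subgroup K G" and sL: "subgroup L G" using K L normal_imp_subgroup by auto
  have Kn: "\<And>g a. \<lbrakk>g \<in> carrier G; a \<in> K\<rbrakk> \<Longrightarrow> conj_by g a \<in> K"
    and Ln: "\<And>g a. \<lbrakk>g \<in> carrier G; a \<in> L\<rbrakk> \<Longrightarrow> conj_by g a \<in> L" using K L normal_conj_by by auto
  have Qc: "Q \<subseteq> carrier G" and Kc: "K \<subseteq> carrier G" and Lc: "L \<subseteq> carrier G"
    using subgroup.subset Q sK sL by auto
  have A: "subgroup ?A G" by (rule set_mult_subgroup[OF sK Q]) (use Kn Qc in blast)
  have B: "subgroup ?B G" by (rule set_mult_subgroup[OF sL Q]) (use Ln Qc in blast)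
  have Ac: "?A \<subseteq> carrier G" and Bc: "?B \<subseteq> carrier G" using subgroup.subset A B by auto
  have KA: "K \<subseteq> ?A" "Q \<subseteq> ?A" and LB: "L \<subseteq> ?B" "Q \<subseteq> ?B"
    using set_mult_incl[OF sK Q] set_mult_incl[OF sL Q] by auto
  have AB: "?A \<subseteq> ?B" using mono_set_mult[OF KL(1) subset_refl] .
  interpret GB: fin_group "G\<lparr>carrier := ?B\<rparr>" using subgroup_fin_group[OF B] .
  have subB: "subgroup X G \<and> X \<subseteq> ?B" if "subgroup X (G\<lparr>carrier := ?B\<rparr>)" for X
    using incl_subgroup[OF B that] subgroup.subset[OF that] by simp
  have normalB: "X \<lhd> G\<lparr>carrier := ?B\<rparr>" if X: "subgroup X G" "X \<subseteq> ?B"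
    and n: "\<And>b x. \<lbrakk>b \<in> ?B; x \<in> X\<rbrakk> \<Longrightarrow> conj_by b x \<in> X" for X
  proof (rule GB.normal_invI)
    show "subgroup X (G\<lparr>carrier := ?B\<rparr>)" using subgroup_incl[OF X(1) B X(2)] .
    fix b x assume "b \<in> carrier (G\<lparr>carrier := ?B\<rparr>)" "x \<in> X"
    then show "b \<otimes>\<^bsub>G\<lparr>carrier := ?B\<rparr>\<^esub> x \<otimes>\<^bsub>G\<lparr>carrier := ?B\<rparr>\<^esub> inv\<^bsub>G\<lparr>carrier := ?B\<rparr>\<^esub> b \<in> X"
      using n by (simp add: conj_by_def m_inv_consistent[OF B])
  qed
  show ?thesis
  proof (cases "L \<subseteq> ?A")
    case True
    then have "?A = ?B" using AB set_mult_least[OF A _ KA(2)] by blast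
    then show ?thesis using GB.normal_imp_modular[OF GB.normal_self] by simp
  next
    case False
    have LA: "L \<inter> ?A = K"
      using adjacentD[OF KL(2) subgroup_Int[OF sL A]] KA KL False by blast
    obtain y where y: "y \<in> L" "y \<notin> K" using False KA by blast
    have yc: "y \<in> carrier G" using y Lc by blast
    obtain q where q: "prime q" "\<And>k::nat. y [^] k \<in> K \<longleftrightarrow> q dvd k"
      "\<And>x. x \<in> L \<Longrightarrow> \<exists>u\<in>K. \<exists>i::nat. x = u \<otimes> y [^] i"
      using adjacent_cyclic[OF sK sL KL y Kn[OF yc]] by blast
    interpret S: cyclic_section G K y q
      using sK yc q(1,2) Kn[OF yc] by (intro cyclic_section.intro[OF fin_group_axioms] cyclic_section_axioms.intro)
    have ex: "\<exists>i. S.acts g i" if g: "g \<in> carrier G" for g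
      using q(3)[OF Ln[OF g y(1)]] g Kn[OF g] unfolding S.acts_def by blast
    have K_acts: "S.acts k 1" if k: "k \<in> K" for k
    proof -
      have kc: "k \<in> carrier G" using k Kc by blast
      have "conj_by k y = (k \<otimes> conj_by y (inv k)) \<otimes> y [^] (1::nat)"
        using kc yc by (simp add: conj_by_def m_assoc)
      moreover have "k \<otimes> conj_by y (inv k) \<in> K"
        using k Kn[OF yc] subgroup.m_closed[OF sK] subgroup.m_inv_closed[OF sK] by blast
      ultimately show ?thesis using kc Kn[OF kc] unfolding S.acts_def by blast
    qed
    have inv_acts: "[i * j = 1] (mod q)" if "S.acts g i" "S.acts (inv g) j" "g \<in> carrier G" for g i j
      using S.acts_unique[OF S.acts_mult[OF that(1,2)]] S.acts_one that(3) by simp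
    define C where "C = {a \<in> ?A. S.acts a 1}"
    have C_iff: "x \<in> C \<longleftrightarrow> x \<in> ?A \<and> S.acts x 1" for x by (simp add: C_def)
    have C: "subgroup C G"
    proof (rule subgroupI)
      show "C \<subseteq> carrier G" using Ac C_iff by blast
      have "\<one> \<in> C" using S.acts_one subgroup.one_closed[OF A] C_iff by blast
      then show "C \<noteq> {}" by blast
      fix a assume a: "a \<in> C"
      then have ac: "a \<in> carrier G" using Ac C_iff by blast
      obtain j where j: "S.acts (inv a) j" using ex ac by blast
      have "[j = 1] (mod q)" using inv_acts[OF _ j ac, of 1] a C_iff by simp
      then have "S.acts (inv a) 1" using S.acts_cong j by blast
      then show "inv a \<in> C" using a subgroup.m_inv_closed[OF A] C_iff by blast
      fix b assume b: "b \<in> C"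
      show "a \<otimes> b \<in> C" using a b S.acts_mult[of a 1 b 1] subgroup.m_closed[OF A] C_iff by auto
    qed
    have CA: "C \<subseteq> ?A" using C_iff by blast
    have KC: "K \<subseteq> C" using KA K_acts C_iff by blast
    have Cc: "C \<subseteq> carrier G" using CA Ac by blast
    have Cn_A: "conj_by a c \<in> C" if a: "a \<in> ?A" and c: "c \<in> C" for a c
    proof -
      have ac: "a \<in> carrier G" using a Ac by blast
      obtain i where i: "S.acts a i" using ex ac by blast
      obtain j where j: "S.acts (inv a) j" using ex inv_closed[OF ac] by blast
      have "S.acts (a \<otimes> c \<otimes> inv a) (i * 1 * j)" using S.acts_mult i j c C_iff by blast
      then have "S.acts (conj_by a c) 1" using S.acts_cong inv_acts[OF i j ac] by (simp add: conj_by_def)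
      then show ?thesis using conj_by_mem_subgroup[OF A a] c C_iff by blast
    qed
    have Cn_L: "conj_by l c \<in> C" if l: "l \<in> L" and c: "c \<in> C" for l c
    proof -
      have lc: "l \<in> carrier G" "c \<in> carrier G" using l c Lc Cc by auto
      have il: "inv l \<in> L" using subgroup.m_inv_closed[OF sL l] .
      obtain v k where vk: "v \<in> K" "inv l = v \<otimes> y [^] (k::nat)" using q(3)[OF il] by blast
      have "conj_by c (inv l) \<otimes> inv (inv l) \<in> K"
        unfolding vk(2) using S.acts_trivially[OF _ vk(1)] c C_iff by blast
      then have m: "conj_by l (conj_by c (inv l) \<otimes> l) \<in> K" using Kn lc by simp
      \<comment> \<open>the commutator of \<open>l\<close> and \<open>c\<close> lies in \<open>K\<close>, because \<open>c\<close> centralizes \<open>L/K\<close>\<close>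
      have "conj_by l c = conj_by l (conj_by c (inv l) \<otimes> l) \<otimes> c"
        using lc by (simp add: conj_by_def m_assoc)
      moreover have "conj_by l (conj_by c (inv l) \<otimes> l) \<otimes> c \<in> C"
        using subgroup.m_closed[OF C subsetD[OF KC m] c] .
      ultimately show ?thesis by simp
    qed
    have Cn: "conj_by b c \<in> C" if b: "b \<in> ?B" and c: "c \<in> C" for b c
    proof -
      obtain l x where lx: "l \<in> L" "x \<in> Q" "b = l \<otimes> x" using b by (rule set_multE)
      have 1: "conj_by x c \<in> C" using Cn_A lx KA c by blast
      have "conj_by b c = conj_by l (conj_by x c)"
        unfolding lx(3) using lx c Lc Qc Cc by (intro conj_by_comp[symmetric]) auto
      then show ?thesis using Cn_L[OF lx(1) 1] by simp
    qed
    show ?thesis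
    proof (cases "Q \<subseteq> C")
      case True
      then have "?A = C" using set_mult_least[OF C KC True] CA by blast
      then have "?A \<lhd> G\<lparr>carrier := ?B\<rparr>" using normalB[OF A AB] Cn by simp
      then show ?thesis by (rule GB.normal_imp_modular)
    next
      case False
      then obtain a where a: "a \<in> Q" "\<not> S.acts a 1" using KA C_iff by blast
      have ac: "a \<in> carrier G" using a Qc by blast
      obtain i where i: "S.acts a i" using ex ac by blast
      have pow1: "[i ^ p = 1] (mod q)" if "S.acts x i" "x \<in> Q" for x i
        using S.acts_unique[OF S.acts_pow[OF that(1)] K_acts[OF Qp[OF that(2)]]] .
      have i1: "\<not> [i = 1] (mod q)" using S.acts_cong[OF i] a(2) by blast
      \<comment> \<open>the exponents by which \<open>x\<close> and \<open>a\<close> act are \<open>p\<close>-th roots of unity, so \<open>x\<close> acts like a power of \<open>a\<close>\<close>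
      have A_gen: "\<exists>c\<in>C. \<exists>n::nat. z = c \<otimes> a [^] n" if z: "z \<in> ?A" for z
      proof -
        obtain k x where kx: "k \<in> K" "x \<in> Q" "z = k \<otimes> x" using z by (rule set_multE)
        have xc: "x \<in> carrier G" "k \<in> carrier G" using kx Qc Kc by auto
        obtain j where j: "S.acts x j" using ex xc by blast
        obtain n where n: "[j = i ^ n] (mod q)"
          using prime_roots_of_unity_cyclic[OF q(1) p pow1[OF i a(1)] i1 pow1[OF j kx(2)]] by blast
        obtain m where m: "S.acts (inv (a [^] n)) m" using ex ac by blast
        have im: "[i ^ n * m = 1] (mod q)" using inv_acts[OF S.acts_pow[OF i] m] ac by simp
        have "[j * m = i ^ n * m] (mod q)" using n by (intro cong_mult cong_refl)
        then have "[j * m = 1] (mod q)" using im cong_trans by blast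
        then have "S.acts (x \<otimes> inv (a [^] n)) 1" using S.acts_cong S.acts_mult[OF j m] by blast
        then have "S.acts (k \<otimes> (x \<otimes> inv (a [^] n))) 1" using S.acts_mult[OF K_acts[OF kx(1)]] by fastforce
        moreover have "k \<otimes> (x \<otimes> inv (a [^] n)) \<in> ?A"
          using kx a subgroup_nat_pow_closed[OF Q] subgroup.m_inv_closed[OF Q] subgroup.m_closed[OF Q]
          by (intro set_multI) auto
        moreover have "z = k \<otimes> (x \<otimes> inv (a [^] n)) \<otimes> a [^] n" using kx xc ac by (simp add: m_assoc)
        ultimately show ?thesis using C_iff by blast
      qed
      \<comment> \<open>\<open>K Q/C\<close> is generated by the image of \<open>a\<close>, whose \<open>p\<close>-th power is trivial\<close>
      have adjCA: "adjacent G C ?A"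
        unfolding adjacent_def
      proof (intro allI impI)
        fix D assume D: "subgroup D G" "C \<subseteq> D" "D \<subseteq> ?A"
        show "D = C \<or> D = ?A"
        proof (cases "D \<subseteq> C")
          case True
          then show ?thesis using D by blast
        next
          case False
          then obtain d where d: "d \<in> D" "d \<notin> C" by blast
          obtain c n where cn: "c \<in> C" "d = c \<otimes> a [^] (n::nat)" using A_gen d D by blast
          have "a [^] n = inv c \<otimes> d" using cn Cc ac by (simp add: m_assoc[symmetric] subset_iff)
          moreover have "inv c \<otimes> d \<in> D"
            using subgroup.m_closed[OF D(1) subgroup.m_inv_closed[OF D(1) subsetD[OF D(2) cn(1)]] d(1)] .
          ultimately have anD: "a [^] n \<in> D" by simp
          have apC: "a [^] p \<in> C" using Qp a KC by blast
          have "\<not> p dvd n"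
          proof
            assume "p dvd n"
            then obtain m where "n = p * m" by (auto elim: dvdE)
            then have "a [^] n \<in> C" using subgroup_nat_pow_closed[OF C apC, of m] ac by (simp add: nat_pow_pow)
            then show False using cn d subgroup.m_closed[OF C] by blast
          qed
          then have "coprime p n" using p prime_imp_coprime by blast
          moreover have "a [^] p \<in> D" using apC D by blast
          ultimately have aD: "a \<in> D" using pow_coprime_mem[OF D(1) ac _ anD] by blast
          have "?A \<subseteq> D"
          proof
            fix z assume "z \<in> ?A"
            then obtain c n where "c \<in> C" "z = c \<otimes> a [^] (n::nat)" using A_gen by blast
            then show "z \<in> D" using D subgroup_nat_pow_closed[OF D(1) aD] subgroup.m_closed[OF D(1)] by blast
          qed
          then show ?thesis using D by blast
        qed
      qed
      have adjAB: "adjacent G ?A ?B"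
        unfolding adjacent_def
      proof (intro allI impI)
        fix D assume D: "subgroup D G" "?A \<subseteq> D" "D \<subseteq> ?B"
        have "subgroup (D \<inter> L) G" using subgroup_Int[OF D(1) sL] .
        then have "D \<inter> L = K \<or> D \<inter> L = L" using adjacentD[OF KL(2)] D KA KL by blast
        then show "D = ?A \<or> D = ?B"
        proof
          assume e: "D \<inter> L = K"
          have "D = (L <#> Q) \<inter> D" using D by blast
          also have "\<dots> = ?A" using dedekind_right[OF D(1) _ Lc, of Q] D KA e by (simp add: Int_commute)
          finally show ?thesis by simp
        next
          assume "D \<inter> L = L"
          then have "?B \<subseteq> D" using set_mult_least[OF D(1)] D KA by blast
          then show ?thesis using D by blast
        qed
      qed
      have LC: "L \<inter> C = K" using LA KC KL CA by blast
      have BLA: "?B = L <#> ?A"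
      proof
        show "?B \<subseteq> L <#> ?A" using mono_set_mult[OF subset_refl KA(2)] .
        show "L <#> ?A \<subseteq> ?B" by (rule set_mult_least[OF B LB(1) AB])
      qed
      have tr: "adjacent G (Z \<inter> ?A) Z" if "subgroup Z G" "Z \<subseteq> ?B" for Z
      proof (rule two_step_interval_trace[OF A B C sL CA AB LB(1) Cn _ BLA adjCA adjAB _ _ that])
        show "\<And>b c. b \<in> ?B \<Longrightarrow> c \<in> L \<Longrightarrow> conj_by b c \<in> L" using Ln Bc by blast
        show "adjacent G (L \<inter> C) L" using LC KL by simp
        show "L \<inter> ?A \<subseteq> C" using LA KC by simp
      qed
      show ?thesis
      proof (rule GB.trace_maximal_imp_modular)
        show "subgroup ?A (G\<lparr>carrier := ?B\<rparr>)" using subgroup_incl[OF A B AB] .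
        fix Z assume "subgroup Z (G\<lparr>carrier := ?B\<rparr>)"
        then have "adjacent G (Z \<inter> ?A) Z" using tr subB by blast
        then show "adjacent (G\<lparr>carrier := ?B\<rparr>) (Z \<inter> ?A) Z" unfolding adjacent_def using subB by blast
      qed
    qed
  qed
qed

text \<open>
  Multiply the tower above \<open>K\<close> by \<open>Q\<close>.
\<close>
lemma p_subgroup_tower_submodular:
  fixes p :: nat
  assumes "normal_tower G K" and Q: "subgroup Q G" and p: "prime p" and "\<And>x. x \<in> Q \<Longrightarrow> x [^] p \<in> K"
  shows "(submodular_step G)\<^sup>*\<^sup>* (K <#> Q) (carrier G)"
  using assms(1,4)
proof (induction rule: normal_tower.induct)
  case top
  have "carrier G <#> Q = carrier G"
    using set_mult_least[OF subgroup_self subset_refl subgroup.subset[OF Q]] set_mult_incl(1)[OF subgroup_self Q] by blast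
  then show ?case by simp
next
  case (down L K)
  have L: "L \<lhd> G" using normal_tower_normal[OF down(1)] .
  have sub: "subgroup (X <#> Q) G" if "X \<lhd> G" for X
    using set_mult_subgroup[OF normal_imp_subgroup[OF that] Q] that normal_conj_by subgroup.mem_carrier[OF Q] by blast
  have "modular_subgroup (K <#> Q) (G\<lparr>carrier := L <#> Q\<rparr>)"
    by (rule p_subgroup_step_modular[OF down(2) L down(3,4) Q p down.prems])
  then have "submodular_step G (K <#> Q) (L <#> Q)"
    using sub[OF down(2)] sub[OF L] mono_set_mult[OF down(3) subset_refl, of G Q] by (simp add: submodular_step_def)
  moreover have "(submodular_step G)\<^sup>*\<^sup>* (L <#> Q) (carrier G)" using down by blast
  ultimately show ?case by (rule converse_rtranclp_into_rtranclp)
qed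

lemma submodular_chain_restrict:
  assumes "(submodular_step G)\<^sup>*\<^sup>* Q H" and E: "subgroup E G"
  shows "(submodular_step G)\<^sup>*\<^sup>* (Q \<inter> E) (H \<inter> E)"
  using assms(1)
proof (induction rule: rtranclp_induct)
  case base
  then show ?case by simp
next
  case (step A B)
  have sub: "subgroup A G" "subgroup B G" "A \<subseteq> B" and m: "modular_subgroup A (G\<lparr>carrier := B\<rparr>)"
    using step(2) by (auto simp: submodular_step_def)
  interpret GB: fin_group "G\<lparr>carrier := B\<rparr>" using subgroup_fin_group[OF sub(2)] .
  have BE: "subgroup (B \<inter> E) G" using subgroup_Int[OF sub(2) E] .
  have "modular_subgroup (A \<inter> (B \<inter> E)) (G\<lparr>carrier := B \<inter> E\<rparr>)"
    using GB.modular_restrict[OF m subgroup_incl[OF BE sub(2)]] by simp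
  moreover have "A \<inter> (B \<inter> E) = A \<inter> E" using sub by blast
  ultimately have "submodular_step G (A \<inter> E) (B \<inter> E)"
    using sub BE subgroup_Int[OF sub(1) E] by (auto simp: submodular_step_def)
  then show ?case using step.IH by simp
qed

lemma submodular_step_of_subgroup:
  assumes L: "subgroup L G" and chain: "(submodular_step (G\<lparr>carrier := L\<rparr>))\<^sup>*\<^sup>* A B"
  shows "(submodular_step G)\<^sup>*\<^sup>* A B"
proof (rule mono_rtranclp[rule_format, OF _ chain])
  fix A B assume "submodular_step (G\<lparr>carrier := L\<rparr>) A B"
  then show "submodular_step G A B" using incl_subgroup[OF L] by (simp add: submodular_step_def)
qed

text \<open>
  For a residual step \<open>R \<le> H \<le> L\<close>, pass from \<open>Q\<close> to \<open>R Q\<close> inside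
  \<open>H\<close> by restricting the chain known for \<open>H\<close>, and from \<open>R Q\<close> to
  \<open>L\<close> along a normal tower. The exponent of \<open>L/R\<close> is squarefree, so
  \<open>p\<close>-th powers of elements of \<open>Q\<close> lie in \<open>R\<close>.
\<close>
lemma KU1_chain_imp_submodular:
  assumes chain: "(KU1_step G)\<^sup>*\<^sup>* Q A" and Q: "subgroup Q G" and p: "prime p" and card: "card Q = p ^ k"
  shows "(submodular_step G)\<^sup>*\<^sup>* Q A"
  using chain
proof (induction rule: rtranclp_induct)
  case base
  then show ?case by simp
next
  case (step H L)
  have sub: "subgroup H G" "subgroup L G" "H \<subseteq> L" using step(2) by (auto simp: KU1_step_def)
  have QH: "Q \<subseteq> H" using step(1)
    by (induction rule: rtranclp_induct) (auto simp: KU1_step_def)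
  let ?L = "G\<lparr>carrier := L\<rparr>"
  interpret GL: fin_group ?L using subgroup_fin_group[OF sub(2)] .
  consider "H \<lhd> ?L" | "residual U1 ?L \<subseteq> H" using step(2) by (auto simp: KU1_step_def)
  then show ?case
  proof cases
    case 1
    then have "submodular_step G H L"
      using sub GL.normal_imp_modular by (simp add: submodular_step_def)
    then show ?thesis using step.IH by simp
  next
    case 2
    let ?R = "residual U1 ?L"
    show ?thesis
    proof (cases "{N. N \<lhd> ?L \<and> U1 (?L Mod N)} = {}")
      case True
      \<comment> \<open>an empty family has the whole type as its intersection\<close>
      then have "?R = UNIV" unfolding residual_def by (simp only: Inter_empty)
      then have "H = L" using 2 sub by blast
      then show ?thesis using step.IH by simp
    next
      case False
      then have tw: "normal_tower ?L ?R" and pc: "GL.squarefree_exponent_mod ?R" using GL.residual_normal_tower by auto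
      have R: "?R \<lhd> ?L" using GL.normal_tower_normal[OF tw] .
      have sR: "subgroup ?R ?L" using R normal_imp_subgroup by blast
      have QL: "subgroup Q ?L" using subgroup_incl[OF Q sub(2)] QH sub by blast
      have Qp: "x [^]\<^bsub>?L\<^esub> p \<in> ?R" if x: "x \<in> Q" for x
      proof -
        have xL: "x \<in> carrier ?L" using x QH sub by auto
        \<comment> \<open>squarefreeness of the exponent modulo \<open>R\<close> lowers the exponent \<open>p\<^sup>j\<^sup>+\<^sup>2\<close> to \<open>p\<^sup>j\<^sup>+\<^sup>1\<close>, down to \<open>p\<close>\<close>
        have down: "x [^]\<^bsub>?L\<^esub> p \<in> ?R" if "x [^]\<^bsub>?L\<^esub> (p ^ Suc j) \<in> ?R" for j
          using that
        proof (induction j)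
          case 0
          then show ?case by simp
        next
          case (Suc j)
          have "(x [^]\<^bsub>?L\<^esub> (p ^ j)) [^]\<^bsub>?L\<^esub> (p * p) \<in> ?R"
            using Suc.prems xL by (simp add: GL.nat_pow_pow mult_ac)
          then have "(x [^]\<^bsub>?L\<^esub> (p ^ j)) [^]\<^bsub>?L\<^esub> p \<in> ?R"
            using pc p GL.nat_pow_closed[OF xL] unfolding GL.squarefree_exponent_mod_def by blast
          then show ?case using Suc.IH xL by (simp add: GL.nat_pow_pow mult.commute)
        qed
        have "x [^]\<^bsub>?L\<^esub> (p ^ k) = \<one>\<^bsub>?L\<^esub>" using GL.subgroup_pow_card[OF QL x] card by simp
        then have "x [^]\<^bsub>?L\<^esub> (p ^ k) \<in> ?R" using subgroup.one_closed[OF sR] by simp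
        then have "(x [^]\<^bsub>?L\<^esub> (p ^ k)) [^]\<^bsub>?L\<^esub> p \<in> ?R" by (rule GL.subgroup_nat_pow_closed[OF sR])
        then have "x [^]\<^bsub>?L\<^esub> (p ^ Suc k) \<in> ?R" using xL by (simp add: GL.nat_pow_pow mult.commute)
        then show ?thesis by (rule down)
      qed
      let ?E = "?R <#>\<^bsub>?L\<^esub> Q"
      have up: "(submodular_step G)\<^sup>*\<^sup>* ?E L"
        using submodular_step_of_subgroup[OF sub(2) GL.p_subgroup_tower_submodular[OF tw QL p Qp]] by simp
      have sEL: "subgroup ?E ?L"
        using GL.set_mult_subgroup[OF sR QL] R GL.normal_conj_by subgroup.mem_carrier[OF QL] by blast
      have sE: "subgroup ?E G" using incl_subgroup[OF sub(2) sEL] .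
      have "?E \<subseteq> H"
        using GL.set_mult_least[OF subgroup_incl[OF sub] 2 QH] .
      moreover have "Q \<subseteq> ?E" using GL.set_mult_incl(2)[OF sR QL] .
      ultimately have "(submodular_step G)\<^sup>*\<^sup>* Q ?E"
        using submodular_chain_restrict[OF step.IH sE] by (simp add: Int_absorb1 Int_absorb2)
      then show ?thesis using up by simp
    qed
  qed
qed

end

theorem theorem1:
  fixes G :: "('a, 'b) monoid_scheme" and Q :: "'a set" and p k :: nat
  assumes "group G" and "finite (carrier G)"
    and "subgroup Q G" and "prime p" and "card Q = p ^ k"
  shows "submodular_subgroup Q G \<longleftrightarrow> KF_subnormal U1 Q G"
proof -
  interpret fin_group G using assms(1,2) by (simp add: fin_group_def fin_group_axioms_def)
  show ?thesis
    using submodular_imp_KU1_chain KU1_chain_imp_submodular[OF _ assms(3-5)]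
    by (auto simp: submodular_iff_rtranclp[OF assms(3)] KU1_subnormal_iff_rtranclp[OF assms(3)])
qed

end
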